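(* Let $\mu$ be the standard V-monotone Gaussian measure, let $\gamma_0 = \dfrac{2}{e^{2\sqrt{3}\pi/9}-1}$, and let $\rho:\mathbb{R}\to\mathbb{R}$ be the even function (i.e. $\rho(-x)=\rho(x)$) whose values for $x\ge 0$ are $$\rho(x)=\begin{cases}\dfrac{\sqrt2}{2\pi}\, e^{\sqrt3\pi/9} & \text{for } x=0,\\[2mm] \dfrac{\operatorname{Im}\widehat F_\mu(x)}{\pi\,|\widehat F_\mu(x)|^2} & \text{for } x\in(0,\sqrt{2+\gamma_0})\setminus\{\sqrt2\},\\[2mm] \dfrac{\sqrt6}{4\pi} & \text{for } x=\sqrt2,\\[1mm] 0 & \text{for } x\ge\sqrt{2+\gamma_0},\end{cases}$$ where $\widehat F_\mu(x)=x\,T^{-1}(W(x))$. Then $\operatorname{supp}\mu=[-\sqrt{2+\gamma_0},\sqrt{2+\gamma_0}]$, and $\mu$ is absolutely continuous with respect to the Lebesgue measure on $\mathbb{R}$ with density function $\rho$.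
   Context: The measure $\mu$. Let $(C_n)_{n\ge0}$ be the Catalan numbers and define polynomials $P_n(s)$, $s\in[0,1]$, by $P_0(s)=1$ and $P_{n+1}(s)=\sum_{m=0}^{n}\Big(\int_0^s P_m(t)\,dt+2^{-m}C_m(1-s)^{m+1}\Big)P_{n-m}(s)$ for $n\ge0$. Put $m_n=P_{n/2}(1)$ if $n$ is even and $m_n=0$ if $n$ is odd. It is known that $|P_n(s)|\le C_n$ and that $(m_n)_{n\ge0}$ is the moment sequence of a (unique, compactly supported) probability measure $\mu$ on $\mathbb{R}$, called the standard V-monotone Gaussian measure. The function $W$. For $x\in(0,\infty)\setminus\{\sqrt2\}$: $W(x)=\frac12\ln\big(1+\frac{2}{x^2-2}\big)$ if $x>\sqrt2$, and $W(x)=\frac12\ln\big|1+\frac{2}{x^2-2}\big|-\frac{i\pi}{2}$ if $x\in(0,\sqrt2)$. The function $T^{-1}$. Let $u_0=\frac{1+\sqrt3 i}{2}$. For $\eta,\xi\in\mathbb{R}$ with $\xi<-\eta$ put $R=e^{-\sqrt3(\eta+\xi)}>1$ and $g(\eta,\xi)=\frac{\sqrt3 i(Re^{i\xi}-1)}{1-R^2}+u_0$. Let $\Gamma_\eta=\{g(\eta,\xi):\xi<-\eta\}$ and $\Delta=\bigcup_{-\pi<\eta<0}\Gamma_\eta$; $\Delta$ is a simply connected domain in $\mathbb{C}$ whose closure $\operatorname{Cl}\Delta$ contains $[0,\infty)$. Let $T_0:[0,\infty)\to\mathbb{R}$, $T_0(s)=\int_s^1\frac{t}{t^2-t+1}\,dt$.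 Let $T:\operatorname{Cl}\Delta\setminus\{u_0\}\to\mathbb{C}$ be the unique continuous extension of $T_0$ that is analytic on $\Delta$. The function $T$ is a bijection from $\operatorname{Cl}\Delta\setminus\{u_0\}$ onto the strip $D=\{w\in\mathbb{C}:-\pi/2\le\operatorname{Im}w\le0\}$, and $T^{-1}:D\to\operatorname{Cl}\Delta\setminus\{u_0\}$ denotes its inverse. *)

theory Defs
  imports "HOL-Probability.Probability"
begin

subsection \<open>The standard V-monotone Gaussian measure\<close>

definition catalan :: "nat \<Rightarrow> nat" where
  "catalan n = (2 * n choose n) div (n + 1)"

function vP :: "nat \<Rightarrow> real \<Rightarrow> real" where
  "vP 0 s = 1"
| "vP (Suc n) s =
     (\<Sum>m\<le>n. ((LBINT t=0..s. vP m t) + real (catalan m) / 2 ^ m * (1 - s) ^ (m + 1)) * vP (n - m) s)"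
  by pat_completeness auto
termination
  by (relation "Wellfounded.measure fst") auto

definition v_moment :: "nat \<Rightarrow> real" where
  "v_moment n = (if even n then vP (n div 2) 1 else 0)"

text \<open>Integrability of the powers is explicit because the Bochner integral of a non-integrable
  function is \<open>0\<close>. The moment sequence determines the measure and forces
  compact support, so neither property is part of the definition.\<close>

definition standard_V_monotone_gaussian :: "real measure \<Rightarrow> bool" where
  "standard_V_monotone_gaussian \<mu> \<longleftrightarrow>
     prob_space \<mu> \<and> sets \<mu> = sets borel \<and>
     (\<forall>n. integrable \<mu> (\<lambda>x. x ^ n) \<and> (\<integral>x. x ^ n \<partial>\<mu>) = v_moment n)"

definition measure_support :: "'a::topological_space measure \<Rightarrow> 'a set" where
  "measure_support \<mu> = {x. \<forall>U. open U \<and> x \<in> U \<longrightarrow> emeasure \<mu> U > 0}"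

subsection \<open>The function \<open>W\<close>\<close>

text \<open>Meaningful only for \<open>x > 0\<close> with \<open>x \<noteq> sqrt 2\<close>.\<close>

definition W_fun :: "real \<Rightarrow> complex" where
  "W_fun x = (if x > sqrt 2 then complex_of_real (1 / 2 * ln (1 + 2 / (x\<^sup>2 - 2)))
          else complex_of_real (1 / 2 * ln \<bar>1 + 2 / (x\<^sup>2 - 2)\<bar>) - \<i> * complex_of_real pi / 2)"

subsection \<open>The function \<open>T\<close> and its inverse\<close>

definition u0 :: complex where
  "u0 = (1 + complex_of_real (sqrt 3) * \<i>) / 2"

definition R_fun :: "real \<Rightarrow> real \<Rightarrow> real" where
  "R_fun \<eta> \<xi> = exp (- sqrt 3 * (\<eta> + \<xi>))"

definition g_fun :: "real \<Rightarrow> real \<Rightarrow> complex" where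
  "g_fun \<eta> \<xi> =
     complex_of_real (sqrt 3) * \<i> * (complex_of_real (R_fun \<eta> \<xi>) * exp (\<i> * complex_of_real \<xi>) - 1)
       / complex_of_real (1 - (R_fun \<eta> \<xi>)\<^sup>2) + u0"

definition Gamma_curve :: "real \<Rightarrow> complex set" where
  "Gamma_curve \<eta> = {g_fun \<eta> \<xi> |\<xi>. \<xi> < - \<eta>}"

definition Delta :: "complex set" where
  "Delta = (\<Union>\<eta>\<in>{-pi<..<0}. Gamma_curve \<eta>)"

definition T0 :: "real \<Rightarrow> real" where
  "T0 s = (LBINT t=s..1. t / (t\<^sup>2 - t + 1))"

definition T_domain :: "complex set" where
  "T_domain = closure Delta - {u0}"

text \<open>The value \<open>0\<close> off the domain is a convention that makes the extension unique as a total
  function.\<close>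

definition T_ext :: "complex \<Rightarrow> complex" where
  "T_ext = (THE f. continuous_on T_domain f \<and> f analytic_on Delta \<and>
               (\<forall>s\<ge>0. f (complex_of_real s) = complex_of_real (T0 s)) \<and>
               (\<forall>z. z \<notin> T_domain \<longrightarrow> f z = 0))"

definition T_inv :: "complex \<Rightarrow> complex" where
  "T_inv = inv_into T_domain T_ext"

subsection \<open>The density\<close>

definition gamma0 :: real where
  "gamma0 = 2 / (exp (2 * sqrt 3 * pi / 9) - 1)"

definition F_hat :: "real \<Rightarrow> complex" where
  "F_hat x = complex_of_real x * T_inv (W_fun x)"

definition rho_nonneg :: "real \<Rightarrow> real" where
  "rho_nonneg x =
     (if x = 0 then sqrt 2 / (2 * pi) * exp (sqrt 3 * pi / 9)
      else if x = sqrt 2 then sqrt 6 / (4 * pi)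
      else if x < sqrt (2 + gamma0) then Im (F_hat x) / (pi * (cmod (F_hat x))\<^sup>2)
      else 0)"

definition rho :: "real \<Rightarrow> real" where
  "rho x = rho_nonneg \<bar>x\<bar>"

end

theory Submission
  imports Defs "HOL-Complex_Analysis.Complex_Analysis"
begin

text \<open>
  Along \<open>s\<close> the generating function of the polynomials satisfies a homogeneous differential
  equation with a first integral; at \<open>s = 1\<close> it says that the generating function of the even moments
  is \<open>1 / U\<close>, where \<open>T U = - ln (1 - 2 * t) / 2\<close>.

  In the coordinate \<open>p\<close> with \<open>u = 1 / 2 - (sqrt 3 / 2) * cot p\<close> the function \<open>2 * T u\<close> becomes an
  explicit function on the upper half-plane, \<open>g = exp (2 * T u)\<close> becomes entire, and \<open>Delta\<close> becomes
  the region between two level curves of \<open>Im (2 * T)\<close> (at \<open>0\<close> and \<open>- pi\<close>), on which \<open>g\<close> is real.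
  Integrate the kernel \<open>2 / ((1 - 2 * t) * g - 1)\<close> over the horizontal segments of this region. The
  imaginary part of the derivative with respect to the height is a difference of boundary values, and
  the substitution \<open>x\<^sup>2 = 2 * g / (g - 1)\<close> turns it into \<open>rho x / (1 - t * x\<^sup>2)\<close>; at height \<open>0\<close> the
  integral contributes half a residue, which is a multiple of \<open>1 / U\<close>. Hence \<open>rho\<close> has the
  required moments, and moments that grow at most geometrically determine the measure through its
  characteristic function.
\<close>

subsection \<open>The coordinate p\<close>

text \<open>The density dictates the kernel. \<open>W x = T u\<close> means
  \<open>g = x^2 / (x^2 - 2)\<close>, so
  \<open>1 - t * x^2 = ((1 - 2 * t) * g - 1) / (g - 1)\<close>. Along an edge parametrised by the
  height, \<open>Im u / |u|^2\<close> is \<open>4 / sqrt 3\<close> divided by the derivative of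
  \<open>2 * Re T\<close>; this derivative and the factor \<open>g - 1\<close> occur in
  \<open>dx\<close> as well. All of it cancels, and up to sign and a constant only the kernel is
  left.

  Horizontal segments fit because each level curve of \<open>Im T\<close> is a graph over the
  height, so one parameter sweeps both edges, and because the kernel is real on the edges, so their
  slopes drop out of the imaginary part. The obstacle is the zero of
  \<open>(1 - 2 * t) * g - 1\<close> on the bottom side, at \<open>u = U\<close>: the integral at
  height 0 is singular. Its limit is found by splitting off a multiple of the logarithmic derivative
  of the denominator, whose integral is an exact change of argument at every positive height; the
  remainder is continuous, and real at height 0. Small \<open>t\<close> are enough, since only the
  coefficients of a power series in \<open>t\<close> have to be identified.\<close>

definition T_const :: real where "T_const = 4 * pi / (3 * sqrt 3) - ln 3"

text \<open>With \<open>u = u_of p\<close> this is \<open>(u - u0) / (u - cnj u0)\<close>: the point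
  \<open>u0\<close> lies at infinite height, and the value 1 stands for infinite \<open>u\<close>. A
  turn around \<open>u0\<close> becomes a translation by \<open>pi\<close>, so the logarithm of
  \<open>T\<close> at \<open>u0\<close> becomes linear in \<open>p\<close>.\<close>

definition exp2i :: "complex \<Rightarrow> complex" where "exp2i p = exp (2 * \<i> * p)"

definition mob :: "complex \<Rightarrow> complex" where "mob p = (1 + exp2i p) / (1 - exp2i p)"

definition u_of :: "complex \<Rightarrow> complex" where
  "u_of p = 1 / 2 + of_real (sqrt 3 / 2) * (\<i> * mob p)"

text \<open>\<open>T2 p\<close> will be \<open>2 * T (u_of p)\<close>; here \<open>u_of p = 1 / 2 - (sqrt 3 / 2) * cot p\<close>, and
  \<open>T_const\<close> makes \<open>T2\<close> vanish at \<open>p = 2 * pi / 3\<close>, where \<open>u_of p = 1\<close>.\<close>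
definition T2 :: "complex \<Rightarrow> complex" where
  "T2 p = of_real T_const + \<i> * of_real pi - (2 / of_real (sqrt 3) + 2 * \<i>) * p
    + 2 * Ln (1 - exp2i p)"

text \<open>Multiplied out instead of \<open>exp (T2 p)\<close>, so that it is entire. It vanishes
  where \<open>exp2i p = 1\<close>, in particular at the corner \<open>pi\<close>, where
  \<open>Ln 0\<close> would give a wrong value.\<close>

definition expT2 :: "complex \<Rightarrow> complex" where
  "expT2 p = exp (of_real T_const + \<i> * of_real pi - (2 / of_real (sqrt 3)
    + 2 * \<i>) * p) * (1 - exp2i p)\<^sup>2"

definition upper :: "complex set" where
  "upper = {p. 0 \<le> Im p \<and> exp2i p \<noteq> 1}"

lemma norm_exp2i: "cmod (exp2i p) = exp (- 2 * Im p)"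
  by (simp add: exp2i_def)

lemma exp2i_ne_1: "Im p > 0 \<Longrightarrow> exp2i p \<noteq> 1"
  using norm_exp2i[of p] by auto

lemma upperI: "Im p > 0 \<Longrightarrow> p \<in> upper"
  by (simp add: upper_def exp2i_ne_1)

lemma exp2i_of_real_ne_1:
  assumes "0 < a" "a < pi"
  shows "exp2i (of_real a) \<noteq> 1"
proof
  assume "exp2i (of_real a) = 1"
  then obtain n :: int where "2 * a = of_int (2 * n) * pi"
    by (auto simp: exp2i_def exp_eq_1)
  then have *: "a = of_int n * pi" by simp
  then have "0 < real_of_int n * pi" "real_of_int n * pi < 1 * pi" using assms by auto
  then have "0 < real_of_int n" "real_of_int n < 1"
    using pi_gt_zero by (simp add: zero_less_mult_iff, subst (asm) mult_less_cancel_right_pos) auto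
  then have "0 < n" "n < 1" by simp_all
  then show False by simp
qed

lemma upper_of_real: "0 < a \<Longrightarrow> a < pi \<Longrightarrow> of_real a \<in> upper"
  by (simp add: upper_def exp2i_of_real_ne_1)

text \<open>The closed unit disc meets the half-plane of real part at least 1 only in the point 1.
  Hence a single principal branch of \<open>Ln\<close> serves on all of
  \<open>upper\<close>.\<close>

lemma Re_1_minus_exp2i:
  assumes "p \<in> upper"
  shows "Re (1 - exp2i p) > 0"
proof (rule ccontr)
  assume "\<not> Re (1 - exp2i p) > 0"
  then have "Re (exp2i p) \<ge> 1" by simp
  moreover have n: "cmod (exp2i p) \<le> 1" using assms by (simp add: norm_exp2i upper_def)
  moreover have "Re (exp2i p) \<le> cmod (exp2i p)" by (rule complex_Re_le_cmod)
  ultimately have 1: "Re (exp2i p) = 1" "cmod (exp2i p) = 1" by auto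
  then have "Im (exp2i p) = 0" by (simp add: cmod_def)
  then have "exp2i p = 1" using 1 by (simp add: complex_eq_iff)
  then show False using assms by (simp add: upper_def)
qed

lemma one_minus_exp2i_slit: "p \<in> upper \<Longrightarrow> 1 - exp2i p \<notin> \<real>\<^sub>\<le>\<^sub>0"
  using Re_1_minus_exp2i[of p] by (metis complex_nonpos_Reals_iff not_less)

lemma exp_T2: "exp2i p \<noteq> 1 \<Longrightarrow> exp (T2 p) = expT2 p"
  unfolding T2_def expT2_def exp_add[of _ "2 * Ln _"] exp_double by simp

text \<open>From \<open>u - 1/2 = - (sqrt 3 / 2) * cot p\<close> the derivative of \<open>u\<close>
  is \<open>2 / sqrt 3\<close> times \<open>u^2 - u + 1\<close>, the denominator in
  \<open>T0\<close>. It cancels, and a multiple of \<open>u\<close> is left. All later slopes and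
  speeds are read off from this.\<close>

lemma has_field_derivative_T2:
  assumes "p \<in> upper"
  shows "(T2 has_field_derivative (- (4 / of_real (sqrt 3)) * u_of p)) (at p within A)"
proof -
  have ne: "1 - exp2i p \<noteq> 0" using assms by (simp add: upper_def)
  have "(T2 has_field_derivative (- (2 / of_real (sqrt 3) + 2 * \<i>) +
      2 * (- (2 * \<i> * exp2i p) / (1 - exp2i p)))) (at p within A)"
    unfolding T2_def exp2i_def
    using one_minus_exp2i_slit[OF assms] unfolding exp2i_def
    by (auto intro!: derivative_eq_intros) (simp add: field_simps)
  also have "- (2 / of_real (sqrt 3) + 2 * \<i>) + 2 * (- (2 * \<i> * exp2i p) / (1 - exp2i p)) =
      - (4 / of_real (sqrt 3)) * u_of p"
  proof -
    have r: "of_real (sqrt 3) * of_real (sqrt 3) = (3 :: complex)" by (simp flip: of_real_mult)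
    have r0: "complex_of_real (sqrt 3) \<noteq> 0" by simp
    have "2 / of_real (sqrt 3) = 2 / 3 * complex_of_real (sqrt 3)" using r r0
      by (simp add: field_simps)
    moreover have "4 / of_real (sqrt 3) = 4 / 3 * complex_of_real (sqrt 3)" using r r0
      by (simp add: field_simps)
    moreover have "exp2i p / (1 - exp2i p) = (mob p - 1) / 2" using ne
      by (simp add: mob_def field_simps)
    moreover have "- (2 * \<i> * exp2i p) / (1 - exp2i p) = - 2 * \<i> * (exp2i p / (1 - exp2i p))"
      by simp
    moreover have "complex_of_real (sqrt 3 / 2) = of_real (sqrt 3) / 2" by simp
    ultimately show ?thesis using r unfolding u_of_def by algebra
  qed
  finally show ?thesis .
qed

lemma Im_u_of: "exp2i p \<noteq> 1 \<Longrightarrow> Im (u_of p) = sqrt 3 / 2 * (1 - (cmod (exp2i p))\<^sup>2) / (cmod (1 -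
  exp2i p))\<^sup>2"
proof -
  assume "exp2i p \<noteq> 1"
  have "Im (u_of p) = sqrt 3 / 2 * Re (mob p)"
    unfolding u_of_def by simp
  also have "Re (mob p) = (1 - (cmod (exp2i p))\<^sup>2) / (cmod (1 - exp2i p))\<^sup>2"
    unfolding mob_def Re_divide cmod_power2 by (simp add: power2_eq_square algebra_simps)
  finally show ?thesis by simp
qed

lemma Im_u_of_pos: "Im p > 0 \<Longrightarrow> Im (u_of p) > 0"
proof -
  assume "Im p > 0"
  then have "cmod (exp2i p) < 1" "exp2i p \<noteq> 1" by (auto simp: norm_exp2i exp2i_ne_1)
  then have "(cmod (exp2i p))\<^sup>2 < 1" by (simp add: abs_square_less_1)
  then show ?thesis using \<open>exp2i p \<noteq> 1\<close> by (subst Im_u_of) (auto intro!: divide_pos_pos)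
qed

lemma u_of_of_real:
  assumes "0 < a" "a < pi"
  shows "u_of (of_real a) = of_real (1 / 2 - sqrt 3 / 2 * cot a)"
proof -
  have s: "sin a \<noteq> 0" using assms sin_gt_zero by force
  have ne: "1 - exp2i (of_real a) \<noteq> 0" using exp2i_of_real_ne_1[OF assms] by simp
  have e: "exp2i (of_real a) = (cis a)\<^sup>2"
    by (simp add: exp2i_def cis_conv_exp mult_ac flip: exp_double)
  have "(1 + exp2i (of_real a)) = 2 * of_real (cos a) * cis a"
    unfolding e using sin_cos_squared_add[of a]
    by (simp add: complex_eq_iff power2_eq_square algebra_simps)
  moreover have "(1 - exp2i (of_real a)) = - 2 * \<i> * of_real (sin a) * cis a"
    unfolding e using sin_cos_squared_add[of a]
    by (simp add: complex_eq_iff power2_eq_square algebra_simps)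
  ultimately have "mob (of_real a) = - (of_real (cos a) / (\<i> * of_real (sin a)))"
    using s by (simp add: mob_def)
  also have "\<dots> = \<i> * of_real (cot a)"
    using s by (simp add: cot_def divide_simps)
  finally show ?thesis
    unfolding u_of_def by simp
qed

lemma T2_of_real:
  assumes "0 < a" "a < pi"
  shows "T2 (of_real a) = of_real (T_const - 2 * a / sqrt 3 + 2 * ln (2 * sin a))"
proof -
  have s: "sin a > 0" using assms sin_gt_zero by force
  have "1 - exp2i (of_real a) = of_real (2 * sin a) * cis (a - pi / 2)"
    unfolding exp2i_def cis_minus_pi_half cis_divide[symmetric]
    apply (simp add: complex_eq_iff Re_exp Im_exp sin_double cos_double)
    apply (use sin_cos_squared_add[of a] in \<open>simp add: power2_eq_square algebra_simps\<close>)
    done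
  also have "\<dots> = exp (of_real (ln (2 * sin a)) + \<i> * of_real (a - pi / 2))"
    using s by (simp add: exp_add exp_of_real cis_conv_exp)
  finally have "Ln (1 - exp2i (of_real a)) = of_real (ln (2 * sin a)) + \<i> * of_real (a - pi / 2)"
    using assms by (simp add: Ln_exp)
  then show ?thesis
    unfolding T2_def by (simp add: complex_eq_iff)
qed

text \<open>\<open>sin_arg \<sigma> b\<close> is the argument of \<open>sin (\<sigma> + \<i> * b)\<close>, continued from \<open>0 < \<sigma> < pi\<close>.\<close>
definition sin_arg :: "real \<Rightarrow> real \<Rightarrow> real" where
  "sin_arg \<sigma> b = pi / 2 - \<sigma> + Im (Ln (1 - exp2i (Complex \<sigma> b)))"

text \<open>The level curve \<open>Im T2 = - 2 * m\<close>, parametrised by the height \<open>b\<close>.\<close>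
definition curve_re :: "real \<Rightarrow> real \<Rightarrow> real" where
  "curve_re m b = sin_arg (b / sqrt 3 - m) b"

definition curve :: "real \<Rightarrow> real \<Rightarrow> complex" where
  "curve m b = Complex (curve_re m b) b"

section \<open>The level curves of the imaginary part\<close>

lemma Re_curve [simp]: "Re (curve m b) = curve_re m b" and Im_curve [simp]: "Im (curve m b) = b"
  by (simp_all add: curve_def)

lemma Im_T2: "Im (T2 (Complex a b)) = 2 * sin_arg a b - 2 * b / sqrt 3"
  by (simp add: T2_def sin_arg_def complex_eq_iff)

lemma Re_T2: "p \<in> upper \<Longrightarrow>
    Re (T2 p) = T_const - 2 * Re p / sqrt 3 + 2 * Im p + 2 * ln (cmod (1 - exp2i p))"
  by (simp add: T2_def upper_def)

lemma abs_Arg_lt: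
  assumes "p \<in> upper"
  shows "\<bar>Im (Ln (1 - exp2i p))\<bar> < pi / 2"
  using Re_1_minus_exp2i[OF assms] by (rule Re_Ln_pos_lt_imp)

lemma one_minus_square_ne_0: "cmod r < 1 \<Longrightarrow> 1 - r * r \<noteq> 0"
proof
  assume "cmod r < 1" "1 - r * r = 0"
  then have "cmod r * cmod r = 1" by (metis eq_iff_diff_eq_0 norm_mult norm_one)
  then show False using \<open>cmod r < 1\<close> mult_strict_mono[of "cmod r" 1 "cmod r" 1] by simp
qed

text \<open>The matrix of the map has trace zero and determinant \<open>1 - r * r\<close>, and a
  Moebius map of trace zero is its own inverse.\<close>

lemma moebius_involution:
  fixes r s :: complex
  assumes "s - r \<noteq> 0" "1 - r * r \<noteq> 0"
  shows "(r * ((r * s - 1) / (s - r)) - 1) / ((r * s - 1) / (s - r) - r) = s"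
proof -
  have "r * ((r * s - 1) / (s - r)) - 1 = (- (1 - r * r) * s) / (s - r)"
    using assms by (simp add: field_simps)
  moreover have "(r * s - 1) / (s - r) - r = - (1 - r * r) / (s - r)"
    using assms by (simp add: field_simps)
  moreover have "(- k * s / d) / (- k / d) = s" if "k \<noteq> 0" "d \<noteq> 0" for k d :: complex
    using that by simp
  ultimately show ?thesis using assms by (simp only:)
qed

text \<open>Twice the argument of \<open>z\<close> is the argument of \<open>z / cnj z\<close>, and
  conjugation inverts points of the unit circle. So doubling the argument yields a Moebius function
  of \<open>exp2i \<sigma>\<close>.\<close>

lemma exp_sin_arg:
  assumes "b > 0"
  shows "exp2i (of_real (sin_arg \<sigma> b)) = (of_real (exp (- 2 * b)) * exp2i (of_real \<sigma>) - 1) /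
            (exp2i (of_real \<sigma>) - of_real (exp (- 2 * b)))"
proof -
  let ?z = "1 - exp2i (Complex \<sigma> b)" and ?r = "complex_of_real (exp (- 2 * b))" and ?s =
    "exp2i (of_real \<sigma>)"
  have up: "Complex \<sigma> b \<in> upper" using assms by (intro upperI) simp
  then have ne: "?z \<noteq> 0" by (auto simp: upper_def)
  have "2 * \<i> * Complex \<sigma> b = of_real (- 2 * b) + 2 * \<i> * of_real \<sigma>"
    by (simp add: complex_eq_iff)
  then have es: "exp2i (Complex \<sigma> b) = ?r * ?s"
    unfolding exp2i_def by (simp only: exp_add exp_of_real)
  have cs: "cnj ?s * ?s = 1"
    by (simp add: exp2i_def exp_cnj flip: exp_add)
  have ne2: "?s - ?r \<noteq> 0"
  proof
    assume "?s - ?r = 0"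
    then have "cmod ?s = cmod ?r" by simp
    then show False using assms by (simp add: norm_exp2i)
  qed
  have "exp2i (of_real (Im (Ln ?z))) = ?z / cnj ?z"
  proof -
    have "exp2i (of_real (Im (Ln ?z))) = exp (Ln ?z - cnj (Ln ?z))"
      unfolding exp2i_def by (rule arg_cong[of _ _ exp]) (simp add: complex_eq_iff)
    also have "\<dots> = ?z / cnj ?z"
      using ne by (simp only: exp_diff exp_cnj[symmetric] exp_Ln not_False_eq_True)
    finally show ?thesis .
  qed
  moreover have "exp2i (of_real (sin_arg \<sigma> b)) = - (1 / ?s) * exp2i (of_real (Im (Ln ?z)))"
    unfolding sin_arg_def exp2i_def
    by (simp add: algebra_simps exp_add exp_diff exp_minus inverse_eq_divide)
  moreover have "cnj ?z = (?s - ?r) / ?s"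
  proof -
    have s0: "?s \<noteq> 0" by (simp add: exp2i_def)
    then have "cnj ?s = 1 / ?s" using cs by (simp add: field_simps)
    then show ?thesis using s0 unfolding es by (simp add: field_simps)
  qed
  ultimately have "exp2i (of_real (sin_arg \<sigma> b)) = - ((1 - ?r * ?s) / (?s - ?r))"
    unfolding es by (simp add: exp2i_def)
  also have "\<dots> = (?r * ?s - 1) / (?s - ?r)"
    by (metis minus_diff_eq minus_divide_left)
  finally show ?thesis .
qed

text \<open>The multiplier of \<open>exp_sin_arg\<close> is a Moebius involution, so \<open>sin_arg (sin_arg \<sigma> b) b\<close> and
  \<open>\<sigma>\<close> agree modulo \<open>pi\<close>; both arguments of \<open>Ln\<close> lie in the right half-plane, which leaves no
  other multiple.\<close>
lemma sin_arg_sin_arg: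
  assumes "b > 0"
  shows "sin_arg (sin_arg \<sigma> b) b = \<sigma>"
proof -
  let ?r = "complex_of_real (exp (- 2 * b))" and ?s = "exp2i (of_real \<sigma>)"
  have n: "cmod ?s = 1" "cmod ?r < 1" using assms by (auto simp: norm_exp2i)
  have ne: "?s - ?r \<noteq> 0" using n by auto
  have r1: "1 - ?r * ?r \<noteq> 0" using n(2) by (rule one_minus_square_ne_0)
  have "exp2i (of_real (sin_arg (sin_arg \<sigma> b) b)) = ?s"
    unfolding exp_sin_arg[OF assms] by (rule moebius_involution[OF ne r1])
  then obtain k :: int where "2 * sin_arg (sin_arg \<sigma> b) b = 2 * \<sigma> + of_int (2 * k) * pi"
    unfolding exp2i_def exp_eq by (auto simp: complex_eq_iff)
  then have k: "sin_arg (sin_arg \<sigma> b) b - \<sigma> = of_int k * pi" by simp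
  have up: "Complex a b \<in> upper" for a using assms by (intro upperI) simp
  have "\<bar>sin_arg (sin_arg \<sigma> b) b - \<sigma>\<bar> < pi"
    using abs_Arg_lt[OF up, of \<sigma>] abs_Arg_lt[OF up, of "sin_arg \<sigma> b"]
    unfolding sin_arg_def[of "sin_arg \<sigma> b"] unfolding sin_arg_def[of \<sigma>] by linarith
  then have "\<bar>real_of_int k\<bar> * pi < 1 * pi" unfolding k by (simp add: abs_mult)
  then have "\<bar>real_of_int k\<bar> < 1" using pi_gt_zero by (subst (asm) mult_less_cancel_right_pos) auto
  then have "real_of_int \<bar>k\<bar> < 1" by simp
  then have "k = 0" by linarith
  then show ?thesis using k by simp
qed

text \<open>The level equation at height \<open>b\<close> reads
  \<open>sin_arg a b = b / sqrt 3 - m\<close>. Since \<open>sin_arg\<close> is an involution in its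
  first argument, it is solved explicitly for \<open>a\<close>, and the solution is
  \<open>curve_re m b\<close>.\<close>

lemma Im_T2_curve: "b > 0 \<Longrightarrow> Im (T2 (curve m b)) = - 2 * m"
  unfolding curve_def Im_T2 curve_re_def by (simp add: sin_arg_sin_arg)

lemma curve_upper: "b > 0 \<Longrightarrow> curve m b \<in> upper"
  by (intro upperI) simp

lemma Im_T2_deriv:
  assumes "b > 0"
  shows "((\<lambda>a. Im (T2 (Complex a b))) has_field_derivative
     (- (4 / sqrt 3) * Im (u_of (Complex a b)))) (at a)"
proof -
  have "(T2 has_field_derivative (- (4 / of_real (sqrt 3)) * u_of (Complex a b))) (at (of_real a
    + \<i> * b))"
    using has_field_derivative_T2[of "Complex a b" UNIV] assms
    by (simp add: upperI Complex_eq)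
  then have "((\<lambda>z. T2 (z + \<i> * b)) has_field_derivative (- (4 / of_real (sqrt 3)) * u_of (Complex a
    b))) (at (of_real a))"
    by (subst (asm) DERIV_shift) 
  then have "((\<lambda>a. T2 (of_real a + \<i> * b)) has_vector_derivative (- (4 / of_real (sqrt 3)) * u_of
    (Complex a b))) (at a)"
    by (rule has_vector_derivative_real_field)
  from has_field_derivative_Im[OF this]
  show ?thesis
    by (simp add: Complex_eq has_real_derivative_iff_has_vector_derivative)
qed

text \<open>On a horizontal line in the open half-plane \<open>u_of\<close> has positive imaginary
  part, which fixes the sign of the derivative. So each level curve meets each height once, and
  comparing levels amounts to comparing real parts.\<close>

lemma Im_T2_strict_anti:
  assumes "b > 0" "a < a'"
  shows "Im (T2 (Complex a' b)) < Im (T2 (Complex a b))"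
  using assms(2)
proof (rule DERIV_neg_imp_decreasing)
  fix x
  show "\<exists>y. DERIV (\<lambda>a. Im (T2 (Complex a b))) x :> y \<and> y < 0"
    using Im_T2_deriv[OF assms(1), of x] Im_u_of_pos[of "Complex x b"] assms(1)
    by (intro exI conjI) auto
qed

lemma Im_T2_less_iff:
  assumes "b > 0"
  shows "Im (T2 (Complex a' b)) < Im (T2 (Complex a b)) \<longleftrightarrow> a < a'"
  by (metis Im_T2_strict_anti[OF assms] linorder_less_linear order_less_asym)

lemma eq_curve_iff:
  assumes "Im p > 0"
  shows "p = curve m (Im p) \<longleftrightarrow> Im (T2 p) = - 2 * m"
proof
  assume "Im (T2 p) = - 2 * m"
  then have "Im (T2 (Complex (Re p) (Im p))) = Im (T2 (Complex (curve_re m (Im p)) (Im p)))"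
    using Im_T2_curve[OF assms, of m] by (simp add: curve_def)
  then have "Re p = curve_re m (Im p)"
    by (metis Im_T2_strict_anti[OF assms] linorder_less_linear order_less_irrefl)
  then show "p = curve m (Im p)" by (simp add: complex_eq_iff)
qed (metis Im_T2_curve assms)

lemma curve_re_mono:
  assumes "b > 0" "m < m'"
  shows "curve_re m b < curve_re m' b"
proof -
  have "Im (T2 (Complex (curve_re m' b) b)) < Im (T2 (Complex (curve_re m b) b))"
    using Im_T2_curve[OF assms(1), of m] Im_T2_curve[OF assms(1), of m'] assms(2)
      by (simp add: curve_def)
  then show ?thesis using assms(1) by (simp add: Im_T2_less_iff)
qed

text \<open>The explicit formula is used only for differentiability. The value of the slope comes
  from differentiating the constant \<open>Im T2\<close> along the curve, which is a linear equation
  for it.\<close>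

lemma curve_re_deriv:
  assumes "b > 0"
  shows "((\<lambda>b. curve_re m b) has_field_derivative (- Re (u_of (curve m b)) / Im (u_of (curve m
    b)))) (at b)"
proof -
  \<comment> \<open>The argument of \<open>exp2i\<close> moves on a line of direction
    \<open>1 / sqrt 3 + i\<close>, so the expression is the restriction to real \<open>b\<close> of
    a holomorphic function.\<close>
  define c :: complex where "c = 2 * \<i> * (of_real (1 / sqrt 3) + \<i>)"
  have cx: "Complex (b / sqrt 3 - m) b = of_real b * (of_real (1 / sqrt 3) + \<i>) - of_real m" for b
    by (simp add: complex_eq_iff)
  let ?f = "\<lambda>z. Ln (1 - exp (c * z - 2 * \<i> * of_real m))"
  have exp2i: "exp2i (Complex (b / sqrt 3 - m) b) = exp (c * of_real b - 2 * \<i> * of_real m)" for b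
    unfolding cx exp2i_def c_def by (simp add: algebra_simps)
  have slit: "1 - exp (c * of_real b - 2 * \<i> * of_real m) \<notin> \<real>\<^sub>\<le>\<^sub>0"
    unfolding exp2i[symmetric] using assms by (intro one_minus_exp2i_slit upperI) simp
  have "\<exists>D. (?f has_field_derivative D) (at (of_real b))"
    using slit by (intro exI) (auto intro!: derivative_eq_intros)
  then obtain D where "(?f has_field_derivative D) (at (of_real b))" by blast
  then have "((\<lambda>b. ?f (of_real b)) has_vector_derivative D) (at b)"
    by (rule has_vector_derivative_real_field)
  from has_field_derivative_Im[OF this]
  have D: "((\<lambda>b. Im (?f (of_real b))) has_field_derivative Im D) (at b)"
    by (simp add: has_real_derivative_iff_has_vector_derivative)
  have "\<exists>d. ((\<lambda>b. curve_re m b) has_field_derivative d) (at b)"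
    unfolding curve_re_def sin_arg_def exp2i
    by (rule exI) (rule derivative_eq_intros D refl | simp)+
  then obtain d where d: "((\<lambda>b. curve_re m b) has_field_derivative d) (at b)" by blast
  have "((\<lambda>b. curve m b) has_vector_derivative (of_real d + \<i>)) (at b)"
    using d unfolding has_vector_derivative_complex_iff curve_def
    by simp
  from field_vector_diff_chain_at[OF this has_field_derivative_T2[OF curve_upper[OF assms]]]
  have "((\<lambda>b. T2 (curve m b)) has_vector_derivative (of_real d
    + \<i>) * (- (4 / of_real (sqrt 3)) * u_of (curve m b))) (at b)"
    by (simp add: o_def)
  from has_field_derivative_Im[OF this]
  have "((\<lambda>b. Im (T2 (curve m b))) has_field_derivative
      Im ((of_real d + \<i>) * (- (4 / of_real (sqrt 3)) * u_of (curve m b)))) (at b)"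
    by (simp add: has_real_derivative_iff_has_vector_derivative)
  moreover have "((\<lambda>b. Im (T2 (curve m b))) has_field_derivative 0) (at b)"
  proof (rule has_field_derivative_transform_within_open[of "\<lambda>_. - 2 * m" _ _ "{0<..}"])
  qed (use assms in \<open>auto simp: Im_T2_curve\<close>)
  ultimately have "Im ((of_real d + \<i>) * (- (4 / of_real (sqrt 3)) * u_of (curve m b))) = 0"
    by (rule DERIV_unique)
  moreover have "(- (4 / of_real (sqrt 3)) * u_of (curve m b))
    = of_real (- 4 / sqrt 3) * u_of (curve m b)" by simp
  ultimately have "d * Im (u_of (curve m b)) + Re (u_of (curve m b)) = 0"
    by (simp only: mult.left_commute[of _ "of_real _"]) (simp add: field_simps)
  then have "d = - Re (u_of (curve m b)) / Im (u_of (curve m b))"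
    using Im_u_of_pos[of "curve m b"] assms by (simp add: field_simps)
  then show ?thesis using d by simp
qed

text \<open>The two values at \<open>0\<close> are the limits: there \<open>u_of\<close> is \<open>0\<close> and infinite, respectively.\<close>
definition edgeL :: "real \<Rightarrow> real" where "edgeL b = (if b = 0 then pi / 3 else curve_re 0 b)"
definition edgeR :: "real \<Rightarrow> real" where "edgeR b = (if b = 0 then pi else curve_re (pi / 2) b)"

lemma isCont_curve_re: "b > 0 \<Longrightarrow> isCont (curve_re m) b"
  using DERIV_isCont[OF curve_re_deriv] .

lemma Im_Ln_scale: "r > 0 \<Longrightarrow> z \<noteq> 0 \<Longrightarrow> Im (Ln (z / of_real r)) = Im (Ln z)"
  unfolding divide_inverse of_real_inverse[symmetric] mult.commute[of z]
  using Ln_times_of_real[of "inverse r" z] by (simp add: Ln_of_real flip: of_real_inverse)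

text \<open>Here \<open>1 - exp (c * b)\<close> tends to 0 and its argument has no direct limit.
  Dividing by \<open>b > 0\<close> leaves the argument unchanged, and the quotient tends to
  \<open>- c\<close>, of argument \<open>- pi / 6\<close>; this gives
  \<open>pi / 2 - pi / 6\<close>.\<close>

lemma tendsto_curve_re_0: "(curve_re 0 \<longlongrightarrow> pi / 3) (at_right 0)"
proof -
  define c :: complex where "c = 2 * \<i> * (of_real (1 / sqrt 3) + \<i>)"
  have exp2i: "exp2i (Complex (b / sqrt 3) b) = exp (c * of_real b)" for b
  proof -
    have "2 * \<i> * Complex (b / sqrt 3) b = c * of_real b"
      unfolding c_def by (simp add: complex_eq_iff)
    then show ?thesis unfolding exp2i_def by simp
  qed
  have "((\<lambda>z. exp (c * z)) has_field_derivative c) (at 0)"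
    by (auto intro!: derivative_eq_intros)
  then have "((\<lambda>z. (exp (c * z) - 1) / z) \<longlongrightarrow> c) (at 0)"
    by (simp add: has_field_derivative_iff)
  then have l: "((\<lambda>b. (exp (c * of_real b) - 1) / of_real b) \<longlongrightarrow> c) (at_right (0::real))"
    by (rule filterlim_compose)
      (auto simp: filterlim_at eventually_at_filter intro!: tendsto_eq_intros)
  have s3: "sqrt 3 * sqrt 3 = 3" by simp
  have "- c = of_real (4 / sqrt 3) * cis (- (pi / 6))"
    unfolding c_def by (simp add: complex_eq_iff cos_30 sin_30 field_simps)
  also have "\<dots> = exp (of_real (ln (4 / sqrt 3)) + \<i> * of_real (- (pi / 6)))"
    by (simp only: exp_add exp_of_real cis_conv_exp) simp
  finally have mc: "- c = exp (of_real (ln (4 / sqrt 3)) + \<i> * of_real (- (pi / 6)))" .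
  have L: "Ln (- c) = of_real (ln (4 / sqrt 3)) + \<i> * of_real (- (pi / 6))"
    unfolding mc using pi_gt_zero by (intro Ln_exp) (simp_all del: pi_gt_zero add: field_simps) 
  have slit: "- c \<notin> \<real>\<^sub>\<le>\<^sub>0"
    unfolding c_def by (simp add: complex_nonpos_Reals_iff)
  have "((\<lambda>b. - ((exp (c * of_real b) - 1) / of_real b)) \<longlongrightarrow> - c) (at_right (0::real))"
    using l by (intro tendsto_intros)
  then have "((\<lambda>b. (1 - exp (c * of_real b)) / of_real b) \<longlongrightarrow> - c) (at_right (0::real))"
    unfolding minus_divide_left minus_diff_eq .
  from tendsto_Im[OF tendsto_Ln[OF this slit]]
  have lim: "((\<lambda>b. Im (Ln ((1 - exp (c * of_real b)) / of_real b))) \<longlongrightarrow> - (pi / 6)) (at_right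
    (0::real))"
    unfolding L by simp
  have "((\<lambda>b. pi / 2 - b / sqrt 3 + Im (Ln ((1 - exp (c * of_real b)) / of_real b)))
     \<longlongrightarrow> pi / 2 - 0 / sqrt 3 + - (pi / 6)) (at_right (0::real))"
    by (intro tendsto_intros lim) auto
  moreover have "eventually (\<lambda>b. pi / 2 - b / sqrt 3 + Im (Ln ((1 - exp (c * of_real b)) / of_real
    b)) = curve_re 0 b)
     (at_right (0::real))"
    unfolding eventually_at_filter
  proof (rule always_eventually, intro allI impI)
    fix b :: real assume "b \<noteq> 0" "b \<in> {0<..}"
    then have b: "b > 0" by simp
    then have "exp2i (Complex (b / sqrt 3) b) \<noteq> 1" by (intro exp2i_ne_1) simp
    then show "pi / 2 - b / sqrt 3 + Im (Ln ((1 - exp (c * of_real b)) / of_real b)) = curve_re 0 b"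
      using b by (simp add: curve_re_def sin_arg_def exp2i[symmetric] Im_Ln_scale)
  qed
  ultimately show ?thesis by (simp add: tendsto_cong)
qed

text \<open>No rescaling this time: \<open>1 - exp2i\<close> tends to 2, and the two terms
  \<open>pi / 2\<close> add up.\<close>

lemma tendsto_curve_re_pi_half: "(curve_re (pi / 2) \<longlongrightarrow> pi) (at_right 0)"
proof -
  have e: "exp2i (Complex (0 / sqrt 3 - pi / 2) 0) = - 1"
  proof -
    have "2 * \<i> * Complex (0 / sqrt 3 - pi / 2) 0 = - (\<i> * of_real pi)"
      by (simp add: complex_eq_iff)
    then show ?thesis unfolding exp2i_def by (simp only: exp_minus exp_pi_i') simp
  qed
  have "((\<lambda>b. Complex (b / sqrt 3 - pi / 2) b) \<longlongrightarrow> Complex (0 / sqrt 3 - pi / 2) 0) (at_right 0)"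
    by (intro tendsto_intros) simp_all
  then have "((\<lambda>b. exp2i (Complex (b / sqrt 3 - pi / 2) b)) \<longlongrightarrow> - 1) (at_right 0)"
    unfolding e[symmetric] unfolding exp2i_def by (intro tendsto_intros) simp_all
  then have "((\<lambda>b. curve_re (pi / 2) b) \<longlongrightarrow> pi / 2 - (0 / sqrt 3 - pi / 2)
    + Im (Ln (1 - (- 1)))) (at_right 0)"
    unfolding curve_re_def sin_arg_def by (intro tendsto_intros) auto
  moreover have "Im (Ln (of_real 2)) = 0" by (rule Im_Ln_of_real) simp
  ultimately show ?thesis by simp
qed

lemma continuous_on_fill_0:
  fixes f :: "real \<Rightarrow> real"
  assumes "(f \<longlongrightarrow> c) (at_right 0)" and cont: "\<And>b. b > 0 \<Longrightarrow> isCont f b"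
  shows "continuous_on {0..} (\<lambda>b. if b = 0 then c else f b)"
  unfolding continuous_on_eq_continuous_within
proof
  let ?g = "\<lambda>b. if b = 0 then c else f b"
  fix x :: real assume x: "x \<in> {0..}"
  show "continuous (at x within {0..}) ?g"
  proof (cases "x = 0")
    case True
    have "(?g \<longlongrightarrow> c) (at_right 0)"
      by (rule Lim_transform_eventually[OF assms(1)]) (auto simp: eventually_at_filter)
    then show ?thesis
      unfolding True continuous_within by (simp add: at_within_Ici_at_right)
  next
    case False
    then have "x > 0" using x by simp
    have "eventually (\<lambda>b. b > 0) (nhds x)"
      using \<open>x > 0\<close> by (intro eventually_nhds_in_open[of "{0<..}", simplified]) auto
    then have "eventually (\<lambda>b. ?g b = f b) (nhds x)" by eventually_elim simp
    then have "isCont ?g x \<longleftrightarrow> isCont f x" by (rule isCont_cong)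
    then show ?thesis using cont[OF \<open>x > 0\<close>] by (simp add: continuous_at_imp_continuous_at_within)
  qed
qed

lemma continuous_on_edgeL: "continuous_on {0..} edgeL"
  unfolding edgeL_def[abs_def] by (rule continuous_on_fill_0[OF tendsto_curve_re_0 isCont_curve_re])

lemma continuous_on_edgeR: "continuous_on {0..} edgeR"
  unfolding edgeR_def[abs_def] by (rule continuous_on_fill_0[OF tendsto_curve_re_pi_half
    isCont_curve_re])

lemma edgeL_less_edgeR: "b \<ge> 0 \<Longrightarrow> edgeL b < edgeR b"
  using curve_re_mono[of b 0 "pi / 2"] by (auto simp: edgeL_def edgeR_def)

text \<open>The logarithm in \<open>sin_arg\<close> is taken in the right half-plane, so its
  imaginary part stays below \<open>pi / 2\<close> in absolute value. The width bound later makes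
  the segment integrals vanish at infinite height.\<close>

lemma edgeR_bound:
  assumes "b \<ge> 0"
  shows "edgeR b \<le> 3 * pi / 2 - b / sqrt 3" "edgeR b - edgeL b \<le> 3 * pi / 2"
    "edgeL b \<ge> - b / sqrt 3"
proof -
  have *: "curve_re (pi / 2) b < 3 * pi / 2 - b / sqrt 3" "curve_re 0 b > - b / sqrt 3" if "b > 0"
    using abs_Arg_lt[of "Complex (b / sqrt 3 - pi / 2) b"] abs_Arg_lt[of "Complex (b / sqrt 3) b"]
      that
    by (auto simp: curve_re_def sin_arg_def upperI)
  show "edgeR b \<le> 3 * pi / 2 - b / sqrt 3" "edgeR b - edgeL b \<le> 3 * pi / 2" "edgeL b \<ge> - b / sqrt 3"
    using * assms pi_gt_zero by (force simp: edgeR_def edgeL_def)+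
qed

section \<open>The region between the two edges\<close>

definition region :: "complex set" where
  "region = {p. Im p > 0 \<and> - pi < Im (T2 p) \<and> Im (T2 p) < 0}"

text \<open>The deleted corner is where \<open>u_of\<close> is infinite. As \<open>u0\<close> sits
  at infinite height, \<open>u_of\<close> can carry exactly this set onto
  \<open>T_domain\<close>.\<close>

definition cregion :: "complex set" where
  "cregion = {p. Im p \<ge> 0 \<and> edgeL (Im p) \<le> Re p \<and> Re p \<le> edgeR (Im p)} - {of_real pi}"

lemma Im_T2_cmp:
  assumes "Im p > 0"
  shows "Im (T2 p) < - 2 * m \<longleftrightarrow> curve_re m (Im p) < Re p"
    and "Im (T2 p) > - 2 * m \<longleftrightarrow> Re p < curve_re m (Im p)"
proof -
  have p: "p = Complex (Re p) (Im p)" by (simp add: complex_eq_iff)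
  note * = Im_T2_less_iff[OF assms, of "Re p" "curve_re m (Im p)"]
    Im_T2_less_iff[OF assms, of "curve_re m (Im p)" "Re p"] Im_T2_curve[OF assms, of m, unfolded
      curve_def]
  show "Im (T2 p) < - 2 * m \<longleftrightarrow> curve_re m (Im p) < Re p"
    using *(1,3) p by metis
  show "Im (T2 p) > - 2 * m \<longleftrightarrow> Re p < curve_re m (Im p)"
    using *(2,3) p by metis
qed

lemma region_iff: "p \<in> region \<longleftrightarrow> Im p > 0 \<and> edgeL (Im p) < Re p \<and> Re p < edgeR (Im p)"
  using Im_T2_cmp[of p 0] Im_T2_cmp[of p "pi / 2"] by (auto simp: region_def edgeL_def edgeR_def)

lemma region_subset_cregion: "region \<subseteq> cregion"
  unfolding cregion_def using region_iff by force

lemma cregion_pos_iff: "Im p > 0 \<Longrightarrow> p \<in> cregion \<longleftrightarrow> - pi \<le> Im (T2 p) \<and> Im (T2 p) \<le> 0"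
  using Im_T2_cmp[of p 0] Im_T2_cmp[of p "pi / 2"] by (auto simp: cregion_def edgeL_def edgeR_def)

lemma cregion_real: 
  assumes "p \<in> cregion" "Im p = 0" shows "p = of_real (Re p)" "pi / 3 \<le> Re p" "Re p < pi"
proof -
  show p: "p = of_real (Re p)" using assms by (simp add: complex_eq_iff)
  show "pi / 3 \<le> Re p" using assms by (simp add: cregion_def edgeL_def)
  have "Re p \<noteq> pi" using p assms(1) unfolding cregion_def by force
  then show "Re p < pi" using assms by (simp add: cregion_def edgeR_def)
qed

lemma of_real_in_cregion: "pi / 3 \<le> a \<Longrightarrow> a < pi \<Longrightarrow> of_real a \<in> cregion"
  by (auto simp: cregion_def edgeL_def edgeR_def)

lemma cregion_upper: "p \<in> cregion \<Longrightarrow> p \<in> upper"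
proof (cases "Im p > 0")
  case False
  assume "p \<in> cregion"
  moreover have "Im p = 0" using False \<open>p \<in> cregion\<close> by (auto simp: cregion_def)
  ultimately show ?thesis
    using cregion_real[of p] upper_of_real[of "Re p"] pi_gt_zero
      by (metis divide_pos_pos less_le_trans zero_less_numeral)
qed (simp add: upperI)

lemma Im_T2_cregion: 
  assumes "p \<in> cregion" shows "- pi \<le> Im (T2 p) \<and> Im (T2 p) \<le> 0"
proof (cases "Im p > 0")
  case False
  have "Im p = 0" using False \<open>p \<in> cregion\<close> by (auto simp: cregion_def)
  note r = cregion_real[OF assms this]
  have "Im (T2 p) = 0"
    using T2_of_real[of "Re p"] r(2,3) pi_gt_zero by (subst r(1)) simp
  then show ?thesis by simp
qed (use cregion_pos_iff assms in blast)

lemma curve_in_cregion: "b > 0 \<Longrightarrow> 0 \<le> m \<Longrightarrow> m \<le> pi / 2 \<Longrightarrow> curve m b \<in> cregion"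
  by (simp add: cregion_pos_iff Im_T2_curve)

lemma curve_in_region: "b > 0 \<Longrightarrow> 0 < m \<Longrightarrow> m < pi / 2 \<Longrightarrow> curve m b \<in> region"
  by (simp add: region_def Im_T2_curve)

lemma cregion_cases:
  assumes "p \<in> cregion"
  obtains (real) a where "pi / 3 \<le> a" "a < pi" "p = of_real a"
        | (pos) m b where "b > 0" "0 \<le> m" "m \<le> pi / 2" "p = curve m b"
proof (cases "Im p > 0")
  case True
  define m where "m = - Im (T2 p) / 2"
  have "p = curve m (Im p)" using eq_curve_iff[OF True, of m] by (simp add: m_def)
  then show ?thesis using pos[of "Im p" m] True assms cregion_pos_iff[OF True] by (simp add: m_def)
next
  case False
  have "Im p = 0" using False \<open>p \<in> cregion\<close> by (auto simp: cregion_def)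
  then show ?thesis using cregion_real[OF assms] real by blast
qed

lemma region_cases:
  assumes "p \<in> region"
  obtains m b where "b > 0" "0 < m" "m < pi / 2" "p = curve m b"
proof -
  have "Im p > 0" using assms by (simp add: region_def)
  define m where "m = - Im (T2 p) / 2"
  have "p = curve m (Im p)" using eq_curve_iff[OF \<open>Im p > 0\<close>, of m] by (simp add: m_def)
  then show ?thesis using that[of "Im p" m] \<open>Im p > 0\<close> assms by (simp add: m_def region_def)
qed

section \<open>The real part along the level curves\<close>

definition curve_T :: "real \<Rightarrow> real \<Rightarrow> real" where "curve_T m b = Re (T2 (curve m b))"

lemma T2_curve: "b > 0 \<Longrightarrow> T2 (curve m b) = Complex (curve_T m b) (- 2 * m)"
  by (simp add: complex_eq_iff curve_T_def Im_T2_curve)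

text \<open>The factor \<open>|u|^2 / Im u\<close> is the reciprocal of the expression in
  \<open>rho_nonneg\<close>. This is how the density becomes the reciprocal of a speed along the
  edges.\<close>

definition curve_T' :: "real \<Rightarrow> real \<Rightarrow> real" where
  "curve_T' m b = 4 / sqrt 3 * (cmod (u_of (curve m b)))\<^sup>2 / Im (u_of (curve m b))"

lemma curve_deriv:
  assumes "b > 0"
  shows "((\<lambda>b. curve m b) has_vector_derivative
    (of_real (- Re (u_of (curve m b)) / Im (u_of (curve m b))) + \<i>)) (at b)"
  using curve_re_deriv[OF assms] unfolding has_vector_derivative_complex_iff curve_def by simp

lemma curve_T_deriv:
  assumes "b > 0"
  shows "((\<lambda>b. curve_T m b) has_field_derivative curve_T' m b) (at b)"
proof -
  from field_vector_diff_chain_at[OF curve_deriv[OF assms] has_field_derivative_T2[OF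
    curve_upper[OF assms]]]
  have "((\<lambda>b. T2 (curve m b)) has_vector_derivative
    (of_real (- Re (u_of (curve m b)) / Im (u_of (curve m b))) + \<i>) * (- (4 / of_real (sqrt 3)) *
      u_of (curve m b))) (at b)"
    by (simp add: o_def)
  from has_field_derivative_Re[OF this]
  have "(curve_T m has_field_derivative
    Re ((of_real (- Re (u_of (curve m b)) / Im (u_of (curve m b))) + \<i>) * (- (4 / of_real (sqrt 3))
      * u_of (curve m b)))) (at b)"
    by (simp add: curve_T_def[abs_def])
  also have "Re ((of_real (- Re (u_of (curve m b)) / Im (u_of (curve m b)))
    + \<i>) * (- (4 / of_real (sqrt 3)) * u_of (curve m b)))
     = curve_T' m b"
  proof -
    have k: "(- (4 / of_real (sqrt 3)) * u_of (curve m b)) = of_real (- 4 / sqrt 3) * u_of (curve m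
      b)" by simp
    have "Im (u_of (curve m b)) > 0" using Im_u_of_pos[of "curve m b"] assms by simp
    then show ?thesis
      unfolding k curve_T'_def cmod_power2
      by (simp only: mult.left_commute[of _ "of_real _"]) (simp add: divide_simps, simp add:
        power2_eq_square algebra_simps)
  qed
  finally show ?thesis .
qed

lemma curve_T'_pos: "b > 0 \<Longrightarrow> curve_T' m b > 0"
  using Im_u_of_pos[of "curve m b"] unfolding curve_T'_def
  by (auto intro!: divide_pos_pos mult_pos_pos)

lemma curve_T_strict_mono:
  assumes "0 < b" "b < b'" shows "curve_T m b < curve_T m b'"
  using assms(2)
proof (rule DERIV_pos_imp_increasing)
  fix x assume "b \<le> x"
  then show "\<exists>y. DERIV (curve_T m) x :> y \<and> y > 0"
    using curve_T_deriv[of x m] curve_T'_pos[of x m] assms(1)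
      by (intro exI[of _ "curve_T' m x"]) auto
qed

text \<open>Growth that is uniform across the region: \<open>Re p\<close> is bounded above, and from
  height 1 on \<open>|exp2i p|\<close> is at most 1/2, so the logarithm costs at most
  \<open>ln 2\<close> and the linear term wins.\<close>

lemma Re_T2_lower:
  assumes "p \<in> cregion" "Im p \<ge> 1"
  shows "Re (T2 p) \<ge> T_const - 3 * pi / sqrt 3 - 2 * ln 2 + 2 * Im p"
proof -
  have b: "Im p > 0" using assms by simp
  have "Re p \<le> 3 * pi / 2 - Im p / sqrt 3"
    using assms edgeR_bound(1)[of "Im p"] by (simp add: cregion_def)
  also have "\<dots> \<le> 3 * pi / 2" using b by simp
  finally have "2 * Re p / sqrt 3 \<le> 2 * (3 * pi / 2) / sqrt 3"
    by (intro divide_right_mono mult_left_mono) auto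
  moreover have "ln (1 / 2) \<le> ln (cmod (1 - exp2i p))"
  proof -
    have "1 - cmod (exp2i p) \<le> cmod (1 - exp2i p)" by (metis norm_one norm_triangle_ineq2)
    moreover have "cmod (exp2i p) \<le> 1 / 2"
    proof -
      have "exp (2::real) \<ge> 2" using exp_ge_add_one_self[of 2] by simp
      then have "exp (- 2) \<le> (1 / 2 :: real)" by (simp add: exp_minus field_simps)
      moreover have "cmod (exp2i p) \<le> exp (- 2)" using assms by (simp add: norm_exp2i)
      ultimately show ?thesis by linarith
    qed
    ultimately have "1 / 2 \<le> cmod (1 - exp2i p)" by linarith
    then show ?thesis by (subst ln_le_cancel_iff) auto
  qed
  ultimately show ?thesis
    unfolding Re_T2[OF upperI[OF b]] by (simp add: ln_div)
qed

lemma curve_T_at_top: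
  assumes "0 \<le> m" "m \<le> pi / 2"
  shows "filterlim (curve_T m) at_top at_top"
proof (rule filterlim_at_top_mono)
  show "filterlim (\<lambda>b. T_const - 3 * pi / sqrt 3 - 2 * ln 2 + 2 * b) at_top at_top"
    by real_asymp
  show "eventually (\<lambda>b. T_const - 3 * pi / sqrt 3 - 2 * ln 2 + 2 * b \<le> curve_T m b) at_top"
    using eventually_ge_at_top[of 1]
    by eventually_elim (use Re_T2_lower[OF curve_in_cregion] assms in \<open>force simp: curve_T_def\<close>)
qed

lemma tendsto_Complex_at_right:
  "(curve_re m \<longlongrightarrow> a) (at_right 0) \<Longrightarrow> (curve m \<longlongrightarrow> of_real a) (at_right 0)"
  unfolding curve_def Complex_eq by (auto intro!: tendsto_eq_intros)

lemma isCont_T2: "p \<in> upper \<Longrightarrow> isCont T2 p"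
  using DERIV_isCont[OF has_field_derivative_T2] .

text \<open>At \<open>p = pi / 3\<close> the value of \<open>u_of\<close> is 0. This number is the
  exponent in \<open>gamma0\<close>, hence it locates the end of the support.\<close>

lemma T2_pi_third: "T2 (of_real (pi / 3)) = of_real (2 * sqrt 3 * pi / 9)"
proof -
  have "ln (2 * sin (pi / 3)) = ln 3 / 2" by (simp add: sin_60 ln_sqrt)
  moreover have "4 * pi / (3 * sqrt 3) - 2 * (pi / 3) / sqrt 3 = 2 * sqrt 3 * pi / 9"
    by (simp add: field_simps)
  ultimately show ?thesis
    by (subst T2_of_real, simp, simp, intro arg_cong[of _ _ of_real], unfold T_const_def) linarith
qed

lemma curve_T_0_at_0: "(curve_T 0 \<longlongrightarrow> 2 * sqrt 3 * pi / 9) (at_right 0)"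
proof -
  have "(curve 0 \<longlongrightarrow> of_real (pi / 3)) (at_right 0)"
    using tendsto_Complex_at_right[OF tendsto_curve_re_0] .
  moreover have "of_real (pi / 3) \<in> upper" by (rule upper_of_real) auto
  ultimately have "((\<lambda>b. T2 (curve 0 b)) \<longlongrightarrow> of_real (2 * sqrt 3 * pi / 9)) (at_right 0)"
    unfolding T2_pi_third[symmetric] by (intro isCont_tendsto_compose[OF isCont_T2])
  from tendsto_Re[OF this] show ?thesis by (simp add: curve_T_def[abs_def])
qed

text \<open>Towards the corner \<open>pi\<close> every term of \<open>Re T2\<close> stays bounded
  except the logarithm of \<open>|1 - exp2i p|\<close>, which tends to minus infinity. In the
  variable \<open>x\<close> this is the approach to 0.\<close>

lemma curve_T_pi_half_at_0: "filterlim (curve_T (pi / 2)) at_bot (at_right 0)"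
proof -
  have p: "(curve (pi / 2) \<longlongrightarrow> of_real pi) (at_right 0)"
    using tendsto_Complex_at_right[OF tendsto_curve_re_pi_half] .
  have e: "exp2i (of_real pi) = 1" by (simp add: exp2i_def mult_ac exp_two_pi_i)
  have "((\<lambda>b. exp2i (curve (pi / 2) b)) \<longlongrightarrow> exp2i (of_real pi)) (at_right 0)"
    using p unfolding exp2i_def by (intro tendsto_intros)
  then have "((\<lambda>b. cmod (1 - exp2i (curve (pi / 2) b))) \<longlongrightarrow> cmod (1 - 1)) (at_right 0)"
    unfolding e by (intro tendsto_intros)
  moreover have "eventually (\<lambda>b. cmod (1 - exp2i (curve (pi / 2) b)) > 0) (at_right 0)"
    using exp2i_ne_1 by (auto simp: eventually_at_filter)
  ultimately have "filterlim (\<lambda>b. cmod (1 - exp2i (curve (pi / 2) b))) (at_right 0) (at_right 0)"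
    by (simp add: filterlim_at)
  then have l: "filterlim (\<lambda>b. ln (cmod (1 - exp2i (curve (pi / 2) b)))) at_bot (at_right 0)"
    by (rule filterlim_compose[OF ln_at_0])
  have "((\<lambda>b. T_const - 2 * curve_re (pi / 2) b / sqrt 3 + 2 * b) \<longlongrightarrow> T_const - 2 * pi / sqrt 3
    + 2 * 0) (at_right 0)"
    by (intro tendsto_intros tendsto_curve_re_pi_half) auto
  then have l2: "((\<lambda>b. - (T_const - 2 * curve_re (pi / 2) b / sqrt 3
    + 2 * b)) \<longlongrightarrow> - (T_const - 2 * pi / sqrt 3 + 2 * 0)) (at_right 0)"
    by (rule tendsto_minus)
  have "filterlim (\<lambda>b. - (ln (cmod (1 - exp2i (curve (pi / 2) b))))) at_top (at_right 0)"
    using l by (simp add: filterlim_uminus_at_top)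
  then have "filterlim (\<lambda>b. 2 * - (ln (cmod (1 - exp2i (curve (pi / 2) b))))) at_top (at_right 0)"
    by (intro filterlim_tendsto_pos_mult_at_top[OF tendsto_const]) auto
  from filterlim_tendsto_add_at_top[OF l2 this]
  have "filterlim (\<lambda>b. - (T_const - 2 * curve_re (pi / 2) b / sqrt 3 + 2 * b
    + 2 * ln (cmod (1 - exp2i (curve (pi / 2) b))))) at_top (at_right 0)"
    by (simp add: algebra_simps)
  then have "filterlim (\<lambda>b. T_const - 2 * curve_re (pi / 2) b / sqrt 3 + 2 * b
    + 2 * ln (cmod (1 - exp2i (curve (pi / 2) b)))) at_bot (at_right 0)"
    unfolding filterlim_uminus_at_bot .
  moreover have "eventually (\<lambda>b. curve_T (pi / 2) b = 
      T_const - 2 * curve_re (pi / 2) b / sqrt 3 + 2 * b + 2 * ln (cmod (1 - exp2i (curve (pi / 2)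
        b)))) (at_right 0)"
    by (auto simp: eventually_at_filter curve_T_def Re_T2 curve_upper)
  ultimately show ?thesis by (simp add: filterlim_cong)
qed

lemma curve_T_0_lower: 
  assumes "b > 0" shows "curve_T 0 b > 2 * sqrt 3 * pi / 9"
proof -
  \<comment> \<open>The limit at 0 yields only a weak inequality; taking it at \<open>b / 2\<close>
    leaves room for a strict one at \<open>b\<close>.\<close>
  have "curve_T 0 (b / 2) \<ge> 2 * sqrt 3 * pi / 9"
  proof (rule tendsto_upperbound[OF curve_T_0_at_0])
    show "\<forall>\<^sub>F x in at_right 0. curve_T 0 x \<le> curve_T 0 (b / 2)"
      unfolding eventually_at_right_field
      by (rule exI[of _ "b / 2"]) (use assms curve_T_strict_mono[of _ "b / 2" 0] in \<open>auto intro: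
        less_imp_le\<close>)
  qed simp
  moreover have "curve_T 0 (b / 2) < curve_T 0 b" using assms by (intro curve_T_strict_mono) auto
  ultimately show ?thesis by simp
qed

lemma curve_T_surj:
  assumes "0 \<le> m" "m \<le> pi / 2" and low: "eventually (\<lambda>b. curve_T m b \<le> y) (at_right 0)"
  obtains b where "b > 0" "curve_T m b = y"
proof -
  obtain b1 where b1: "b1 > 0" "curve_T m b1 \<le> y"
    using low unfolding eventually_at_right_field by (metis dense)
  have "eventually (\<lambda>b. curve_T m b \<ge> y \<and> b \<ge> b1) at_top"
    using filterlim_at_top[THEN iffD1, OF curve_T_at_top[OF assms(1,2)]] eventually_ge_at_top[of b1]
    by (auto intro: eventually_conj)
  then obtain b2 where b2: "curve_T m b2 \<ge> y" "b2 \<ge> b1" using eventually_happens by fastforce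
  have "\<exists>b. b1 \<le> b \<and> b \<le> b2 \<and> curve_T m b = y"
  proof (rule IVT)
    show "\<forall>x. b1 \<le> x \<and> x \<le> b2 \<longrightarrow> isCont (curve_T m) x"
      using b1(1) by (auto intro!: DERIV_isCont[OF curve_T_deriv])
  qed (use b1 b2 in simp_all)
  then obtain b where "b \<ge> b1" "curve_T m b = y" by blast
  then show ?thesis using that[of b] b1(1) by simp
qed

lemma curve_T_0_surj:
  assumes "y > 2 * sqrt 3 * pi / 9"
  obtains b where "b > 0" "curve_T 0 b = y"
proof (rule curve_T_surj[of 0 y])
  show "eventually (\<lambda>b. curve_T 0 b \<le> y) (at_right 0)"
    using order_tendstoD(2)[OF curve_T_0_at_0 assms] by eventually_elim simp
qed auto

lemma curve_T_pi_half_surj: obtains b where "b > 0" "curve_T (pi / 2) b = y"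
proof (rule curve_T_surj[of "pi / 2" y])
  show "eventually (\<lambda>b. curve_T (pi / 2) b \<le> y) (at_right 0)"
    using curve_T_pi_half_at_0 by (simp add: filterlim_at_bot)
qed auto

section \<open>Injectivity of u_of on the closed region\<close>

lemma exp2i_mob:
  assumes "exp2i p \<noteq> 1"
  shows "exp2i p = (mob p - 1) / (mob p + 1)" "mob p \<noteq> 1" "mob p \<noteq> - 1"
proof -
  have ne: "1 - exp2i p \<noteq> 0" "exp2i p \<noteq> 0" using assms by (auto simp: exp2i_def)
  have 1: "mob p - 1 = 2 * exp2i p / (1 - exp2i p)" and 2: "mob p + 1 = 2 / (1 - exp2i p)"
    using ne by (simp_all add: mob_def field_simps)
  show "exp2i p = (mob p - 1) / (mob p + 1)" unfolding 1 2 using ne by simp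
  show "mob p \<noteq> 1" using 1 ne by auto
  show "mob p \<noteq> - 1" using 2 ne by (metis add.left_inverse divide_eq_0_iff zero_neq_numeral)
qed

lemma mob_u_of: "mob p = (u_of p - 1 / 2) / (of_real (sqrt 3 / 2) * \<i>)"
  by (simp add: u_of_def)

lemma u_of_ne_u0: "exp2i p \<noteq> 1 \<Longrightarrow> u_of p \<noteq> u0"
  using exp2i_mob(2)[of p] unfolding mob_u_of by (auto simp: u0_def add_divide_distrib)

lemma holomorphic_exp2i: "exp2i holomorphic_on A"
  unfolding exp2i_def[abs_def] by (intro holomorphic_intros)

lemma holomorphic_u_of: "(\<And>p. p \<in> A \<Longrightarrow> exp2i p \<noteq> 1) \<Longrightarrow> u_of holomorphic_on A"
  unfolding u_of_def[abs_def] mob_def by (intro holomorphic_intros holomorphic_exp2i) auto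

lemma continuous_on_u_of: "A \<subseteq> upper \<Longrightarrow> continuous_on A u_of"
  by (intro holomorphic_on_imp_continuous_on holomorphic_u_of) (auto simp: upper_def)

lemma continuous_on_T2: "A \<subseteq> upper \<Longrightarrow> continuous_on A T2"
  by (intro continuous_at_imp_continuous_on ballI isCont_T2) auto

text \<open>The monodromy of \<open>2 * T\<close> around \<open>u0\<close>.\<close>

lemma T2_shift: "T2 (p + of_int k * of_real pi) = T2 p - of_int k * Complex (2 * pi / sqrt 3) (2 *
  pi)"
proof -
  have e: "exp2i (p + of_int k * of_real pi) = exp2i p"
    unfolding exp2i_def exp_eq by (intro exI[of _ k]) (simp add: algebra_simps)
  show ?thesis unfolding T2_def e
    by (simp add: complex_eq_iff algebra_simps add_divide_distrib)
qed

lemma exp2i_eq_imp: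
  assumes "exp2i p = exp2i p'"
  obtains k :: int where "p' = p + of_int k * of_real pi"
proof -
  obtain k :: int where "2 * \<i> * p' = 2 * \<i> * p + of_int (2 * k) * of_real pi * \<i>"
    using assms[symmetric] unfolding exp2i_def exp_eq by auto
  then have "2 * \<i> * p' = 2 * \<i> * (p + of_int k * of_real pi)" by (simp add: algebra_simps)
  then have "p' = p + of_int k * of_real pi" by (subst (asm) mult_cancel_left) auto
  then show ?thesis using that by blast
qed

text \<open>Points with equal \<open>u_of\<close> differ by \<open>k * pi\<close>, and then
  \<open>Im T2\<close> differs by \<open>2 * k * pi\<close>, whereas it varies by at most
  \<open>pi\<close> on the region. At height 0 the levels agree, but there the segment is shorter
  than \<open>pi\<close>.\<close>

lemma inj_on_u_of: "inj_on u_of cregion"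
proof (rule inj_onI)
  fix p p' assume p: "p \<in> cregion" "p' \<in> cregion" "u_of p = u_of p'"
  have ne: "exp2i p \<noteq> 1" "exp2i p' \<noteq> 1" using p cregion_upper by (auto simp: upper_def)
  have "mob p = mob p'" using p(3) by (simp add: mob_u_of)
  then have "exp2i p = exp2i p'" using exp2i_mob(1) ne by metis
  then obtain k :: int where k: "p' = p + of_int k * of_real pi" by (rule exp2i_eq_imp)
  have Im: "Im p' = Im p" unfolding k by simp
  have "k = 0"
  proof (cases "Im p > 0")
    case True
    have "Im (T2 p') = Im (T2 p) - 2 * of_int k * pi" unfolding k T2_shift by simp
    then have "\<bar>2 * of_int k * pi\<bar> \<le> pi"
      using Im_T2_cregion[OF p(1)] Im_T2_cregion[OF p(2)] by linarith
    then have "2 * \<bar>real_of_int k\<bar> * pi \<le> 1 * pi" by (simp add: abs_mult)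
    then have "2 * \<bar>real_of_int k\<bar> \<le> 1" using pi_gt_zero
      by (subst (asm) mult_le_cancel_right_pos) auto
    then show ?thesis by linarith
  next
    case False
    then have "Im p = 0" using p(1) by (auto simp: cregion_def)
    then have "pi / 3 \<le> Re p" "Re p < pi" "pi / 3 \<le> Re p'" "Re p' < pi"
      using cregion_real[OF p(1)] cregion_real[OF p(2)] Im by auto
    moreover have "Re p' = Re p + of_int k * pi" unfolding k by simp
    ultimately have "\<bar>of_int k * pi\<bar> < pi" using pi_gt_zero by linarith
    then have "\<bar>of_int k\<bar> * pi < 1 * pi" by (simp add: abs_mult)
    then have "\<bar>real_of_int k\<bar> < 1" using pi_gt_zero
      by (subst (asm) mult_less_cancel_right_pos) auto
    then show ?thesis by linarith
  qed
  then show "p = p'" using k by simp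
qed

section \<open>The real axis\<close>

definition cot_arg :: "real \<Rightarrow> real" where "cot_arg s = pi / 2 + arctan ((2 * s - 1) / sqrt 3)"

text \<open>The primitive of \<open>s / (s^2 - s + 1)\<close> that vanishes at 1, with the
  arctangent hidden in \<open>cot_arg\<close>, the point of the bottom line over \<open>s\<close>.
  So \<open>T0\<close> is \<open>- T_prim\<close>, and the comparison with \<open>T2\<close> needs
  only a logarithm of a sine.\<close>

definition T_prim :: "real \<Rightarrow> real" where
  "T_prim s = ln (s\<^sup>2 - s + 1) / 2 + (cot_arg s - 2 * pi / 3) / sqrt 3"

lemma quad_pos: "(s::real)\<^sup>2 - s + 1 > 0"
proof -
  have "s\<^sup>2 - s + 1 = (s - 1 / 2)\<^sup>2 + 3 / 4" by (simp add: power2_eq_square algebra_simps)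
  then show ?thesis by (simp add: add_nonneg_pos)
qed

lemma cot_arg_bounds: "0 < cot_arg s" "cot_arg s < pi"
  using arctan_lbound[of "(2 * s - 1) / sqrt 3"] arctan_ubound[of "(2 * s - 1) / sqrt 3"]
  by (auto simp: cot_arg_def)

lemma arctan_inv_sqrt3: "arctan (1 / sqrt 3) = pi / 6"
  using arctan_tan[of "pi / 6"] by (simp add: tan_30)

lemma cot_arg_ge: "s \<ge> 0 \<Longrightarrow> cot_arg s \<ge> pi / 3"
proof -
  assume "s \<ge> 0"
  then have "arctan ((2 * s - 1) / sqrt 3) \<ge> arctan (- (1 / sqrt 3))"
    by (intro arctan_monotone') (simp add: divide_right_mono field_simps)
  then show ?thesis unfolding arctan_minus arctan_inv_sqrt3 cot_arg_def by simp
qed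

lemma cot_cot_arg: "cot (cot_arg s) = - (2 * s - 1) / sqrt 3"
proof -
  have "cot (cot_arg s) = - tan (arctan ((2 * s - 1) / sqrt 3))"
    unfolding cot_arg_def cot_def tan_def by (simp add: cos_add sin_add)
  then show ?thesis by (simp only: tan_arctan minus_divide_left)
qed

lemma u_of_cot_arg: "u_of (of_real (cot_arg s)) = of_real s"
  unfolding u_of_of_real[OF cot_arg_bounds] cot_cot_arg by (simp add: field_simps)

lemma T2_cot_arg: "T2 (of_real (cot_arg s)) = of_real (- 2 * T_prim s)"
proof -
  let ?x = "(2 * s - 1) / sqrt 3"
  have q: "1 + ?x\<^sup>2 = 4 / 3 * (s\<^sup>2 - s + 1)"
    by (simp add: power_divide power2_eq_square field_simps)
  have "sin (cot_arg s) = 1 / sqrt (4 / 3 * (s\<^sup>2 - s + 1))"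
    unfolding cot_arg_def sin_add by (simp only: cos_arctan q) simp
  then have "ln (2 * sin (cot_arg s)) = ln (2 / sqrt (4 / 3 * (s\<^sup>2 - s + 1)))" by simp
  also have "\<dots> = ln 2 - (ln (4 / 3) + ln (s\<^sup>2 - s + 1)) / 2"
  proof -
    have "4 / 3 * (s\<^sup>2 - s + 1) > 0" using quad_pos[of s] by simp
    moreover have "ln (4 / 3 * (s\<^sup>2 - s + 1)) = ln (4 / 3) + ln (s\<^sup>2 - s + 1)"
      using quad_pos[of s] by (subst ln_mult_pos) auto
    moreover have "ln (2 / sqrt x) = ln 2 - ln x / 2" if "x > 0" for x :: real
      using that by (simp add: ln_div ln_sqrt)
    ultimately show ?thesis by metis
  qed
  also have "ln (4 / 3 :: real) = 2 * ln 2 - ln 3"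
    using ln_realpow[of 2 2] by (simp add: ln_div)
  finally have "ln (2 * sin (cot_arg s)) = ln 3 / 2 - ln (s\<^sup>2 - s + 1) / 2"
    by (simp add: field_simps)
  then show ?thesis
    by (subst T2_of_real[OF cot_arg_bounds], intro arg_cong[of _ _ of_real], simp add: T_const_def
      T_prim_def)
       (simp add: field_simps)
qed

lemma T_prim_deriv: "(T_prim has_field_derivative (s / (s\<^sup>2 - s + 1))) (at s)"
proof -
  have q: "1 + ((2 * s - 1) / sqrt 3)\<^sup>2 = 4 / 3 * (s\<^sup>2 - s + 1)"
    by (simp add: power_divide power2_eq_square field_simps)
  have n: "s\<^sup>2 - s + 1 \<noteq> 0" using quad_pos[of s] by simp
  have "((\<lambda>s. s\<^sup>2 - s + 1) has_field_derivative (2 * s - 1)) (at s)"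
    by (auto intro!: derivative_eq_intros)
  from DERIV_chain2[OF DERIV_ln_divide[OF quad_pos] this]
  have 1: "((\<lambda>s. ln (s\<^sup>2 - s + 1)) has_field_derivative (2 * s - 1) / (s\<^sup>2 - s + 1)) (at s)" by simp
  have "((\<lambda>s. 2 * s - 1) has_field_derivative 2) (at s)"
    by (auto intro!: derivative_eq_intros)
  then have "((\<lambda>s. (2 * s - 1) / sqrt 3) has_field_derivative (2 / sqrt 3)) (at s)"
    by (rule DERIV_cdivide)
  from DERIV_chain2[OF DERIV_arctan this]
  have 2: "((\<lambda>s. arctan ((2 * s - 1) / sqrt 3)) has_field_derivative
      (inverse (1 + ((2 * s - 1) / sqrt 3)\<^sup>2) * (2 / sqrt 3))) (at s)" .
  have "(T_prim has_field_derivative ((2 * s - 1) / (s\<^sup>2 - s + 1) / 2 +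
      (0 + (inverse (1 + ((2 * s - 1) / sqrt 3)\<^sup>2) * (2 / sqrt 3)) - 0) / sqrt 3)) (at s)"
    unfolding T_prim_def[abs_def] cot_arg_def
    by (intro DERIV_add DERIV_diff DERIV_cdivide 1 2 DERIV_const)
  also have "(0 + (inverse (1 + ((2 * s - 1) / sqrt 3)\<^sup>2) * (2 / sqrt 3)) - 0) / sqrt 3
    = (2 / sqrt 3) / (1 + ((2 * s - 1) / sqrt 3)\<^sup>2) / sqrt 3" by (simp add: divide_inverse)
  also have "(2 * s - 1) / (s\<^sup>2 - s + 1) / 2 + (2 / sqrt 3) / (1
    + ((2 * s - 1) / sqrt 3)\<^sup>2) / sqrt 3
      = s / (s\<^sup>2 - s + 1)"
  proof -
    have "2 / sqrt 3 / y / sqrt 3 = 2 / (sqrt 3 * sqrt 3) / y" for y :: real by simp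
    then have "2 / sqrt 3 / (4 / 3 * x) / sqrt 3 = 2 / 3 / (4 / 3 * x)" for x :: real
      by (simp only: real_sqrt_mult_self abs_numeral)
    also have "2 / 3 / (4 / 3 * x) = 1 / x / 2" for x :: real by simp
    finally have "2 / sqrt 3 / (4 / 3 * x) / sqrt 3 = 1 / x / 2" for x :: real .
    moreover have "(2 * s - 1) / y / 2 + 1 / y / 2 = s / y" for y
      by (simp add: diff_divide_distrib)
    ultimately show ?thesis by (simp only: q)
  qed
  finally show ?thesis .
qed

lemma T_prim_1: "T_prim 1 = 0"
  by (simp add: T_prim_def cot_arg_def arctan_inv_sqrt3)

lemma T0_T_prim: "T0 s = - T_prim s"
proof -
  have "T0 s = T_prim 1 - T_prim s"
    unfolding T0_def one_ereal_def
  proof (rule interval_integral_FTC_finite)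
    show "continuous_on {min s 1..max s 1} (\<lambda>t. t / (t\<^sup>2 - t + 1))"
      using quad_pos by (intro continuous_intros) (metis less_irrefl)
    show "(T_prim has_vector_derivative x / (x\<^sup>2 - x + 1)) (at x within {min s 1..max s 1})" for x
      using T_prim_deriv[of x] has_field_derivative_at_within
      by (auto simp: has_real_derivative_iff_has_vector_derivative[symmetric])
  qed
  then show ?thesis by (simp add: T_prim_1)
qed

text \<open>The given curves are the level curves in other letters: \<open>R\<close> is
  \<open>exp (2 * b)\<close>, and with \<open>m = - \<eta> / 2\<close> the argument
  \<open>b / sqrt 3 - m\<close> of \<open>sin_arg\<close> in \<open>curve_re\<close> is
  \<open>- \<xi> / 2\<close>. The condition \<open>\<xi> < - \<eta>\<close> says
  \<open>b > 0\<close>.\<close>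

lemma g_fun_eq:
  assumes "\<xi> < - \<eta>"
  shows "g_fun \<eta> \<xi> = u_of (curve (- \<eta> / 2) (- (sqrt 3 / 2) * (\<eta> + \<xi>)))"
proof -
  define b where "b = - (sqrt 3 / 2) * (\<eta> + \<xi>)"
  have b: "b > 0" using assms unfolding b_def by (intro mult_neg_neg) auto
  define r where "r = complex_of_real (exp (- 2 * b))"
  define s where "s = exp2i (of_real (- \<xi> / 2))"
  have s_ne: "s \<noteq> 0" by (simp add: s_def exp2i_def)
  have r_ne: "r \<noteq> 0" by (simp add: r_def)
  have n: "cmod r < 1" "cmod s = 1" using b by (auto simp: r_def s_def norm_exp2i)
  have sr: "s - r \<noteq> 0" using n by auto
  have r1: "1 - r * r \<noteq> 0" using n(1) by (rule one_minus_square_ne_0)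
  have "sin_arg (- \<xi> / 2) b = curve_re (- \<eta> / 2) b"
    unfolding curve_re_def b_def by (rule arg_cong[of _ _ "\<lambda>x. sin_arg x _"]) (simp add:
      field_simps)
  then have 1: "exp2i (of_real (curve_re (- \<eta> / 2) b)) = (r * s - 1) / (s - r)"
    using exp_sin_arg[OF b, of "- \<xi> / 2"] by (simp add: r_def s_def)
  have "2 * \<i> * curve (- \<eta> / 2) b = of_real (- 2 * b) + 2 * \<i> * of_real (curve_re (- \<eta> / 2) b)"
    by (simp add: complex_eq_iff)
  then have 2: "exp2i (curve (- \<eta> / 2) b) = r * ((r * s - 1) / (s - r))"
    unfolding exp2i_def[of "curve _ _"] exp_add r_def 1[symmetric, unfolded r_def] exp2i_def[of
      "of_real _"] 
    by (simp only: exp_add exp_of_real)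
  have 3: "mob (curve (- \<eta> / 2) b) = (1 + r * r - 2 * r / s) / (1 - r * r)"
  proof -
    have "1 + r * ((r * s - 1) / (s - r)) = (s * (1 + r * r) - 2 * r) / (s - r)"
      using sr by (simp add: field_simps)
    moreover have "1 - r * ((r * s - 1) / (s - r)) = s * (1 - r * r) / (s - r)"
      using sr by (simp add: field_simps)
    moreover have "x / (s - r) / (y / (s - r)) = x / y" for x y using sr by simp
    ultimately have "mob (curve (- \<eta> / 2) b) = (s * (1 + r * r) - 2 * r) / (s * (1 - r * r))"
      unfolding mob_def 2 by (simp only:)
    also have "s * (1 + r * r) - 2 * r = s * (1 + r * r - 2 * r / s)"
      using s_ne by (simp add: field_simps)
    finally show ?thesis using s_ne by (simp only: mult_divide_mult_cancel_left not_False_eq_True)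
  qed
  have R: "complex_of_real (R_fun \<eta> \<xi>) = 1 / r"
    unfolding R_fun_def r_def b_def by (simp add: exp_minus field_simps)
  have e: "exp (\<i> * of_real \<xi>) = 1 / s"
    unfolding s_def exp2i_def by (simp add: exp_minus field_simps)
  have "g_fun \<eta> \<xi> = of_real (sqrt 3) * \<i> * (1 / r * (1 / s) - 1) / (1 - (1 / r)\<^sup>2) + u0"
    unfolding g_fun_def e of_real_diff of_real_power R by simp
  also have "of_real (sqrt 3) * \<i> * (1 / r * (1 / s) - 1) / (1 - (1 / r)\<^sup>2) =
     of_real (sqrt 3) * \<i> * ((r * r - r / s) / (1 - r * r))"
  proof -
    have "1 - (1 / r)\<^sup>2 = - (1 - r * r) / (r * r)" using r_ne
      by (simp add: field_simps power2_eq_square)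
    moreover have "1 / r * (1 / s) - 1 = - (r * r - r / s) / (r * r)"
      using r_ne s_ne by (simp add: field_simps)
    moreover have "- x / y / (- z / y) = x / z" if "y \<noteq> 0" for x y z :: complex using that by simp
    ultimately show ?thesis using r_ne
      by (simp only: times_divide_eq_right[symmetric] mult_eq_0_iff simp_thms not_False_eq_True)
  qed
  also have "\<dots> + u0 = u_of (curve (- \<eta> / 2) b)"
  proof -
    have "(1 + r * r - 2 * r / s) / (1 - r * r) = 2 * ((r * r - r / s) / (1 - r * r)) + 1"
      using r1 by (simp add: field_simps)
    then show ?thesis unfolding u_of_def 3 u0_def by (simp add: field_simps)
  qed
  finally show ?thesis unfolding b_def .
qed

lemma Delta_eq: "Delta = u_of ` region"
proof
  show "Delta \<subseteq> u_of ` region"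
  proof
    fix z assume "z \<in> Delta"
    then obtain \<eta> \<xi> where *: "- pi < \<eta>" "\<eta> < 0" "\<xi> < - \<eta>" "z = g_fun \<eta> \<xi>"
      by (auto simp: Delta_def Gamma_curve_def)
    moreover have "- (sqrt 3 / 2) * (\<eta> + \<xi>) > 0" using * by (intro mult_neg_neg) auto
    ultimately show "z \<in> u_of ` region" by (auto simp: g_fun_eq intro!: imageI curve_in_region)
  qed
  show "u_of ` region \<subseteq> Delta"
  proof safe
    fix p assume "p \<in> region"
    then obtain m b where mb: "b > 0" "0 < m" "m < pi / 2" "p = curve m b" by (rule region_cases)
    define \<eta> \<xi> where "\<eta> = - 2 * m" and "\<xi> = - \<eta> - 2 / sqrt 3 * b"
    have x: "\<xi> < - \<eta>" "- pi < \<eta>" "\<eta> < 0" using mb by (auto simp: \<xi>_def \<eta>_def)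
    have "u_of p = g_fun \<eta> \<xi>"
      unfolding g_fun_eq[OF x(1)] mb by (simp add: \<xi>_def \<eta>_def)
    then show "u_of p \<in> Delta" using x by (auto simp: Delta_def Gamma_curve_def)
  qed
qed

subsection \<open>The inverse of T\<close>

text \<open>Straightens the region to a half-strip. The same chart serves connectedness, closure and
  compactness here, and later the integration over segments of varying length with fixed
  limits.\<close>

definition seg_pt :: "real \<Rightarrow> real \<Rightarrow> complex" where
  "seg_pt v b = Complex (edgeL b + v * (edgeR b - edgeL b)) b"

lemma Im_seg_pt [simp]: "Im (seg_pt v b) = b" by (simp add: seg_pt_def)

lemma continuous_on_seg_pt: "continuous_on (UNIV \<times> {0..}) (\<lambda>(v, b). seg_pt v b)"
  unfolding seg_pt_def Complex_eq split_beta
  by (intro continuous_intros continuous_on_compose2[OF continuous_on_edgeL]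
    continuous_on_compose2[OF continuous_on_edgeR]) auto

lemma seg_pt_in_region: "0 < b \<Longrightarrow> 0 < v \<Longrightarrow> v < 1 \<Longrightarrow> seg_pt v b \<in> region"
proof -
  assume *: "0 < b" "0 < v" "v < 1"
  then have "v * (edgeR b - edgeL b) < 1 * (edgeR b - edgeL b)" "0 < v * (edgeR b - edgeL b)"
    using edgeL_less_edgeR[of b] by (intro mult_strict_right_mono mult_pos_pos; simp)+
  then show ?thesis using * unfolding region_iff seg_pt_def by simp
qed

lemma band_eq: "b \<ge> 0 \<Longrightarrow> edgeL b \<le> a \<Longrightarrow> a \<le> edgeR b \<Longrightarrow>
  \<exists>v\<in>{0..1}. Complex a b = seg_pt v b"
  using edgeL_less_edgeR[of b]
  by (intro bexI[of _ "(a - edgeL b) / (edgeR b - edgeL b)"]) (auto simp: seg_pt_def complex_eq_iff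
    divide_simps)

lemma seg_pt_in_band:
  assumes "b \<ge> 0" "0 \<le> v" "v \<le> 1"
  shows "edgeL b \<le> Re (seg_pt v b)" "Re (seg_pt v b) \<le> edgeR b"
proof -
  have "v * (edgeR b - edgeL b) \<le> 1 * (edgeR b - edgeL b)" "0 \<le> v * (edgeR b - edgeL b)"
    using assms edgeL_less_edgeR[of b] by (intro mult_right_mono mult_nonneg_nonneg; simp)+
  then show "edgeL b \<le> Re (seg_pt v b)" "Re (seg_pt v b) \<le> edgeR b" by (simp_all add: seg_pt_def)
qed

lemma seg_pt_in_cregion: "0 < b \<Longrightarrow> 0 \<le> v \<Longrightarrow> v \<le> 1 \<Longrightarrow> seg_pt v b \<in> cregion"
  using seg_pt_in_band[of b v] by (auto simp: cregion_def complex_eq_iff)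

lemma region_eq: "region = (\<lambda>(v, b). seg_pt v b) ` ({0<..<1} \<times> {0<..})"
proof
  show "region \<subseteq> (\<lambda>(v, b). seg_pt v b) ` ({0<..<1} \<times> {0<..})"
  proof
    fix p assume "p \<in> region"
    then have *: "Im p > 0" "edgeL (Im p) < Re p" "Re p < edgeR (Im p)" by (auto simp: region_iff)
    have "p = seg_pt ((Re p - edgeL (Im p)) / (edgeR (Im p) - edgeL (Im p))) (Im p)"
      using * by (simp add: seg_pt_def complex_eq_iff)
    moreover have "(Re p - edgeL (Im p)) / (edgeR (Im p) - edgeL (Im p)) \<in> {0<..<1}" using * by simp
    ultimately show "p \<in> (\<lambda>(v, b). seg_pt v b) ` ({0<..<1} \<times> {0<..})" using *(1) by force
  qed
qed (auto intro: seg_pt_in_region)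

lemma connected_region: "connected region"
  unfolding region_eq
  by (intro connected_continuous_image continuous_on_subset[OF continuous_on_seg_pt]
    connected_Times) auto

lemma open_region: "open region"
proof -
  have o: "open {p. 0 < Im p}" by (intro open_Collect_less continuous_intros)
  have "continuous_on {p. 0 < Im p} (\<lambda>p. Im (T2 p))"
    by (intro continuous_intros continuous_on_T2) (auto intro: upperI)
  then have "open ({p. 0 < Im p} \<inter> (\<lambda>p. Im (T2 p)) -` {- pi<..<0})"
    by (rule continuous_open_preimage[OF _ o open_greaterThanLessThan])
  also have "{p. 0 < Im p} \<inter> (\<lambda>p. Im (T2 p)) -` {- pi<..<0} = region" by (auto simp: region_def)
  finally show ?thesis .
qed

text \<open>In the chart the closure is taken one variable at a time: first \<open>v\<close> at
  positive height, then \<open>b\<close> for fixed \<open>v\<close>.\<close>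

lemma cregion_subset_closure: "cregion \<subseteq> closure region"
proof
  have pos: "seg_pt v b \<in> closure region" if "b > 0" "0 \<le> v" "v \<le> 1" for v b
  proof -
    have "continuous_on UNIV (\<lambda>v. seg_pt v b)"
      unfolding seg_pt_def Complex_eq by (intro continuous_intros)
    then have "(\<lambda>v. seg_pt v b) ` closure {0<..<1} \<subseteq> closure region"
      by (intro image_closure_subset) (use that in \<open>auto intro!: closure_subset[THEN subsetD]
        seg_pt_in_region intro: continuous_on_subset\<close>)
    then show ?thesis using that by (auto simp: closure_greaterThanLessThan)
  qed
  fix p assume p: "p \<in> cregion"
  then obtain v where v: "v \<in> {0..1}" "p = seg_pt v (Im p)"
    using band_eq[of "Im p" "Re p"] by (auto simp: cregion_def)
  have "continuous_on {0..} (\<lambda>b. seg_pt v b)"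
    unfolding seg_pt_def Complex_eq
      by (intro continuous_intros continuous_on_edgeL continuous_on_edgeR)
  then have "(\<lambda>b. seg_pt v b) ` closure {0<..} \<subseteq> closure region"
    by (intro image_closure_subset) (use pos v in \<open>auto simp: closure_greaterThan\<close>)
  then show "p \<in> closure region" using p v by (auto simp: cregion_def closure_greaterThan)
qed

section \<open>Behaviour of u_of at the boundary\<close>

lemma compact_band: "compact {p. 0 \<le> Im p \<and> Im p \<le> B \<and> edgeL (Im p) \<le> Re p \<and> Re p \<le> edgeR (Im p)}"
proof -
  have "{p. 0 \<le> Im p \<and> Im p \<le> B \<and> edgeL (Im p) \<le> Re p \<and> Re p \<le> edgeR (Im p)}
    = (\<lambda>(v, b). seg_pt v b) ` ({0..1} \<times> {0..B})"
  proof (intro equalityI subsetI)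
    fix p assume "p \<in> {p. 0 \<le> Im p \<and> Im p \<le> B \<and> edgeL (Im p) \<le> Re p \<and> Re p \<le> edgeR (Im p)}"
    then obtain v where "v \<in> {0..1}" "p = seg_pt v (Im p)" "Im p \<in> {0..B}"
      using band_eq[of "Im p" "Re p"] by auto
    then show "p \<in> (\<lambda>(v, b). seg_pt v b) ` ({0..1} \<times> {0..B})" by force
  qed (auto intro: seg_pt_in_band)
  moreover have "compact ((\<lambda>(v, b). seg_pt v b) ` ({0..1} \<times> {0..B}))"
    by (intro compact_continuous_image continuous_on_subset[OF continuous_on_seg_pt] compact_Times)
      auto
  ultimately show ?thesis by simp
qed

lemma isCont_exp2i: "isCont exp2i p"
  using holomorphic_on_imp_continuous_on[OF holomorphic_exp2i[of UNIV]]
    by (simp add: continuous_on_eq_continuous_at)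

text \<open>Properness of \<open>u_of\<close> on the closed region, away from \<open>u0\<close>: the imaginary part of \<open>p\<close> is
  read off from \<open>u_of p\<close>.\<close>
lemma u_of_proper:
  fixes p :: "nat \<Rightarrow> complex"
  assumes p: "\<And>n. p n \<in> cregion" and lim: "(\<lambda>n. u_of (p n)) \<longlonglongrightarrow> z" and z: "z \<noteq> u0"
  obtains r l where "strict_mono r" "l \<in> cregion" "(p \<circ> r) \<longlonglongrightarrow> l" "u_of l = z"
proof -
  define M where "M w = (w - 1 / 2) / (of_real (sqrt 3 / 2) * \<i>)" for w :: complex
  have ne: "exp2i (p n) \<noteq> 1" for n using cregion_upper[OF p] by (auto simp: upper_def)
  have e: "exp2i (p n) = (M (u_of (p n)) - 1) / (M (u_of (p n)) + 1)" for n
    using exp2i_mob(1)[OF ne] by (simp add: M_def mob_u_of)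
  have "Im (u_of (p n)) \<ge> 0" for n
    unfolding Im_u_of[OF ne] using p[of n]
    by (intro divide_nonneg_nonneg mult_nonneg_nonneg) (auto simp: norm_exp2i cregion_def
      power_le_one)
  then have "Im z \<ge> 0"
    by (intro LIMSEQ_le_const[OF tendsto_Im[OF lim]]) auto
  \<comment> \<open>A zero here would put \<open>z\<close> at \<open>cnj u0\<close>, in the lower
    half-plane.\<close>
  have Mz: "M z + 1 \<noteq> 0"
  proof
    assume "M z + 1 = 0"
    then have "(z - 1 / 2) / (of_real (sqrt 3 / 2) * \<i>) = - 1" by (simp only: M_def add_eq_0_iff2)
    then have "z - 1 / 2 = - 1 * (of_real (sqrt 3 / 2) * \<i>)"
      by (subst (asm) nonzero_divide_eq_eq) auto
    then have "Im z = - (sqrt 3 / 2)" by (simp add: complex_eq_iff)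
    then show False using \<open>Im z \<ge> 0\<close> by simp
  qed
  have Mz1: "M z - 1 \<noteq> 0"
  proof
    assume "M z - 1 = 0"
    then have "(z - 1 / 2) / (of_real (sqrt 3 / 2) * \<i>) = 1" by (simp only: M_def right_minus_eq)
    then have "z - 1 / 2 = 1 * (of_real (sqrt 3 / 2) * \<i>)"
      by (subst (asm) nonzero_divide_eq_eq) auto
    then show False using z by (simp add: u0_def complex_eq_iff)
  qed
  define ez where "ez = (M z - 1) / (M z + 1)"
  have ez: "ez \<noteq> 0" "ez \<noteq> 1" using Mz Mz1 by (auto simp: ez_def divide_simps)
  have elim: "(\<lambda>n. exp2i (p n)) \<longlonglongrightarrow> ez"
    unfolding e ez_def using Mz by (auto simp: M_def intro!: tendsto_intros lim)
  have "(\<lambda>n. - ln (cmod (exp2i (p n))) / 2) \<longlonglongrightarrow> - ln (cmod ez) / 2"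
    using ez by (intro tendsto_intros elim) auto
  then have "(\<lambda>n. Im (p n)) \<longlonglongrightarrow> - ln (cmod ez) / 2" by (simp add: norm_exp2i)
  then have "Bseq (\<lambda>n. Im (p n))" by (rule convergent_imp_Bseq[OF convergentI])
  then obtain B where B: "\<And>n. \<bar>Im (p n)\<bar> \<le> B" by (auto simp: Bseq_def)
  have "seq_compact {p. 0 \<le> Im p \<and> Im p \<le> B \<and> edgeL (Im p) \<le> Re p \<and> Re p \<le> edgeR (Im p)}" (is
    "seq_compact ?K")
    using compact_band[of B] by (simp only: compact_eq_seq_compact_metric)
  moreover have "\<forall>n. p n \<in> ?K" using p B by (auto simp: cregion_def abs_le_iff)
  ultimately obtain l r where lr: "l \<in> ?K" "strict_mono r" "(p \<circ> r) \<longlonglongrightarrow> l"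
    by (rule seq_compactE)
  have "(\<lambda>n. exp2i ((p \<circ> r) n)) \<longlonglongrightarrow> exp2i l" by (rule isCont_tendsto_compose[OF isCont_exp2i lr(3)])
  moreover have "(\<lambda>n. exp2i ((p \<circ> r) n)) \<longlonglongrightarrow> ez"
    using LIMSEQ_subseq_LIMSEQ[OF elim lr(2)] by (simp add: o_def)
  ultimately have el: "exp2i l = ez" by (rule LIMSEQ_unique)
  \<comment> \<open>The compact band contains the corner that \<open>cregion\<close> lacks; the
    limit avoids it because \<open>exp2i\<close> is 1 there and \<open>ez\<close> is not.\<close>
  have "l \<noteq> of_real pi"
    using el ez by (auto simp: exp2i_def mult_ac exp_two_pi_i)
  then have l: "l \<in> cregion" using lr by (auto simp: cregion_def)
  have "mob l = M z"
    unfolding mob_def el ez_def using Mz by (simp add: divide_simps)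
  moreover have "of_real (sqrt 3 / 2) * (\<i> * M z) = z - 1 / 2"
    unfolding M_def by (subst mult.assoc[symmetric], subst times_divide_eq_right, subst
      nonzero_mult_div_cancel_left) auto
  ultimately have "u_of l = z" unfolding u_of_def by (metis add.commute diff_add_cancel)
  then show ?thesis using that lr l by blast
qed

lemma T_domain_eq: "T_domain = u_of ` cregion"
proof
  show "T_domain \<subseteq> u_of ` cregion"
  proof
    fix z assume "z \<in> T_domain"
    then obtain x where z: "\<And>n. x n \<in> u_of ` region" "x \<longlonglongrightarrow> z" "z \<noteq> u0"
      by (auto simp: T_domain_def Delta_eq closure_sequential)
    then have "\<forall>n. \<exists>p. p \<in> region \<and> x n = u_of p" by blast
    then obtain p where p: "\<And>n. p n \<in> region" "\<And>n. x n = u_of (p n)" by metis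
    then have "\<And>n. p n \<in> cregion" "(\<lambda>n. u_of (p n)) \<longlonglongrightarrow> z"
      using region_subset_cregion z(2) by (auto simp flip: p(2))
    then show "z \<in> u_of ` cregion" using z(3) by (rule u_of_proper) auto
  qed
  have "u_of ` cregion \<subseteq> closure (u_of ` region)"
  proof -
    have "u_of ` (cregion \<inter> closure region) \<subseteq> closure (u_of ` region)"
    proof safe
      fix p assume "p \<in> cregion" "p \<in> closure region"
      then obtain x where x: "\<And>n. x n \<in> region" "x \<longlonglongrightarrow> p" by (auto simp: closure_sequential)
      have "((\<lambda>n. u_of (x n)) \<longlonglongrightarrow> u_of p)"
      proof (rule continuous_on_tendsto_compose[OF continuous_on_u_of x(2) \<open>p \<in> cregion\<close>])
        show "\<forall>\<^sub>F n in sequentially. x n \<in> cregion"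
          using x(1) region_subset_cregion by (intro always_eventually) auto
      qed (use cregion_upper in auto)
      moreover have "\<forall>n. u_of (x n) \<in> u_of ` region" using x(1) by auto
      ultimately show "u_of p \<in> closure (u_of ` region)"
        unfolding closure_sequential by (intro exI[of _ "\<lambda>n. u_of (x n)"] conjI)
    qed
    then show ?thesis using cregion_subset_closure by (simp add: Int_absorb2)
  qed
  then show "u_of ` cregion \<subseteq> T_domain"
    using u_of_ne_u0 cregion_upper by (force simp: T_domain_def Delta_eq upper_def)
qed

text \<open>A continuous injection that is closed onto its image is a homeomorphism, and
  \<open>u_of_proper\<close> provides closedness. The open mapping theorem would cover only the
  interior, while \<open>T\<close> has to be continuous up to the boundary.\<close>

lemma continuous_on_inv_u_of: "continuous_on (u_of ` cregion) (inv_into cregion u_of)"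
proof -
  have "\<exists>g. homeomorphism cregion (u_of ` cregion) u_of g"
  proof (rule homeomorphism_injective_closed_map[OF continuous_on_u_of refl inj_on_u_of])
    fix U assume "closedin (top_of_set cregion) U"
    then obtain C where C: "closed C" "U = cregion \<inter> C" by (auto simp: closedin_closed)
    have "u_of ` U = u_of ` cregion \<inter> closure (u_of ` U)"
    proof
      show "u_of ` cregion \<inter> closure (u_of ` U) \<subseteq> u_of ` U"
      proof
        fix z assume z: "z \<in> u_of ` cregion \<inter> closure (u_of ` U)"
        then obtain x where x: "\<And>n. x n \<in> u_of ` U" "x \<longlonglongrightarrow> z" by (auto simp: closure_sequential)
        then have "\<forall>n. \<exists>p. p \<in> U \<and> x n = u_of p" by blast
        then obtain p where p: "\<And>n. p n \<in> U" "\<And>n. x n = u_of (p n)" by metis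
        have "z \<noteq> u0" using z u_of_ne_u0 cregion_upper by (force simp: upper_def)
        moreover have "\<And>n. p n \<in> cregion" "(\<lambda>n. u_of (p n)) \<longlonglongrightarrow> z" using p(1) C x(2)
          by (auto simp flip: p(2))
        ultimately obtain r l where rl: "strict_mono r" "l \<in> cregion" "(p \<circ> r) \<longlonglongrightarrow> l" "u_of l = z"
          using u_of_proper by blast
        have "l \<in> C" using C(1) rl(3) p(1) C(2) by (intro closed_sequentially[of C "p \<circ> r" l]) auto
        then show "z \<in> u_of ` U" using rl C(2) by auto
      qed
    qed (use C closure_subset[of "u_of ` U"] in auto)
    then show "closedin (top_of_set (u_of ` cregion)) (u_of ` U)"
      by (metis closed_closure closedin_closed_Int)
  qed (use cregion_upper in auto)
  then obtain g where g: "homeomorphism cregion (u_of ` cregion) u_of g" by blast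
  then have "g z = inv_into cregion u_of z" if "z \<in> u_of ` cregion" for z
    using that inj_on_u_of unfolding homeomorphism_def by (auto simp: inv_into_f_f)
  then show ?thesis using g unfolding homeomorphism_def by (metis continuous_on_cong)
qed

definition T_lift :: "complex \<Rightarrow> complex" where
  "T_lift z = (if z \<in> T_domain then T2 (inv_into cregion u_of z) / 2 else 0)"

lemma T_lift_u_of: "p \<in> cregion \<Longrightarrow> T_lift (u_of p) = T2 p / 2"
  by (simp add: T_lift_def T_domain_eq inv_into_f_f[OF inj_on_u_of])

lemma open_Delta: "open Delta"
  unfolding Delta_eq
proof (rule open_mapping_thm3)
  show "inj_on u_of region" using inj_on_u_of region_subset_cregion by (rule inj_on_subset)
qed (use open_region region_subset_cregion cregion_upper in \<open>auto intro!: holomorphic_u_of simp: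
  upper_def\<close>)

lemma holomorphic_T2: "(\<And>p. p \<in> A \<Longrightarrow> Im p > 0) \<Longrightarrow> T2 holomorphic_on A"
  unfolding holomorphic_on_def field_differentiable_def
  using has_field_derivative_T2 upperI by blast

lemma T_lift_properties:
  "continuous_on T_domain T_lift" "T_lift analytic_on Delta"
  "\<And>s. s \<ge> 0 \<Longrightarrow> T_lift (of_real s) = of_real (T0 s)" "\<And>z. z \<notin> T_domain \<Longrightarrow> T_lift z = 0"
proof -
  have "continuous_on (u_of ` cregion) (\<lambda>z. T2 (inv_into cregion u_of z) / 2)"
    by (intro continuous_intros continuous_on_compose2[OF continuous_on_T2[of cregion]
      continuous_on_inv_u_of])
      (auto simp: cregion_upper inv_into_f_f[OF inj_on_u_of])
  then show "continuous_on T_domain T_lift"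
    unfolding T_domain_eq by (rule continuous_on_eq) (auto simp: T_lift_def T_domain_eq)
  have "u_of holomorphic_on region" using region_subset_cregion cregion_upper
    by (auto intro!: holomorphic_u_of simp: upper_def)
  moreover have "inj_on u_of region" using inj_on_u_of region_subset_cregion by (rule inj_on_subset)
  ultimately obtain g where g: "g holomorphic_on (u_of ` region)" "\<And>z. z \<in> region \<Longrightarrow> g (u_of z) = z"
    using holomorphic_has_inverse[OF _ open_region] by metis
  have "(\<lambda>z. T2 (g z) / 2) holomorphic_on (u_of ` region)"
    by (intro holomorphic_intros holomorphic_on_compose_gen[OF g(1) holomorphic_T2[of region],
      unfolded o_def])
      (auto simp: g(2) region_def)
  then have "T_lift holomorphic_on (u_of ` region)"
    by (rule holomorphic_transform) (use region_subset_cregion in \<open>auto simp: g(2) T_lift_u_of\<close>)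
  then show "T_lift analytic_on Delta" using open_Delta by (simp add: analytic_on_open Delta_eq)
  show "T_lift (of_real s) = of_real (T0 s)" if "s \<ge> 0" for s
  proof -
    have "of_real (cot_arg s) \<in> cregion" using that
      by (intro of_real_in_cregion cot_arg_ge cot_arg_bounds)
    from T_lift_u_of[OF this] show ?thesis unfolding u_of_cot_arg T2_cot_arg T0_T_prim by simp
  qed
  show "T_lift z = 0" if "z \<notin> T_domain" for z using that by (simp add: T_lift_def)
qed

lemma cregion_real_cot_arg:
  assumes "pi / 3 \<le> a" "a < pi"
  obtains s where "s \<ge> 0" "a = cot_arg s"
proof -
  have "- (pi / 6) \<le> a - pi / 2" "a - pi / 2 < pi / 2" using assms by auto
  then have at: "arctan (tan (a - pi / 2)) = a - pi / 2" using pi_gt_zero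
    by (intro arctan_tan) linarith+
  define s where "s = (1 + sqrt 3 * tan (a - pi / 2)) / 2"
  have "2 * s = 1 + sqrt 3 * tan (a - pi / 2)" by (simp only: s_def) simp
  then have "(2 * s - 1) / sqrt 3 = tan (a - pi / 2)" by simp
  then have a: "a = cot_arg s" using at by (simp add: cot_arg_def)
  have "tan (- (pi / 6)) \<le> tan (a - pi / 2)"
    using \<open>- (pi / 6) \<le> a - pi / 2\<close> \<open>a - pi / 2 < pi / 2\<close> by (intro tan_mono_le) auto
  then have "- (1 / sqrt 3) \<le> tan (a - pi / 2)" by (simp add: tan_30)
  then have "sqrt 3 * - (1 / sqrt 3) \<le> sqrt 3 * tan (a - pi / 2)" by (intro mult_left_mono) auto
  then have "s \<ge> 0" unfolding s_def by simp
  then show ?thesis using that a by blast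
qed

text \<open>The difference of two extensions, pulled back to the \<open>p\<close>-plane, vanishes on a real
  interval of the boundary; extended by \<open>0\<close> below the real axis it stays holomorphic, hence
  vanishes.\<close>
lemma extension_unique:
  assumes f: "continuous_on T_domain f" "f analytic_on Delta" "\<And>s. s \<ge> 0 \<Longrightarrow> f (of_real s) = h s"
    and g: "continuous_on T_domain g" "g analytic_on Delta" "\<And>s. s \<ge> 0 \<Longrightarrow> g (of_real s) = h s"
    and z: "z \<in> T_domain"
  shows "f z = g z"
proof -
  define d where "d p = f (u_of p) - g (u_of p)" for p
  define D where "D p = (if Im p > 0 then d p else 0)" for p
  have holo_d: "d holomorphic_on region"
  proof -
    have u: "u_of holomorphic_on region" using region_subset_cregion cregion_upper
      by (auto intro!: holomorphic_u_of simp: upper_def)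
    have "f holomorphic_on u_of ` region" "g holomorphic_on u_of ` region"
      using f(2) g(2) by (auto simp: Delta_eq intro: analytic_imp_holomorphic)
    then show ?thesis unfolding d_def
      by (intro holomorphic_intros holomorphic_on_compose[OF u, unfolded o_def])
  qed
  have cont_d: "continuous_on cregion d"
    unfolding d_def
    by (intro continuous_intros continuous_on_compose2[OF f(1) continuous_on_u_of]
      continuous_on_compose2[OF g(1) continuous_on_u_of])
      (auto simp: T_domain_eq cregion_upper)
  have real_d: "d (of_real a) = 0" if a: "pi / 3 \<le> a" "a < pi" for a
  proof -
    obtain s where "s \<ge> 0" "a = cot_arg s" using a by (rule cregion_real_cot_arg)
    then show ?thesis unfolding d_def by (simp add: u_of_cot_arg f(3) g(3))
  qed
  \<comment> \<open>The midpoint of the bottom side, where \<open>u_of\<close> is 1.\<close>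
  define p0 :: complex where "p0 = of_real (2 * pi / 3)"
  obtain e where e: "e > 0" "e \<le> pi / 3" "\<And>p. p \<in> ball p0 e \<Longrightarrow> Im p > 0 \<Longrightarrow> p \<in> region"
  proof -
    have "(edgeL \<longlongrightarrow> pi / 3) (at_right 0)" "(edgeR \<longlongrightarrow> pi) (at_right 0)"
      using continuous_on_edgeL[unfolded continuous_on_def, rule_format, of 0]
        continuous_on_edgeR[unfolded continuous_on_def, rule_format, of 0]
      by (simp_all add: at_within_Ici_at_right edgeL_def[of 0] edgeR_def[of 0])
    \<comment> \<open>With each edge within \<open>pi / 6\<close> of its limit, the strip of
      half-width \<open>pi / 6\<close> around \<open>p0\<close> is free at small heights.\<close>
    then have "eventually (\<lambda>b. edgeL b < pi / 3 + pi / 6) (at_right 0)"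
      "eventually (\<lambda>b. edgeR b > pi - pi / 6) (at_right 0)"
      by - (rule order_tendstoD(2), assumption, simp, rule order_tendstoD(1), assumption, simp)
    then have "eventually (\<lambda>b. edgeL b < pi / 3 + pi / 6 \<and> edgeR b > pi - pi / 6) (at_right 0)"
      by (rule eventually_conj)
    then obtain c where c: "c > 0" "\<And>b. 0 < b \<Longrightarrow> b < c \<Longrightarrow> edgeL b < pi / 3
      + pi / 6 \<and> edgeR b > pi - pi / 6"
      by (auto simp: eventually_at_right_field)
    show ?thesis
    proof (rule that[of "min c (pi / 6)"])
      fix p assume p: "p \<in> ball p0 (min c (pi / 6))" "Im p > 0"
      then have "cmod (p - p0) < c" "cmod (p - p0) < pi / 6"
        by (auto simp: dist_norm norm_minus_commute)
      then have "\<bar>Re p - 2 * pi / 3\<bar> < pi / 6" "Im p < c"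
        using abs_Re_le_cmod[of "p - p0"] abs_Im_le_cmod[of "p - p0"] p by (auto simp: p0_def)
      then show "p \<in> region" using c(2)[of "Im p"] p(2) unfolding region_iff
        by (intro conjI; linarith)
    qed (use c(1) pi_gt_zero in \<open>auto simp: min_def\<close>)
  qed
  have real_in: "p \<in> cregion" "d p = 0" if "p \<in> ball p0 e" "Im p = 0" for p
  proof -
    have "\<bar>Re p - 2 * pi / 3\<bar> < e"
      using abs_Re_le_cmod[of "p - p0"] that by (auto simp: p0_def dist_norm norm_minus_commute)
    then have "pi / 3 \<le> Re p" "Re p < pi" using e(2) by (auto simp: abs_less_iff)
    moreover have "p = of_real (Re p)" using that by (simp add: complex_eq_iff)
    ultimately show "p \<in> cregion" "d p = 0" using of_real_in_cregion real_d by metis+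
  qed
  have upper_eq: "ball p0 e \<inter> {z. 0 < \<i> \<bullet> z} \<subseteq> region" using e(3) by (auto simp: inner_complex_def)
  have "D holomorphic_on ball p0 e"
  proof (rule holomorphic_on_paste_across_line[of _ \<i> _ 0])
    show "D holomorphic_on ball p0 e \<inter> {z. \<i> \<bullet> z < 0}"
      by (rule holomorphic_transform[of "\<lambda>_. 0"]) (auto simp: D_def inner_complex_def)
    show "D holomorphic_on ball p0 e \<inter> {z. 0 < \<i> \<bullet> z}"
      by (rule holomorphic_transform[OF holomorphic_on_subset[OF holo_d upper_eq]]) (auto simp:
        D_def inner_complex_def)
    have "continuous_on ((ball p0 e \<inter> {p. 0 \<le> Im p}) \<union> (ball p0 e \<inter> {p. Im p \<le> 0})) (\<lambda>p. if 0 \<le> Im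
      p then d p else 0)"
    proof (rule continuous_on_cases_local)
      show "closedin (top_of_set (ball p0 e \<inter> {p. 0 \<le> Im p} \<union> ball p0 e \<inter> {p. Im p \<le> 0})) (ball p0
        e \<inter> {p. 0 \<le> Im p})"
        by (rule closedin_subset_trans[of "ball p0 e"]) (auto intro!: closedin_closed_Int
          closed_halfspace_Im_ge)
      show "closedin (top_of_set (ball p0 e \<inter> {p. 0 \<le> Im p} \<union> ball p0 e \<inter> {p. Im p \<le> 0})) (ball p0
        e \<inter> {p. Im p \<le> 0})"
        by (rule closedin_subset_trans[of "ball p0 e"]) (auto intro!: closedin_closed_Int
          closed_halfspace_Im_le)
      show "continuous_on (ball p0 e \<inter> {p. 0 \<le> Im p}) d"
      proof (rule continuous_on_subset[OF cont_d], safe)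
        fix p assume "p \<in> ball p0 e" "0 \<le> Im p"
        then show "p \<in> cregion" using e(3)[of p] real_in(1)[of p] region_subset_cregion
          by (cases "Im p = 0") auto
      qed
    qed (use real_in(2) in \<open>auto simp: not_le\<close>)
    then show "continuous_on (ball p0 e) D"
      by (rule continuous_on_eq[OF continuous_on_subset]) (use real_in(2) in \<open>auto simp: D_def
        not_less le_less\<close>)
  qed auto
  define q where "q = p0 + of_real (e / 2) * \<i>"
  define q' where "q' = p0 - of_real (e / 2) * \<i>"
  have q: "q \<in> ball p0 e" "q' \<in> ball p0 e" "Im q > 0" "Im q' < 0"
    using e(1) by (auto simp: q_def q'_def dist_norm norm_mult p0_def)
  have D0: "D p = 0" if "p \<in> ball p0 e" for p
  proof (rule analytic_continuation_open[of "ball p0 e \<inter> {p. Im p < 0}" "ball p0 e" D "\<lambda>_. 0"])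
    show "open (ball p0 e \<inter> {p. Im p < 0})" by (intro open_Int open_ball open_halfspace_Im_lt)
    show "ball p0 e \<inter> {p. Im p < 0} \<noteq> {}" using q by auto
  qed (use \<open>D holomorphic_on ball p0 e\<close> that in \<open>auto simp: D_def\<close>)
  \<comment> \<open>A second use of the identity theorem passes from the half-disc to the connected
    region; afterwards continuity reaches the boundary.\<close>
  have d_region: "d p = 0" if "p \<in> region" for p
  proof (rule analytic_continuation_open[of "ball p0 e \<inter> {p. 0 < Im p}" region d "\<lambda>_. 0"])
    show "open (ball p0 e \<inter> {p. 0 < Im p})" by (intro open_Int open_ball open_halfspace_Im_gt)
    show "ball p0 e \<inter> {p. 0 < Im p} \<noteq> {}" using q by auto
    show "ball p0 e \<inter> {p. 0 < Im p} \<subseteq> region" using e(3) by auto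
    fix p assume "p \<in> ball p0 e \<inter> {p. 0 < Im p}"
    then show "d p = 0" using D0[of p] by (simp add: D_def)
  qed (use holo_d open_region connected_region that in auto)
  obtain p where p: "p \<in> cregion" "z = u_of p" using z by (auto simp: T_domain_eq)
  have "p \<in> closure region" using p(1) cregion_subset_closure by auto
  then obtain x where x: "\<And>n. x n \<in> region" "x \<longlonglongrightarrow> p" by (auto simp: closure_sequential)
  have "(\<lambda>n. d (x n)) \<longlonglongrightarrow> d p"
    by (rule continuous_on_tendsto_compose[OF cont_d x(2) p(1)])
      (use x(1) region_subset_cregion in \<open>auto intro!: always_eventually\<close>)
  then have "d p = 0" using d_region[OF x(1)] LIMSEQ_unique[of "\<lambda>_. 0"]
    by (metis (no_types, lifting) ext tendsto_const)
  then show ?thesis by (simp add: d_def p(2))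
qed

section \<open>Identification of T and its inverse\<close>

lemma T_ext_eq: "T_ext = T_lift"
  unfolding T_ext_def
proof (rule the_equality)
  fix f assume f: "continuous_on T_domain f \<and> f analytic_on Delta \<and>
               (\<forall>s\<ge>0. f (complex_of_real s) = complex_of_real (T0 s)) \<and> (\<forall>z. z \<notin> T_domain \<longrightarrow> f z =
                 0)"
  show "f = T_lift"
  proof
    fix z show "f z = T_lift z"
      using extension_unique[of f "\<lambda>s. of_real (T0 s)" T_lift z] f T_lift_properties
      by (cases "z \<in> T_domain") auto
  qed
qed (use T_lift_properties in auto)

lemma T_prim_strict_mono: 
  assumes "0 \<le> s" "s < s'" shows "T_prim s < T_prim s'"
  using assms(2)
proof (rule DERIV_pos_imp_increasing_open)
  fix x assume "s < x" "x < s'"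
  then show "\<exists>y. DERIV T_prim x :> y \<and> y > 0"
    using T_prim_deriv[of x] quad_pos[of x] assms(1) by (intro exI[of _ "x / (x\<^sup>2 - x + 1)"]) auto
qed (auto intro!: continuous_at_imp_continuous_on DERIV_isCont[OF T_prim_deriv])

text \<open>The imaginary part of \<open>T2\<close> selects the level and the real part increases
  along each curve. Only level 0 is shared, by the bottom side and the left edge; there the value at
  their common corner \<open>pi / 3\<close> separates the two.\<close>

lemma inj_on_T2: "inj_on T2 cregion"
proof (rule inj_onI)
  have real_lt: "Re (T2 (of_real a)) \<le> 2 * sqrt 3 * pi / 9" "Im (T2 (of_real a)) = 0"
    if a: "pi / 3 \<le> a" "a < pi" for a
  proof -
    obtain s where s: "s \<ge> 0" "a = cot_arg s" using a by (rule cregion_real_cot_arg)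
    have e: "cot_arg 0 = pi / 3" by (simp add: cot_arg_def arctan_minus arctan_inv_sqrt3 flip:
      minus_divide_left)
    have "T_prim 0 \<le> T_prim s" using T_prim_strict_mono[of 0 s] s by (cases "s = 0") auto
    moreover have "- 2 * T_prim 0 = 2 * sqrt 3 * pi / 9"
      using T2_cot_arg[of 0] T2_pi_third unfolding e by (metis of_real_eq_iff)
    ultimately show "Re (T2 (of_real a)) \<le> 2 * sqrt 3 * pi / 9" "Im (T2 (of_real a)) = 0"
      unfolding s T2_cot_arg by auto
  qed
  fix p p' assume *: "p \<in> cregion" "p' \<in> cregion" "T2 p = T2 p'"
  show "p = p'"
    using *(1)
  proof (cases rule: cregion_cases)
    case (real a)
    note p = this
    show ?thesis using *(2)
    proof (cases rule: cregion_cases)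
      case (real a')
      obtain s where s: "s \<ge> 0" "a = cot_arg s" using p(1,2) by (rule cregion_real_cot_arg)
      obtain s' where s': "s' \<ge> 0" "a' = cot_arg s'" using real(1,2) by (rule cregion_real_cot_arg)
      have "T_prim s = T_prim s'" using *(3) unfolding p real s s' T2_cot_arg by simp
      then have "s = s'" using T_prim_strict_mono s s'
        by (metis linorder_less_linear order_less_irrefl)
      then show ?thesis using p real s s' by simp
    next
      case (pos m b)
      have "m = 0" using *(3) real_lt(2)[OF p(1,2)] Im_T2_curve[OF pos(1), of m]
        by (simp add: p pos)
      then show ?thesis using *(3) real_lt(1)[OF p(1,2)] curve_T_0_lower[OF pos(1)]
        by (simp add: p pos curve_T_def)
    qed
  next
    case (pos m b)
    note p = this
    show ?thesis using *(2)
    proof (cases rule: cregion_cases)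
      case (real a')
      have "m = 0" using *(3) real_lt(2)[OF real(1,2)] Im_T2_curve[OF pos(1), of m]
        by (simp add: real pos)
      then show ?thesis using *(3) real_lt(1)[OF real(1,2)] curve_T_0_lower[OF pos(1)]
        by (simp add: real pos curve_T_def)
    next
      case (pos m' b')
      have "m = m'" using *(3) Im_T2_curve[OF pos(1), of m'] Im_T2_curve[OF p(1), of m]
        by (simp add: p pos)
      moreover have "curve_T m b = curve_T m' b'" using *(3) by (simp add: curve_T_def p pos)
      ultimately have "b = b'" using curve_T_strict_mono p pos
        by (metis linorder_less_linear order_less_irrefl)
      then show ?thesis using p pos \<open>m = m'\<close> by simp
    qed
  qed
qed

lemma T_inv_T2: 
  assumes "p \<in> cregion" shows "T_inv (T2 p / 2) = u_of p"
proof -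
  have "inj_on T_lift T_domain"
    unfolding T_domain_eq
  proof (rule inj_onI, safe)
    fix p p' assume "p \<in> cregion" "p' \<in> cregion" "T_lift (u_of p) = T_lift (u_of p')"
    then have "p = p'" using inj_onD[OF inj_on_T2, of p p'] by (simp add: T_lift_u_of)
    then show "u_of p = u_of p'" by simp
  qed
  then have "inv_into T_domain T_lift (T_lift (u_of p)) = u_of p"
    by (rule inv_into_f_f) (use assms in \<open>simp add: T_domain_eq\<close>)
  then show ?thesis by (simp add: T_inv_def T_ext_eq T_lift_u_of[OF assms])
qed

subsection \<open>The kernel integral\<close>

lemma has_field_derivative_expT2:
  assumes "p \<in> upper"
  shows "(expT2 has_field_derivative (- (4 / of_real (sqrt 3)) * u_of p * expT2 p)) (at p)"
proof -
  have ne: "exp2i p \<noteq> 1" using assms by (simp add: upper_def)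
  have "((\<lambda>p. exp (T2 p)) has_field_derivative (exp (T2 p) * (- (4 / of_real (sqrt 3)) * u_of p)))
    (at p)"
    by (rule DERIV_chain2[OF DERIV_exp has_field_derivative_T2[OF assms]])
  moreover have "open {p. exp2i p \<noteq> 1}"
    by (intro open_Collect_neq continuous_intros holomorphic_on_imp_continuous_on[OF
      holomorphic_exp2i])
  ultimately show ?thesis
    using ne by (elim has_field_derivative_transform_within_open[THEN DERIV_cong]) (auto simp:
      exp_T2)
qed

lemma holomorphic_expT2: "expT2 holomorphic_on A"
  unfolding expT2_def[abs_def] by (intro holomorphic_intros holomorphic_exp2i)

lemma expT2_curve: "b > 0 \<Longrightarrow> expT2 (curve m b) = of_real (exp (curve_T m b)) * cis (- 2 * m)"
  using exp_T2[of "curve m b"] T2_curve[of b m] exp2i_ne_1[of "curve m b"]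
  by (simp add: exp_eq_polar)

lemma expT2_cot_arg: "expT2 (of_real (cot_arg s)) = of_real (exp (- 2 * T_prim s))"
  using exp_T2[OF exp2i_of_real_ne_1[OF cot_arg_bounds[of s]]] unfolding T2_cot_arg exp_of_real
    by simp

lemma expT2_pi: "expT2 (of_real pi) = 0"
  by (simp add: expT2_def exp2i_def mult_ac exp_two_pi_i)

lemma seg_pt_0: "b > 0 \<Longrightarrow> seg_pt 0 b = curve 0 b" and seg_pt_1:
  "b > 0 \<Longrightarrow> seg_pt 1 b = curve (pi / 2) b"
  by (simp_all add: seg_pt_def curve_def edgeL_def edgeR_def)

lemma seg_pt_real: "seg_pt v 0 = of_real (pi / 3 + v * (2 * pi / 3))"
  by (simp add: seg_pt_def edgeL_def edgeR_def complex_eq_iff)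

lemma seg_pt_closed: "b \<ge> 0 \<Longrightarrow> 0 \<le> v \<Longrightarrow> v \<le> 1 \<Longrightarrow> seg_pt v b \<in> cregion \<or> seg_pt v b = of_real pi"
  using seg_pt_in_band[of b v] by (auto simp: cregion_def)

definition curve_re' :: "real \<Rightarrow> real \<Rightarrow> real" where
  "curve_re' m b = - Re (u_of (curve m b)) / Im (u_of (curve m b))"

lemma continuous_on_curve: "continuous_on {0<..} (curve m)"
  unfolding curve_def Complex_eq
  by (intro continuous_intros continuous_at_imp_continuous_on) (auto simp: isCont_curve_re)

lemma continuous_on_u_of_curve: "continuous_on {0<..} (\<lambda>b. u_of (curve m b))"
  by (intro continuous_on_compose2[OF continuous_on_u_of[of upper] continuous_on_curve]) (auto
    simp: curve_upper)

lemma continuous_on_curve_re': "continuous_on {0<..} (curve_re' m)"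
  unfolding curve_re'_def[abs_def]
  using Im_u_of_pos[of "curve m _"] by (intro continuous_intros continuous_on_u_of_curve) force

lemma edgeL_deriv: "b > 0 \<Longrightarrow> (edgeL has_field_derivative curve_re' 0 b) (at b)"
  by (rule has_field_derivative_transform_within_open[OF curve_re_deriv[of b 0], of "{0<..}",
    folded curve_re'_def]) (auto simp: edgeL_def)

lemma edgeR_deriv: "b > 0 \<Longrightarrow> (edgeR has_field_derivative curve_re' (pi / 2) b) (at b)"
  by (rule has_field_derivative_transform_within_open[OF curve_re_deriv[of b "pi / 2"], of
    "{0<..}", folded curve_re'_def]) (auto simp: edgeR_def)

text \<open>Here \<open>\<kappa>\<close> is \<open>1 - 2 * t\<close>. Its relation to
  \<open>U\<close> puts a zero of the denominator at the real point with \<open>u_of = U\<close>;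
  the inequality says \<open>\<kappa> * g > 1\<close> at the corner \<open>u = 0\<close>, hence
  along the whole left edge.\<close>

locale kernel =
  fixes \<kappa> U :: real
  assumes U: "U > 0" and \<kappa>: "\<kappa> = exp (2 * T_prim U)" and \<kappa>_gt: "\<kappa> * exp (2 * sqrt 3 * pi / 9) > 1"
begin

definition kden :: "complex \<Rightarrow> complex" where "kden p = of_real \<kappa> * expT2 p - 1"
definition pole :: complex where "pole = of_real (cot_arg U)"
text \<open>The derivative of \<open>kden\<close> at \<open>pole\<close>, written as a number that
  is visibly real and nonzero.\<close>

definition D :: complex where "D = of_real (- (4 / sqrt 3) * U)"

lemma \<kappa>_pos: "\<kappa> > 0" by (simp add: \<kappa>)

lemma \<kappa>_inv: "exp (- 2 * T_prim U) = 1 / \<kappa>"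
  unfolding \<kappa> by (simp add: exp_minus field_simps)

lemma holomorphic_kden: "kden holomorphic_on A"
  unfolding kden_def[abs_def] by (intro holomorphic_intros holomorphic_expT2)

lemma kden_pole: "kden pole = 0"
  using \<kappa>_pos unfolding kden_def pole_def expT2_cot_arg \<kappa>_inv by simp

lemma D_ne: "D \<noteq> 0" using U by (simp add: D_def)

lemma deriv_kden_pole: "deriv kden pole = D"
proof (rule DERIV_imp_deriv)
  have "pole \<in> upper" unfolding pole_def by (intro upper_of_real cot_arg_bounds)
  from has_field_derivative_expT2[OF this]
  have "(kden has_field_derivative (of_real \<kappa> * (- (4 / of_real (sqrt 3)) * u_of pole * expT2
    pole))) (at pole)"
    unfolding kden_def[abs_def] by (auto intro!: derivative_eq_intros)
  also have "of_real \<kappa> * (- (4 / of_real (sqrt 3)) * u_of pole * expT2 pole)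
    = (of_real \<kappa> * expT2 pole) * (- (4 / of_real (sqrt 3)) * of_real U)"
    unfolding pole_def u_of_cot_arg by simp
  also have "\<dots> = D" using kden_pole by (simp add: D_def kden_def)
  finally show "(kden has_field_derivative D) (at pole)" .
qed

lemma kden_curve_0: "b > 0 \<Longrightarrow> kden (curve 0 b) = of_real (\<kappa> * exp (curve_T 0 b) - 1)"
  by (simp add: kden_def expT2_curve)

lemma kden_curve_0_pos: "b > 0 \<Longrightarrow> \<kappa> * exp (curve_T 0 b) - 1 > 0"
proof -
  assume "b > 0"
  then have "\<kappa> * exp (2 * sqrt 3 * pi / 9) \<le> \<kappa> * exp (curve_T 0 b)"
    using curve_T_0_lower \<kappa>_pos by (intro mult_left_mono) (auto intro: less_imp_le)
  then show ?thesis using \<kappa>_gt by linarith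
qed

lemma kden_curve_pi_half_pos: "\<kappa> * exp (curve_T (pi / 2) b) + 1 > 0"
  using \<kappa>_pos by (simp add: add_pos_pos)

lemma kden_curve_pi_half: "b > 0 \<Longrightarrow> kden (curve (pi / 2) b) = of_real (- (\<kappa> * exp (curve_T (pi / 2)
  b) + 1))"
proof -
  assume "b > 0"
  moreover have "cis (- pi) = - 1" using minus_cis'[of 0] by simp
  ultimately show ?thesis by (simp add: kden_def expT2_curve)
qed

lemma kden_region: "p \<in> region \<Longrightarrow> Im (kden p) < 0"
proof -
  assume "p \<in> region"
  then obtain m b where *: "b > 0" "0 < m" "m < pi / 2" "p = curve m b" by (rule region_cases)
  moreover have "sin (2 * m) > 0" using * by (intro sin_gt_zero) auto
  ultimately show ?thesis using \<kappa>_pos by (simp add: kden_def expT2_curve)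
qed

text \<open>Each part of the region has its own reason: on the bottom side \<open>T_prim\<close> is
  injective, on the left edge \<open>\<kappa> * g > 1\<close>, on the right edge \<open>g\<close> is
  negative, and inside \<open>g\<close> is not real.\<close>

lemma kden_ne:
  assumes "p \<in> cregion" "p \<noteq> pole"
  shows "kden p \<noteq> 0"
  using assms(1)
proof (cases rule: cregion_cases)
  case (real a)
  obtain s where s: "s \<ge> 0" "a = cot_arg s" using real(1,2) by (rule cregion_real_cot_arg)
  have "s \<noteq> U" using assms(2) real s by (auto simp: pole_def)
  then have "T_prim s \<noteq> T_prim U"
    using T_prim_strict_mono[of s U] T_prim_strict_mono[of U s] s U
      by (cases s U rule: linorder_cases) auto
  then have "exp (2 * T_prim U - 2 * T_prim s) \<noteq> 1" by simp
  moreover have "\<kappa> * exp (- 2 * T_prim s) = exp (2 * T_prim U - 2 * T_prim s)"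
    unfolding \<kappa> by (simp flip: exp_add)
  ultimately have "\<kappa> * exp (- 2 * T_prim s) - 1 \<noteq> 0" by simp
  moreover have "kden p = of_real (\<kappa> * exp (- 2 * T_prim s) - 1)"
    unfolding real s kden_def expT2_cot_arg by simp
  ultimately show ?thesis by (simp only: of_real_eq_0_iff not_False_eq_True)
next
  case (pos m b)
  consider "m = 0" | "m = pi / 2" | "0 < m" "m < pi / 2" using pos by linarith
  then show ?thesis
  proof cases
    case 1
    then show ?thesis using kden_curve_0[OF pos(1)] kden_curve_0_pos[OF pos(1)] pos
      by (metis of_real_eq_0_iff less_irrefl)
  next
    case 2
    show ?thesis using kden_curve_pi_half[OF pos(1)] kden_curve_pi_half_pos[of b] 2 pos
      by (metis of_real_eq_0_iff less_irrefl neg_0_equal_iff_equal neg_equal_0_iff_equal)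
  next
    case 3
    then show ?thesis using kden_region[of p] curve_in_region pos by force
  qed
qed

lemma pole_real: "Im pole = 0" by (simp add: pole_def)

lemma kden_seg_pt_ne: "b > 0 \<Longrightarrow> 0 \<le> v \<Longrightarrow> v \<le> 1 \<Longrightarrow> kden (seg_pt v b) \<noteq> 0"
  by (rule kden_ne[OF seg_pt_in_cregion]) (auto dest: arg_cong[of _ _ Im] simp: pole_real)

text \<open>Pulled back to a fixed interval, so that moving the segment is differentiation under the
  integral sign.\<close>

definition seg_int :: "real \<Rightarrow> complex" where
  "seg_int b = integral (cbox 0 1) (\<lambda>v. 2 / kden (seg_pt v b) * of_real (edgeR b - edgeL b))"

definition seg_pt_deriv :: "real \<Rightarrow> real \<Rightarrow> complex" where
  "seg_pt_deriv v b = of_real (curve_re' 0 b + v * (curve_re' (pi / 2) b - curve_re' 0 b)) + \<i>"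

lemma seg_pt_deriv_b:
  assumes "b > 0"
  shows "((\<lambda>b. seg_pt v b) has_vector_derivative seg_pt_deriv v b) (at b)"
proof -
  have "((\<lambda>b. edgeL b + v * (edgeR b - edgeL b)) has_field_derivative (curve_re' 0 b
    + v * (curve_re' (pi / 2) b - curve_re' 0 b))) (at b)"
    using assms by (auto intro!: derivative_eq_intros edgeL_deriv edgeR_deriv)
  then show ?thesis
    unfolding seg_pt_def seg_pt_deriv_def has_vector_derivative_complex_iff by simp
qed

lemma seg_pt_deriv_v: "((\<lambda>v. seg_pt v b) has_vector_derivative of_real (edgeR b - edgeL b)) (at v)"
  unfolding seg_pt_def has_vector_derivative_complex_iff
  by (auto intro!: derivative_eq_intros)

definition kernel_deriv :: "complex \<Rightarrow> complex" where "kernel_deriv p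
  = - 2 * deriv kden p / (kden p)\<^sup>2"

lemma kden_deriv: "(kden has_field_derivative deriv kden p) (at p)"
  using holomorphic_derivI[OF holomorphic_kden[of UNIV]] by simp

lemma K_deriv: "kden p \<noteq> 0 \<Longrightarrow> ((\<lambda>p. 2 / kden p) has_field_derivative kernel_deriv p) (at p)"
  unfolding kernel_deriv_def by (auto intro!: derivative_eq_intros kden_deriv simp:
    power2_eq_square)

lemma cont_kden: "continuous_on A kden"
  by (intro holomorphic_on_imp_continuous_on holomorphic_kden)

lemma cont_dG1: "continuous_on A (deriv kden)"
  by (rule continuous_on_subset[of UNIV])
    (auto intro!: holomorphic_on_imp_continuous_on holomorphic_deriv holomorphic_kden)

lemma cont_pp2: "continuous_on ({0<..} \<times> cbox 0 1) (\<lambda>x. seg_pt (snd x) (fst x))"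
  unfolding seg_pt_def Complex_eq
  by (intro continuous_intros continuous_on_compose2[OF continuous_on_edgeL]
    continuous_on_compose2[OF continuous_on_edgeR]) auto

lemma K_integrable_on:
  assumes "b > 0"
  shows "(\<lambda>v. 2 / kden (seg_pt v b) * of_real (edgeR b - edgeL b)) integrable_on cbox 0 1"
proof -
  have "continuous_on (cbox 0 1) (\<lambda>v. seg_pt v b)"
    unfolding seg_pt_def Complex_eq by (intro continuous_intros)
  then show ?thesis
    using assms
    by (intro integrable_continuous continuous_intros continuous_on_compose2[OF cont_kden[of UNIV]])
      (auto simp: kden_seg_pt_ne)
qed

definition seg_int_deriv :: "real \<Rightarrow> real \<Rightarrow> complex" where
  "seg_int_deriv b v = kernel_deriv (seg_pt v b) * seg_pt_deriv v b * of_real (edgeR b - edgeL b) +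
      2 / kden (seg_pt v b) * of_real (curve_re' (pi / 2) b - curve_re' 0 b)"

lemma cont_seg_int_deriv: "continuous_on ({0<..} \<times> cbox 0 1) (\<lambda>(b, v). seg_int_deriv b v)"
  unfolding seg_int_deriv_def kernel_deriv_def seg_pt_deriv_def split_beta
  by (intro continuous_intros continuous_on_compose2[OF cont_kden[of UNIV] cont_pp2]
      continuous_on_compose2[OF cont_dG1[of UNIV] cont_pp2]
      continuous_on_compose2[OF continuous_on_edgeL] continuous_on_compose2[OF continuous_on_edgeR]
      continuous_on_compose2[OF continuous_on_curve_re'])
    (auto simp: kden_seg_pt_ne)

text \<open>The mixed derivatives of \<open>seg_pt\<close> agree, so the \<open>b\<close>-derivative
  of the integrand is also the \<open>v\<close>-derivative of the kernel times
  \<open>seg_pt_deriv\<close>. This is Cauchy's theorem for a moving segment: only the end points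
  survive.\<close>

lemma seg_int_deriv_integral:
  assumes "b > 0"
  shows "integral (cbox 0 1) (seg_int_deriv b) = 2 / kden (seg_pt 1 b) * seg_pt_deriv 1 b - 2 /
    kden (seg_pt 0 b) * seg_pt_deriv 0 b"
proof -
  have "(seg_int_deriv b has_integral (2 / kden (seg_pt 1 b) * seg_pt_deriv 1 b - 2 / kden (seg_pt
    0 b) * seg_pt_deriv 0 b)) {0..1}"
  proof (rule fundamental_theorem_of_calculus)
    fix v :: real assume v: "v \<in> {0..1}"
    have 1: "((\<lambda>v. 2 / kden (seg_pt v b)) has_vector_derivative of_real (edgeR b - edgeL b) *
      kernel_deriv (seg_pt v b)) (at v)"
      using field_vector_diff_chain_at[OF seg_pt_deriv_v[of b v] K_deriv] kden_seg_pt_ne[OF assms]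
        v by (simp add: o_def)
    have "((\<lambda>v. curve_re' 0 b + v * (curve_re' (pi / 2) b - curve_re' 0 b)) has_field_derivative
      (curve_re' (pi / 2) b - curve_re' 0 b)) (at v)"
      by (auto intro!: derivative_eq_intros)
    then have 2: "((\<lambda>v. seg_pt_deriv v b) has_vector_derivative of_real (curve_re' (pi / 2) b -
      curve_re' 0 b)) (at v)"
      unfolding seg_pt_deriv_def has_vector_derivative_complex_iff by simp
    have "((\<lambda>v. 2 / kden (seg_pt v b) * seg_pt_deriv v b) has_vector_derivative seg_int_deriv b v)
      (at v)"
      using has_vector_derivative_mult[OF 1 2] by (simp add: seg_int_deriv_def algebra_simps)
    then show "((\<lambda>v. 2 / kden (seg_pt v b) * seg_pt_deriv v b) has_vector_derivative seg_int_deriv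
      b v) (at v within {0..1})"
      by (rule has_vector_derivative_at_within)
  qed simp
  then show ?thesis by (simp add: integral_unique)
qed

lemma seg_int_deriv:
  assumes "b > 0"
  shows "(seg_int has_vector_derivative (2 / kden (seg_pt 1 b) * seg_pt_deriv 1 b - 2 / kden
    (seg_pt 0 b) * seg_pt_deriv 0 b)) (at b)"
proof -
  have "((\<lambda>b. integral (cbox 0 1) (\<lambda>v. 2 / kden (seg_pt v b) * of_real (edgeR b - edgeL b)))
    has_vector_derivative
     integral (cbox 0 1) (seg_int_deriv b)) (at b within {0<..})"
  proof (rule leibniz_rule_vector_derivative)
    fix b v :: real assume b: "b \<in> {0<..}" and v: "v \<in> cbox 0 1"
    have 1: "((\<lambda>b. 2 / kden (seg_pt v b)) has_vector_derivative seg_pt_deriv v b * kernel_deriv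
      (seg_pt v b)) (at b)"
      using field_vector_diff_chain_at[OF seg_pt_deriv_b[of b v] K_deriv] kden_seg_pt_ne[of b v] b
        v by (simp add: o_def)
    have "((\<lambda>b. edgeR b - edgeL b) has_field_derivative (curve_re' (pi / 2) b - curve_re' 0 b)) (at
      b)"
      using b by (auto intro!: derivative_eq_intros edgeL_deriv edgeR_deriv)
    then have 2: "((\<lambda>b. complex_of_real (edgeR b - edgeL b)) has_vector_derivative of_real
      (curve_re' (pi / 2) b - curve_re' 0 b)) (at b)"
      unfolding has_vector_derivative_complex_iff by simp
    have "((\<lambda>b. 2 / kden (seg_pt v b) * of_real (edgeR b - edgeL b)) has_vector_derivative
      seg_int_deriv b v) (at b)"
      using has_vector_derivative_mult[OF 1 2] by (simp add: seg_int_deriv_def algebra_simps)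
    then show "((\<lambda>b. 2 / kden (seg_pt v b) * of_real (edgeR b - edgeL b)) has_vector_derivative
      seg_int_deriv b v) (at b within {0<..})"
      by (rule has_vector_derivative_at_within)
  next
    fix b :: real assume b: "b \<in> {0<..}"
    then show "(\<lambda>v. 2 / kden (seg_pt v b) * of_real (edgeR b - edgeL b)) integrable_on cbox 0 1"
      by (intro K_integrable_on) simp
  qed (use assms cont_seg_int_deriv in auto)
  then show ?thesis
    unfolding seg_int_deriv_integral[OF assms] seg_int_def[abs_def]
    using assms by (simp add: has_vector_derivative_def at_within_open[of b "{0<..}"])
qed

definition K_edge :: "real \<Rightarrow> real" where
  "K_edge b = 2 / (\<kappa> * exp (curve_T 0 b) - 1) + 2 / (\<kappa> * exp (curve_T (pi / 2) b) + 1)"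

text \<open>At both ends the kernel is real, so of the velocity \<open>slope + i\<close> only the
  component \<open>i\<close> enters the imaginary part.\<close>

lemma Im_seg_int_deriv:
  assumes "b > 0"
  shows "((\<lambda>b. - Im (seg_int b)) has_field_derivative K_edge b) (at b)"
proof -
  have *: "Im (2 / of_real c * (of_real x + \<i>)) = 2 / c" for c x
  proof -
    have "2 / of_real c = complex_of_real (2 / c)" by simp
    then show ?thesis by (simp add: times_complex.sel)
  qed
  have "Im (2 / kden (seg_pt 1 b) * seg_pt_deriv 1 b) = 2 / - (\<kappa> * exp (curve_T (pi / 2) b) + 1)"
    unfolding seg_pt_1[OF assms] kden_curve_pi_half[OF assms] seg_pt_deriv_def by (rule *)
  moreover have "Im (2 / kden (seg_pt 0 b) * seg_pt_deriv 0 b) = 2 / (\<kappa> * exp (curve_T 0 b) - 1)"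
    unfolding seg_pt_0[OF assms] kden_curve_0[OF assms] seg_pt_deriv_def by (rule *)
  ultimately show ?thesis
    using DERIV_minus[OF has_field_derivative_Im[OF seg_int_deriv[OF assms]]] 
    by (simp only: minus_diff_eq minus_divide_right[symmetric] K_edge_def minus_complex.sel) simp
qed

text \<open>The denominator grows exponentially, uniformly across the region, while the segments
  keep bounded length.\<close>

lemma seg_int_at_top: "(seg_int \<longlongrightarrow> 0) at_top"
proof -
  define C where "C = T_const - 3 * pi / sqrt 3 - 2 * ln 2"
  have T: "((\<lambda>b. 2 / (\<kappa> * exp (C + 2 * b) - 1) * (3 * pi / 2)) \<longlongrightarrow> 0) at_top"
    using \<kappa>_pos by real_asymp
  have "eventually (\<lambda>b. \<kappa> * exp (C + 2 * b) > 1) at_top"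
    using \<kappa>_pos by real_asymp
  then have "eventually (\<lambda>b. norm (seg_int b) \<le> 2 / (\<kappa> * exp (C
    + 2 * b) - 1) * (3 * pi / 2)) at_top"
    using eventually_ge_at_top[of 1]
  proof eventually_elim
    case (elim b)
    have "norm (2 / kden (seg_pt v b) * of_real (edgeR b - edgeL b)) \<le> 2 / (\<kappa> * exp (C
      + 2 * b) - 1) * (3 * pi / 2)"
      if "v \<in> cbox 0 1" for v
    proof -
      have p: "seg_pt v b \<in> cregion" using that elim by (intro seg_pt_in_cregion) auto
      have "\<kappa> * exp (C + 2 * b) \<le> \<kappa> * exp (Re (T2 (seg_pt v b)))"
        using Re_T2_lower[OF p] elim \<kappa>_pos by (intro mult_left_mono) (auto simp: C_def)
      also have "\<dots> = cmod (of_real \<kappa> * expT2 (seg_pt v b))"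
        using exp_T2[of "seg_pt v b"] cregion_upper[OF p] \<kappa>_pos
          by (simp add: norm_mult upper_def flip: norm_exp_eq_Re)
      also have "\<dots> \<le> cmod (kden (seg_pt v b)) + 1"
        unfolding kden_def by (metis norm_one norm_triangle_sub diff_add_cancel norm_triangle_ineq)
      finally have "cmod (kden (seg_pt v b)) \<ge> \<kappa> * exp (C + 2 * b) - 1" by simp
      then have "2 / cmod (kden (seg_pt v b)) \<le> 2 / (\<kappa> * exp (C + 2 * b) - 1)"
        using elim by (intro divide_left_mono mult_pos_pos) auto
      moreover have "\<bar>edgeR b - edgeL b\<bar> \<le> 3 * pi / 2"
        using edgeR_bound(2)[of b] edgeL_less_edgeR[of b] elim by simp
      ultimately show ?thesis
        using elim by (simp only: norm_mult norm_divide norm_of_real norm_numeral) (intro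
          mult_mono; simp)
    qed
    moreover have "(\<lambda>v. 2 / kden (seg_pt v b) * of_real (edgeR b - edgeL b)) integrable_on cbox 0 1"
      using elim by (intro K_integrable_on) simp
    ultimately show ?case
      using has_integral_bound[OF _ integrable_integral, of "2 / (\<kappa> * exp (C
        + 2 * b) - 1) * (3 * pi / 2)"
          "\<lambda>v. 2 / kden (seg_pt v b) * of_real (edgeR b - edgeL b)" 0 1] elim(1)
      unfolding seg_int_def by simp
  qed
  then show ?thesis using T by (rule Lim_null_comparison)
qed

text \<open>Subtracting a multiple of the logarithmic derivative of \<open>kden\<close> from \<open>2 / kden\<close> leaves
  \<open>rem_fun\<close>, which has no pole at \<open>pole\<close>.\<close>
definition quot :: "complex \<Rightarrow> complex" where
  "quot p = (if p = pole then deriv kden pole else (kden p - kden pole) / (p - pole))"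
definition quot_deriv :: "complex \<Rightarrow> complex" where
  "quot_deriv p = (if p = pole then deriv (deriv kden) pole else (deriv kden p - deriv kden pole) /
    (p - pole))"
definition rem_fun :: "complex \<Rightarrow> complex" where
  "rem_fun p = - 2 * quot_deriv p / (quot p * D)"

lemma cont_quot: "continuous_on UNIV quot"
  unfolding quot_def[abs_def]
  by (intro holomorphic_on_imp_continuous_on pole_lemma_open holomorphic_kden) auto

lemma cont_quot_deriv: "continuous_on UNIV quot_deriv"
  unfolding quot_deriv_def[abs_def]
  by (intro holomorphic_on_imp_continuous_on pole_lemma_open holomorphic_deriv holomorphic_kden)
    auto

text \<open>The difference is \<open>2 * (D - deriv kden p) / (kden p * D)\<close>. Numerator and
  denominator both vanish at \<open>pole\<close>; \<open>rem_fun\<close> is the quotient of their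
  divided differences, and the one of \<open>kden\<close> has no zero there because \<open>D\<close>
  is nonzero.\<close>

lemma rem_fun_eq:
  assumes "p \<noteq> pole" "kden p \<noteq> 0"
  shows "2 / kden p = 2 / D * (deriv kden p / kden p) + rem_fun p"
proof -
  have "rem_fun p = - 2 * (deriv kden p - D) / (kden p * D)"
    using assms unfolding rem_fun_def quot_def quot_deriv_def deriv_kden_pole kden_pole by simp
  then show ?thesis using assms D_ne by (simp add: field_simps)
qed

lemma kden_pi: "kden (of_real pi) = - 1" by (simp add: kden_def expT2_pi)

lemma quot_ne:
  assumes "b \<ge> 0" "0 \<le> v" "v \<le> 1" shows "quot (seg_pt v b) \<noteq> 0"
proof (cases "seg_pt v b = pole")
  case False
  then have "kden (seg_pt v b) \<noteq> 0" using seg_pt_closed[OF assms] kden_ne[OF _ False] kden_pi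
    by auto
  then show ?thesis using False by (simp add: quot_def kden_pole)
qed (simp add: quot_def deriv_kden_pole D_ne)

definition rem_int :: "real \<Rightarrow> complex" where
  "rem_int b = integral (cbox 0 1) (\<lambda>v. rem_fun (seg_pt v b) * of_real (edgeR b - edgeL b))"

lemma cont_rem_fun: "continuous_on ({0..} \<times> cbox 0 1) (\<lambda>(b, v). rem_fun (seg_pt v b) * of_real
  (edgeR b - edgeL b))"
proof -
  have seg_pt: "continuous_on ({0..} \<times> cbox 0 1) (\<lambda>x. seg_pt (snd x) (fst x))"
    unfolding seg_pt_def Complex_eq
    by (intro continuous_intros continuous_on_compose2[OF continuous_on_edgeL]
      continuous_on_compose2[OF continuous_on_edgeR]) auto
  show ?thesis
    unfolding rem_fun_def split_beta
    by (intro continuous_intros continuous_on_compose2[OF cont_quot seg_pt]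
      continuous_on_compose2[OF cont_quot_deriv seg_pt]
        continuous_on_compose2[OF continuous_on_edgeL] continuous_on_compose2[OF
          continuous_on_edgeR])
      (auto simp: quot_ne D_ne)
qed

lemma cont_rem_fun_v:
  assumes "b \<ge> 0"
  shows "continuous_on (cbox 0 1) (\<lambda>v. rem_fun (seg_pt v b) * of_real (edgeR b - edgeL b))"
proof -
  have "continuous_on (cbox 0 1) ((\<lambda>(b, v). rem_fun (seg_pt v b) * of_real (edgeR b - edgeL b)) \<circ>
    (\<lambda>v. (b, v)))"
    using assms by (intro continuous_on_compose continuous_intros continuous_on_subset[OF
      cont_rem_fun]) auto
  then show ?thesis by (simp add: o_def)
qed

lemma rem_int_cont: "continuous_on {0..} rem_int"
  unfolding rem_int_def[abs_def] by (rule integral_continuous_on_param[OF cont_rem_fun])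

lemma kden_real: "pi / 3 \<le> a \<Longrightarrow> a \<le> pi \<Longrightarrow> Im (kden (of_real a)) = 0"
proof (cases "a = pi")
  case False
  assume *: "pi / 3 \<le> a" "a \<le> pi"
  with False obtain s where "a = cot_arg s" using cregion_real_cot_arg[of a] by force
  then show ?thesis by (simp add: kden_def expT2_cot_arg)
qed (simp add: kden_pi)

lemma dG1_real:
  assumes "pi / 3 < a" "a < pi" shows "Im (deriv kden (of_real a)) = 0"
proof -
  have "((\<lambda>a. kden (of_real a)) has_vector_derivative deriv kden (of_real a)) (at a)"
    by (rule has_vector_derivative_real_field[OF kden_deriv])
  from has_field_derivative_Im[OF this]
  have "((\<lambda>a. Im (kden (of_real a))) has_field_derivative Im (deriv kden (of_real a))) (at a)" .
  moreover have "((\<lambda>a. Im (kden (of_real a))) has_field_derivative 0) (at a)"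
    by (rule has_field_derivative_transform_within_open[of "\<lambda>_. 0" _ _ "{pi / 3<..<pi}"])
       (use assms kden_real in auto)
  ultimately show ?thesis by (rule DERIV_unique)
qed

text \<open>On the bottom side \<open>kden\<close>, its derivative and \<open>D\<close> are real, so
  \<open>rem_fun\<close> is real apart from the pole and the two end points, which do not affect the
  integral.\<close>

lemma Im_rem_int_0: "Im (rem_int 0) = 0"
proof -
  \<comment> \<open>The parameter at which the bottom segment passes through the pole.\<close>
  define v0 where "v0 = (cot_arg U - pi / 3) / (2 * pi / 3)"
  have Im0: "Im (rem_fun (seg_pt v 0) * of_real (edgeR 0 - edgeL 0)) = 0"
    if v: "v \<in> {0..1} - {v0, 0, 1}" for v
  proof -
    define a where "a = pi / 3 + v * (2 * pi / 3)"
    have p: "seg_pt v 0 = of_real a" by (simp add: a_def seg_pt_real)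
    have "v * (2 * pi / 3) < 1 * (2 * pi / 3)" using v pi_gt_zero
      by (intro mult_strict_right_mono) auto
    moreover have "v * (2 * pi / 3) > 0" using v pi_gt_zero by (intro mult_pos_pos) auto
    ultimately have a: "pi / 3 < a" "a < pi" unfolding a_def by linarith+
    have "v = (a - pi / 3) / (2 * pi / 3)" using pi_gt_zero by (simp add: a_def)
    then have "a \<noteq> cot_arg U" using v by (auto simp: v0_def)
    then have ne: "of_real a \<noteq> pole" by (auto simp: pole_def)
    have G: "kden (of_real a) \<noteq> 0" using a by (intro kden_ne ne of_real_in_cregion) auto
    have e: "rem_fun (of_real a) = 2 / kden (of_real a) - 2 / D * (deriv kden (of_real a) / kden
      (of_real a))"
      using rem_fun_eq[OF ne G] by simp
    have "kden (of_real a) \<in> \<real>" "deriv kden (of_real a) \<in> \<real>" "D \<in> \<real>"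
      using kden_real[of a] dG1_real[OF a] a by (auto simp: complex_is_Real_iff D_def)
    then have "rem_fun (of_real a) \<in> \<real>" unfolding e
      by (intro Reals_diff Reals_divide Reals_mult) auto
    then show ?thesis unfolding p by (simp add: complex_is_Real_iff)
  qed
  have "continuous_on (cbox 0 1) (\<lambda>v. rem_fun (seg_pt v 0) * of_real (edgeR 0 - edgeL 0))"
    by (rule cont_rem_fun_v) simp
  then have "((\<lambda>v. rem_fun (seg_pt v 0) * of_real (edgeR 0 - edgeL 0)) has_integral rem_int 0)
    (cbox 0 1)"
    unfolding rem_int_def by (intro integrable_integral integrable_continuous)
  from has_integral_linear[OF this bounded_linear_Im]
  have "((\<lambda>v. Im (rem_fun (seg_pt v 0) * of_real (edgeR 0 - edgeL 0))) has_integral Im (rem_int 0))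
    {0..1}" by (simp add: o_def)
  moreover have "((\<lambda>v. Im (rem_fun (seg_pt v 0) * of_real (edgeR 0 - edgeL 0))) has_integral 0)
    {0..1}"
    by (rule has_integral_spike_finite[of "{v0, 0, 1}" _ _ "\<lambda>_. 0"]) (use Im0 in auto)
  ultimately show ?thesis by (rule has_integral_unique)
qed

text \<open>On the segment at height \<open>b\<close> the function \<open>kden\<close> runs through the lower half-plane from a
  positive to a negative number, so its argument changes by exactly \<open>- pi\<close>.\<close>
lemma log_deriv_integral:
  assumes "b > 0"
  shows "((\<lambda>v. deriv kden (seg_pt v b) / kden (seg_pt v b) * of_real (edgeR b - edgeL b))
    has_integral
            (Ln (\<i> * kden (seg_pt 1 b)) - Ln (\<i> * kden (seg_pt 0 b)))) (cbox 0 1)"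
    and "Im (Ln (\<i> * kden (seg_pt 1 b)) - Ln (\<i> * kden (seg_pt 0 b))) = - pi"
proof -
  \<comment> \<open>Multiplication by \<open>i\<close> turns the lower half-plane into the right one
    and the real end values into imaginary ones, so the branch cut of \<open>Ln\<close> is never
    met.\<close>
  have slit: "\<i> * kden (seg_pt v b) \<notin> \<real>\<^sub>\<le>\<^sub>0" if v: "v \<in> {0..1}" for v
  proof -
    consider "v = 0" | "v = 1" | "0 < v" "v < 1" using v by force
    then show ?thesis
    proof cases
      case 1
      then show ?thesis using kden_curve_0_pos[OF assms]
        by (simp add: seg_pt_0[OF assms] kden_curve_0[OF assms] complex_nonpos_Reals_iff)
    next
      case 2
      then show ?thesis using kden_curve_pi_half_pos[of b]
        by (simp add: seg_pt_1[OF assms] kden_curve_pi_half[OF assms] complex_nonpos_Reals_iff)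
    next
      case 3
      then show ?thesis using kden_region[OF seg_pt_in_region[OF assms, of v]]
        by (simp add: complex_nonpos_Reals_iff)
    qed
  qed
  have "((\<lambda>v. deriv kden (seg_pt v b) / kden (seg_pt v b) * of_real (edgeR b - edgeL b))
    has_integral
            (Ln (\<i> * kden (seg_pt 1 b)) - Ln (\<i> * kden (seg_pt 0 b)))) {0..1}"
  proof (rule fundamental_theorem_of_calculus)
    fix v :: real assume v: "v \<in> {0..1}"
    have ne: "kden (seg_pt v b) \<noteq> 0" using v by (intro kden_seg_pt_ne assms) auto
    have "((\<lambda>p. Ln (\<i> * kden p)) has_field_derivative inverse (\<i> * kden (seg_pt v b)) * (\<i> * deriv
      kden (seg_pt v b))) (at (seg_pt v b))"
      by (rule DERIV_chain2[where f = Ln and g = "\<lambda>p. \<i> * kden p", OF has_field_derivative_Ln[OF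
        slit[OF v]] DERIV_cmult[OF kden_deriv]])
    then have "((\<lambda>p. Ln (\<i> * kden p)) has_field_derivative deriv kden (seg_pt v b) / kden (seg_pt v
      b)) (at (seg_pt v b))"
      by (rule DERIV_cong) (use ne in \<open>simp add: field_simps\<close>)
    from field_vector_diff_chain_at[OF seg_pt_deriv_v[of b v] this]
    have "((\<lambda>v. Ln (\<i> * kden (seg_pt v b))) has_vector_derivative deriv kden (seg_pt v b) / kden
      (seg_pt v b) * of_real (edgeR b - edgeL b)) (at v)"
      by (simp add: o_def mult.commute)
    then show "((\<lambda>v. Ln (\<i> * kden (seg_pt v b))) has_vector_derivative deriv kden (seg_pt v b) /
      kden (seg_pt v b) * of_real (edgeR b - edgeL b)) (at v within {0..1})"
      by (rule has_vector_derivative_at_within)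
  qed simp
  then show "((\<lambda>v. deriv kden (seg_pt v b) / kden (seg_pt v b) * of_real (edgeR b - edgeL b))
    has_integral
            (Ln (\<i> * kden (seg_pt 1 b)) - Ln (\<i> * kden (seg_pt 0 b)))) (cbox 0 1)" by simp
  have Lni: "Im (Ln (\<i> * of_real x)) = pi / 2" "Im (Ln (\<i> * of_real (- x))) = - (pi / 2)"
    if "x > 0" for x
    using Ln_times_of_real[OF that, of "\<i>"] Ln_times_of_real[OF that, of "- \<i>"] that
    by (simp_all add: mult.commute)
  show "Im (Ln (\<i> * kden (seg_pt 1 b)) - Ln (\<i> * kden (seg_pt 0 b))) = - pi"
    unfolding seg_pt_0[OF assms] seg_pt_1[OF assms] kden_curve_0[OF assms] kden_curve_pi_half[OF
      assms]
    using Lni(2)[OF kden_curve_pi_half_pos] Lni(1)[OF kden_curve_0_pos[OF assms]] by simp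
qed

text \<open>The half residue: the argument change \<open>- pi\<close> times
  \<open>2 / D = - sqrt 3 / (2 * U)\<close>, the same at every height.\<close>

lemma Im_seg_int_eq:
  assumes "b > 0"
  shows "Im (seg_int b) = sqrt 3 * pi / (2 * U) + Im (rem_int b)"
proof -
  let ?L = "Ln (\<i> * kden (seg_pt 1 b)) - Ln (\<i> * kden (seg_pt 0 b))"
  have "continuous_on (cbox 0 1) (\<lambda>v. rem_fun (seg_pt v b) * of_real (edgeR b - edgeL b))"
    using assms by (intro cont_rem_fun_v) simp
  then have J: "((\<lambda>v. rem_fun (seg_pt v b) * of_real (edgeR b - edgeL b)) has_integral rem_int b)
    (cbox 0 1)"
    unfolding rem_int_def by (intro integrable_integral integrable_continuous)
  have "((\<lambda>v. 2 / D * (deriv kden (seg_pt v b) / kden (seg_pt v b) * of_real (edgeR b - edgeL b))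
    + rem_fun (seg_pt v b) * of_real (edgeR b - edgeL b))
      has_integral (2 / D * ?L + rem_int b)) (cbox 0 1)"
    by (intro has_integral_add has_integral_mult_right log_deriv_integral(1) assms J)
  then have "((\<lambda>v. 2 / kden (seg_pt v b) * of_real (edgeR b - edgeL b)) has_integral (2 / D * ?L
    + rem_int b)) (cbox 0 1)"
  proof (rule has_integral_eq[rotated])
    fix v :: real assume "v \<in> cbox 0 1"
    then have v: "0 \<le> v" "v \<le> 1" by auto
    have "seg_pt v b \<noteq> pole" using assms by (auto simp: pole_def complex_eq_iff)
    from rem_fun_eq[OF this kden_seg_pt_ne[OF assms v]]
    show "2 / D * (deriv kden (seg_pt v b) / kden (seg_pt v b) * of_real (edgeR b - edgeL b))
      + rem_fun (seg_pt v b) * of_real (edgeR b - edgeL b)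
      = 2 / kden (seg_pt v b) * of_real (edgeR b - edgeL b)" by (simp only: distrib_right
        mult.assoc)
  qed
  then have "seg_int b = 2 / D * ?L + rem_int b" unfolding seg_int_def by (rule integral_unique)
  moreover have "2 / D = of_real (- (sqrt 3 / (2 * U)))"
    using U by (simp add: D_def field_simps)
  moreover have "Im (of_real (- (sqrt 3 / (2 * U))) * ?L) = - (sqrt 3 / (2 * U)) * Im ?L"
    by (simp add: times_complex.sel)
  ultimately show ?thesis using log_deriv_integral(2)[OF assms] by simp
qed

text \<open>\<open>- Im seg_int\<close> is a primitive of the nonnegative function
  \<open>K_edge\<close> with known limits at both ends, so integrability and value come
  together.\<close>

lemma kernel_integral:
  "set_integrable lborel (einterval 0 \<infinity>) K_edge" "(LBINT b=0..\<infinity>. K_edge b) = sqrt 3 * pi / (2 * U)"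
proof -
  have K_edge_nonneg: "K_edge b \<ge> 0" if "b > 0" for b
    using kden_curve_0_pos[OF that] \<kappa>_pos unfolding K_edge_def
      by (intro add_nonneg_nonneg divide_nonneg_nonneg) auto
  have lim0: "((\<lambda>b. - Im (seg_int b)) \<longlongrightarrow> - (sqrt 3 * pi / (2 * U))) (at_right 0)"
  proof -
    have "(rem_int \<longlongrightarrow> rem_int 0) (at_right 0)"
      using rem_int_cont[unfolded continuous_on_def, rule_format, of 0]
        by (simp add: at_within_Ici_at_right)
    then have "((\<lambda>b. - (sqrt 3 * pi / (2 * U) + Im (rem_int b))) \<longlongrightarrow> - (sqrt 3 * pi / (2 * U)
      + Im (rem_int 0))) (at_right 0)"
      by (intro tendsto_intros)
    then have "((\<lambda>b. - (sqrt 3 * pi / (2 * U) + Im (rem_int b))) \<longlongrightarrow> - (sqrt 3 * pi / (2 * U)))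
      (at_right 0)"
      by (simp add: Im_rem_int_0)
    then show ?thesis
      by (rule Lim_transform_eventually) (auto simp: eventually_at_filter Im_seg_int_eq)
  qed
  have limT: "((\<lambda>b. - Im (seg_int b)) \<longlongrightarrow> 0) at_top"
    using tendsto_minus[OF tendsto_Im[OF seg_int_at_top]] by simp
  have cont: "isCont K_edge b" if "b > 0" for b
  proof -
    have "isCont (curve_T m) b" for m using curve_T_deriv[OF that] by (rule DERIV_isCont)
    moreover have "\<kappa> * exp (curve_T (pi / 2) b) + 1 \<noteq> 0" using \<kappa>_pos
      by (metis add_pos_pos exp_gt_zero less_irrefl mult_pos_pos zero_less_one)
    ultimately show ?thesis unfolding K_edge_def[abs_def]
      using kden_curve_0_pos[OF that] by (intro continuous_intros) auto
  qed
  have A: "(((\<lambda>b. - Im (seg_int b)) \<circ> real_of_ereal) \<longlongrightarrow> - (sqrt 3 * pi / (2 * U))) (at_right 0)"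
    using lim0 unfolding zero_ereal_def ereal_tendsto_simps .
  have B: "(((\<lambda>b. - Im (seg_int b)) \<circ> real_of_ereal) \<longlongrightarrow> 0) (at_left \<infinity>)"
    using limT unfolding ereal_tendsto_simps .
  have quot_deriv: "AE x in lborel. 0 < ereal x \<longrightarrow> ereal x < \<infinity> \<longrightarrow> 0 \<le> K_edge x"
    using K_edge_nonneg by auto
  show "set_integrable lborel (einterval 0 \<infinity>) K_edge"
    by (rule interval_integral_FTC_nonneg(1)[OF _ _ _ quot_deriv A B]) (use Im_seg_int_deriv cont
      in auto)
  have "(LBINT b=0..\<infinity>. K_edge b) = 0 - (- (sqrt 3 * pi / (2 * U)))"
    by (rule interval_integral_FTC_nonneg(2)[OF _ _ _ quot_deriv A B]) (use Im_seg_int_deriv cont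
      in auto)
  then show "(LBINT b=0..\<infinity>. K_edge b) = sqrt 3 * pi / (2 * U)" by simp
qed

end

subsection \<open>The moment generating function\<close>

text \<open>The coefficients of \<open>sqrt (1 - 4 * y)\<close>. Through them the Catalan series and
  the Catalan recursion become facts about the binomial series.\<close>

definition sqrt_coeff :: "nat \<Rightarrow> real" where "sqrt_coeff n = (1 / 2 gchoose n) * (- 4) ^ n"

lemma gbinomial_Suc_times: "of_nat (Suc k) * (a gchoose Suc k) = (a - of_nat k) * (a gchoose k)"
  for a :: real
  using gbinomial_mult_1[of a k] by (simp add: algebra_simps)

lemma central_binomial_Suc: "Suc n * (2 * Suc n choose Suc n) = 2 * (2 * n + 1) * (2 * n choose n)"
proof -
  have "Suc n * (2 * Suc n choose Suc n) = 2 * Suc n * (Suc (2 * n) choose n)"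
    using Suc_times_binomial[of n "Suc (2 * n)"] by simp
  moreover have "Suc (2 * n) choose n = Suc (2 * n) choose Suc n"
    using binomial_symmetric[of n "Suc (2 * n)"] by simp
  moreover have "Suc n * (Suc (2 * n) choose Suc n) = Suc (2 * n) * (2 * n choose n)"
    by (rule Suc_times_binomial)
  ultimately show ?thesis by (simp only: mult.assoc Suc_eq_plus1)
qed

text \<open>Both sides start with 1 and obey the same two-term recursion, from
  \<open>central_binomial_Suc\<close> and \<open>gbinomial_Suc_times\<close>.\<close>

lemma central_binomial_sqrt_coeff: "real (2 * n choose n) = real (Suc n) * (- sqrt_coeff (Suc n) /
  2)"
proof (induction n)
  case 0
  then show ?case by (simp add: sqrt_coeff_def)
next
  case (Suc n)
  have g: "real (Suc (Suc n)) * (1 / 2 gchoose Suc (Suc n)) = (1 / 2 - real (Suc n)) * (1 / 2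
    gchoose Suc n :: real)"
    by (rule gbinomial_Suc_times)
  have "real (Suc (Suc n)) * (- sqrt_coeff (Suc (Suc n)) / 2)
      = (real (Suc (Suc n)) * (1 / 2 gchoose Suc (Suc n))) * (- ((- 4) ^ Suc (Suc n)) / 2)"
    unfolding sqrt_coeff_def by (simp only: mult_ac minus_mult_right times_divide_eq_right)
  also have "\<dots> = 2 * (2 * real n + 1) * (- sqrt_coeff (Suc n) / 2)"
    unfolding g sqrt_coeff_def by (simp add: field_simps)
  finally have *: "real (Suc n) * (real (Suc (Suc n)) * (- sqrt_coeff (Suc (Suc n)) / 2)) =
      2 * (2 * real n + 1) * real (2 * n choose n)"
    unfolding Suc.IH by simp
  also have "\<dots> = real (Suc n * (2 * Suc n choose Suc n))" unfolding central_binomial_Suc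
    by (simp add: algebra_simps)
  finally show ?case
    by (simp only: of_nat_mult mult_cancel_left of_nat_eq_0_iff nat.distinct simp_thms)
qed

lemma catalan_sqrt_coeff: "real (catalan n) = - sqrt_coeff (Suc n) / 2"
proof -
  \<comment> \<open>\<open>catalan\<close> is a quotient of naturals, so exactness comes first; the
    cofactor is a difference of neighbouring binomial coefficients.\<close>
  have "Suc n dvd (2 * n choose n)"
  proof (cases n)
    case (Suc k)
    have 1: "Suc n * (2 * n choose Suc n) = n * (2 * n choose n)"
    proof -
      have "Suc n * (2 * n choose Suc n) = 2 * n * (2 * n - 1 choose n)"
        by (rule binomial_absorption)
      also have "\<dots> = (2 * n - n) * (2 * n choose n)" by (rule binomial_absorb_comp[symmetric])
      finally show ?thesis by simp
    qed
    have "Suc n * ((2 * n choose n) - (2 * n choose Suc n)) = (2 * n choose n)"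
      unfolding diff_mult_distrib2 1 by simp
    then show ?thesis by (metis dvd_triv_left)
  qed simp
  then have "real (catalan n) = real (2 * n choose n) / real (Suc n)"
    unfolding catalan_def by (simp add: real_of_nat_div)
  also have "\<dots> = - sqrt_coeff (Suc n) / 2"
    unfolding central_binomial_sqrt_coeff by (rule nonzero_mult_div_cancel_left) simp
  finally show ?thesis .
qed

lemma catalan_0: "catalan 0 = 1" by (simp add: catalan_def)

lemma catalan_le: "real (catalan n) \<le> 4 ^ n"
proof -
  have "catalan n \<le> (2 * n choose n)" unfolding catalan_def by simp
  also have "\<dots> \<le> 2 ^ (2 * n)" by (rule binomial_le_pow2)
  also have "\<dots> = 4 ^ n" by (simp add: power_mult)
  finally have "catalan n \<le> 4 ^ n" .
  then show ?thesis by (metis of_nat_le_iff of_nat_numeral of_nat_power)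
qed

text \<open>The square of \<open>sqrt (1 - 4 * y)\<close> has degree 1, so the self-convolution of
  its coefficients vanishes from degree 2 on: this is Vandermonde with \<open>1/2 + 1/2 = 1\<close>.
  The two outer terms give the left-hand side.\<close>

lemma catalan_Suc: "real (catalan (Suc n)) = (\<Sum>m\<le>n. real (catalan m) * real (catalan (n - m)))"
proof -
  let ?N = "Suc (Suc n)"
  have "(\<Sum>k\<in>{0..?N}. sqrt_coeff k * sqrt_coeff (?N - k)) = (\<Sum>k\<in>{0..?N}. ((1 / 2 gchoose k) * (1 / 2
    gchoose (?N - k))) * (- 4) ^ ?N)"
  proof (intro sum.cong refl)
    fix k assume "k \<in> {0..?N}"
    then have "(- 4 :: real) ^ ?N = (- 4) ^ k * (- 4) ^ (?N - k)"
      by (simp add: power_add[symmetric] del: power_Suc)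
    then show "sqrt_coeff k * sqrt_coeff (?N - k) = ((1 / 2 gchoose k) * (1 / 2 gchoose (?N - k)))
      * (- 4) ^ ?N"
      by (simp only: sqrt_coeff_def mult_ac)
  qed
  also have "\<dots> = ((1 / 2 + 1 / 2 :: real) gchoose ?N) * (- 4) ^ ?N"
    unfolding gbinomial_Vandermonde[symmetric] sum_distrib_right ..
  also have "(1 / 2 + 1 / 2 :: real) gchoose ?N = 0"
    using binomial_gbinomial[of 1 ?N, where ?'a = real] by simp
  finally have "(\<Sum>k\<le>?N. sqrt_coeff k * sqrt_coeff (?N - k)) = 0" by (simp add: atLeast0AtMost)
  moreover have "(\<Sum>k\<le>?N. sqrt_coeff k * sqrt_coeff (?N - k)) = 2 * sqrt_coeff ?N
    + (\<Sum>m\<le>n. sqrt_coeff (Suc m) * sqrt_coeff (Suc (n - m)))"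
  proof -
    have "(\<Sum>k\<le>?N. sqrt_coeff k * sqrt_coeff (?N - k)) = (\<Sum>k\<le>Suc n. sqrt_coeff k * sqrt_coeff (?N -
      k)) + sqrt_coeff ?N * sqrt_coeff 0" by simp
    also have "(\<Sum>k\<le>Suc n. sqrt_coeff k * sqrt_coeff (?N - k)) = sqrt_coeff 0 * sqrt_coeff ?N
      + (\<Sum>m\<le>n. sqrt_coeff (Suc m) * sqrt_coeff (?N - Suc m))"
      by (subst sum.atMost_Suc_shift) simp
    also have "(\<Sum>m\<le>n. sqrt_coeff (Suc m) * sqrt_coeff (?N - Suc m))
      = (\<Sum>m\<le>n. sqrt_coeff (Suc m) * sqrt_coeff (Suc (n - m)))"
      by (intro sum.cong refl) (simp add: Suc_diff_le)
    finally show ?thesis by (simp add: sqrt_coeff_def[of 0])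
  qed
  moreover have "(\<Sum>m\<le>n. real (catalan m) * real (catalan (n - m)))
    = (\<Sum>m\<le>n. sqrt_coeff (Suc m) * sqrt_coeff (Suc (n - m))) / 4"
    unfolding catalan_sqrt_coeff by (simp add: sum_divide_distrib)
  ultimately show ?thesis unfolding catalan_sqrt_coeff by simp
qed

text \<open>Kept multiplied by \<open>2 * y\<close>, so that \<open>y = 0\<close> is not
  exceptional.\<close>

lemma catalan_sums:
  assumes "\<bar>y\<bar> < 1 / 4"
  shows "(\<lambda>m. 2 * y * (real (catalan m) * y ^ m)) sums (1 - sqrt (1 - 4 * y))"
proof -
  have "\<bar>- 4 * y\<bar> < 1" using assms by (simp add: abs_mult)
  from gen_binomial_real[OF this, of "1 / 2"]
  have "(\<lambda>n. sqrt_coeff n * y ^ n) sums ((1 + - 4 * y) powr (1 / 2))"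
    by (simp add: sqrt_coeff_def power_mult_distrib mult.assoc flip: power_mult_distrib)
  moreover have "(1 + - 4 * y) powr (1 / 2) = sqrt (1 - 4 * y)"
    using assms by (simp add: powr_half_sqrt)
  ultimately have "(\<lambda>n. sqrt_coeff n * y ^ n) sums sqrt (1 - 4 * y)" by simp
  then have "(\<lambda>n. sqrt_coeff (Suc n) * y ^ Suc n) sums (sqrt (1 - 4 * y) - sqrt_coeff 0 * y ^ 0)"
    by (subst sums_Suc_iff[of "\<lambda>n. sqrt_coeff n * y ^ n"]) simp
  from sums_minus[OF this]
  show ?thesis by (simp add: catalan_sqrt_coeff sqrt_coeff_def[of 0] algebra_simps)
qed

section \<open>Bounds and generating function of the polynomials\<close>

definition vP_int :: "nat \<Rightarrow> real \<Rightarrow> real" where "vP_int m s = (LBINT t=0..s. vP m t)"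

lemma vP_Suc: "vP (Suc n) s =
    (\<Sum>m\<le>n. (vP_int m s + real (catalan m) / 2 ^ m * (1 - s) ^ (m + 1)) * vP (n - m) s)"
  by (simp add: vP_int_def)

declare vP.simps(2) [simp del]

text \<open>Continuity is assumed because its own inductive proof uses this lemma;
  \<open>vP_int_deriv\<close> is the unconditional form.\<close>

lemma vP_int_deriv_aux:
  assumes "continuous_on {0..1} (vP m)" "s \<in> {0..1}"
  shows "(vP_int m has_field_derivative vP m s) (at s within {0..1})"
proof -
  have "((\<lambda>u. LBINT y=(0::real)..u. vP m y) has_vector_derivative vP m s) (at s within {0..1})"
    by (rule interval_integral_FTC2) (use assms in auto)
  then show ?thesis
    by (simp add: vP_int_def[abs_def] has_real_derivative_iff_has_vector_derivative flip:
      zero_ereal_def)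
qed

lemma continuous_on_vP: "continuous_on {0..1} (vP n)"
proof (induction n rule: less_induct)
  case (less n)
  show ?case
  proof (cases n)
    case 0
    then show ?thesis by simp
  next
    case (Suc k)
    have "continuous_on {0..1} (vP_int m)" if "m \<le> k" for m
      using vP_int_deriv_aux[OF less] that Suc by (intro DERIV_continuous_on[where D = "vP m"]) auto
    then show ?thesis unfolding Suc vP_Suc[abs_def]
      using less Suc by (intro continuous_intros) auto
  qed
qed

lemmas vP_int_deriv = vP_int_deriv_aux[OF continuous_on_vP]

lemma vP_int_0: "vP_int m 0 = 0" by (simp add: vP_int_def flip: zero_ereal_def)

lemma vP_int_bound:
  assumes "\<And>s. s \<in> {0..1} \<Longrightarrow> \<bar>vP m s\<bar> \<le> c" "s \<in> {0..1}"
  shows "\<bar>vP_int m s\<bar> \<le> c * s"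
proof -
  have "norm (vP_int m s - vP_int m 0) \<le> c * norm (s - 0)"
    by (rule field_differentiable_bound[of "{0..1}" "vP_int m" "vP m"]) (use assms vP_int_deriv in
      auto)
  then show ?thesis using assms by (simp add: vP_int_0)
qed

text \<open>The two parts are bounded by the Catalan number times \<open>s\<close> and times
  \<open>1 - s\<close>. So the recursion for \<open>vP\<close> is dominated by the Catalan
  recursion.\<close>

lemma vP_coeff_bound:
  assumes "\<And>s. s \<in> {0..1} \<Longrightarrow> \<bar>vP m s\<bar> \<le> real (catalan m)" "s \<in> {0..1}"
  shows "\<bar>vP_int m s + real (catalan m) / 2 ^ m * (1 - s) ^ (m + 1)\<bar> \<le> real (catalan m)"
proof -
  have J: "\<bar>vP_int m s\<bar> \<le> real (catalan m) * s" using assms by (intro vP_int_bound)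
  have "(1 - s) ^ (m + 1) \<le> (1 - s) ^ 1" using assms(2) by (intro power_decreasing) auto
  moreover have "real (catalan m) / 2 ^ m \<le> real (catalan m)"
    by (simp add: divide_le_eq mult_le_cancel_left1)
  ultimately have "real (catalan m) / 2 ^ m * (1 - s) ^ (m + 1) \<le> real (catalan m) * (1 - s)"
    using assms(2) by (intro mult_mono) auto
  moreover have "real (catalan m) / 2 ^ m * (1 - s) ^ (m + 1) \<ge> 0" using assms(2) by simp
  ultimately have "\<bar>vP_int m s + real (catalan m) / 2 ^ m * (1 - s) ^ (m + 1)\<bar>
      \<le> real (catalan m) * s + real (catalan m) * (1 - s)"
    using J by linarith
  also have "\<dots> = real (catalan m)" by (simp add: algebra_simps)
  finally show ?thesis .
qed

lemma vP_bound: "s \<in> {0..1} \<Longrightarrow> \<bar>vP n s\<bar> \<le> real (catalan n)"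
proof (induction n arbitrary: s rule: less_induct)
  case (less n)
  show ?case
  proof (cases n)
    case 0
    then show ?thesis by (simp add: catalan_0)
  next
    case (Suc k)
    have "\<bar>vP n s\<bar> \<le> (\<Sum>m\<le>k. \<bar>(vP_int m s + real (catalan m) / 2 ^ m * (1 - s) ^ (m
      + 1)) * vP (k - m) s\<bar>)"
      unfolding Suc vP_Suc by (rule sum_abs)
    also have "\<dots> \<le> (\<Sum>m\<le>k. real (catalan m) * real (catalan (k - m)))"
    proof (rule sum_mono)
      fix m assume m: "m \<in> {..k}"
      have "\<bar>vP_int m s + real (catalan m) / 2 ^ m * (1 - s) ^ (m + 1)\<bar> \<le> real (catalan m)"
        using less m Suc by (intro vP_coeff_bound) auto
      then show "\<bar>(vP_int m s + real (catalan m) / 2 ^ m * (1 - s) ^ (m + 1)) * vP (k - m) s\<bar>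
          \<le> real (catalan m) * real (catalan (k - m))"
        unfolding abs_mult using less m Suc by (intro mult_mono) auto
    qed
    finally show ?thesis unfolding Suc catalan_Suc .
  qed
qed

text \<open>With \<open>g\<close> the integral of the generating function \<open>P\<close>, the
  recursion reads \<open>P * (\<sigma> - t * g) = 1\<close>. Hence
  \<open>Q = \<sigma> - t * g\<close> satisfies \<open>Q' = t / \<sigma> - t / Q\<close>, where
  \<open>\<sigma>' = t / \<sigma>\<close>. This is homogeneous in \<open>Q\<close> and
  \<open>\<sigma>\<close>, the ratio \<open>v = Q / \<sigma>\<close> separates, and
  \<open>ln \<sigma> + T_prim v\<close> is constant. At \<open>s = 0\<close> the ratio is 1, a zero
  of \<open>T_prim\<close>; at \<open>s = 1\<close> it is \<open>Q 1\<close>, which becomes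
  \<open>U\<close>.\<close>

lemma vP_series:
  assumes t: "\<bar>t\<bar> \<le> 1 / 8"
  obtains U where "U > 0" "1 - 2 * t = exp (2 * T_prim U)" "(\<lambda>n. vP n 1 * t ^ n) sums (1 / U)"
proof -
  \<comment> \<open>The constant 1/8 is chosen here: against Catalan growth \<open>4 ^ n\<close> it
    leaves the ratio 1/2.\<close>
  have C: "\<bar>real (catalan n) * t ^ n\<bar> \<le> (1 / 2) ^ n" for n
  proof -
    have "\<bar>real (catalan n) * t ^ n\<bar> \<le> 4 ^ n * (1 / 8) ^ n"
      unfolding abs_mult power_abs using t catalan_le by (intro mult_mono power_mono) auto
    also have "\<dots> = (1 / 2) ^ n" by (simp flip: power_mult_distrib)
    finally show ?thesis .
  qed
  have bd: "\<bar>vP n s * t ^ n\<bar> \<le> (1 / 2) ^ n" if "s \<in> {0..1}" for n s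
  proof -
    have "\<bar>vP n s * t ^ n\<bar> \<le> \<bar>real (catalan n) * t ^ n\<bar>"
      unfolding abs_mult using vP_bound[OF that, of n] by (intro mult_right_mono) auto
    then show ?thesis using C[of n] by linarith
  qed
  have geo: "summable (\<lambda>n. (1 / 2 :: real) ^ n)" by simp
  define P where "P s = (\<Sum>n. vP n s * t ^ n)" for s
  have sumP: "summable (\<lambda>n. norm (vP n s * t ^ n))" if "s \<in> {0..1}" for s
    using bd[OF that] by (intro summable_comparison_test'[OF geo]) auto
  have ul: "uniform_limit {0..1} (\<lambda>n s. \<Sum>i<n. vP i s * t ^ i) P sequentially"
    unfolding P_def using bd geo by (intro Weierstrass_m_test) auto
  have "\<exists>g. \<forall>s\<in>{0..1}. (\<lambda>n. vP_int n s * t ^ n) sums g s \<and> (g has_field_derivative P s) (at s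
    within {0..1})"
  proof (rule has_field_derivative_series[OF _ _ ul])
    show "((\<lambda>s. vP_int n s * t ^ n) has_field_derivative vP n s * t ^ n) (at s within {0..1})"
      if "s \<in> {0..1}" for n s
      using vP_int_deriv[OF that] by (rule DERIV_cmult_right)
    show "summable (\<lambda>n. vP_int n 0 * t ^ n)" by (simp add: vP_int_0)
  qed auto
  then obtain g where g: "\<And>s. s \<in> {0..1} \<Longrightarrow> (\<lambda>n. vP_int n s * t ^ n) sums g s"
     "\<And>s. s \<in> {0..1} \<Longrightarrow> (g has_field_derivative P s) (at s within {0..1})" by blast
  have g0: "g 0 = 0" using g(1)[of 0] sums_unique2[OF _ sums_zero] by (simp add: vP_int_0)
  \<comment> \<open>The Catalan part of the recursion sums to \<open>1 - \<sigma>\<close>, by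
    \<open>catalan_sums\<close> at \<open>y = t * (1 - s) / 2\<close>.\<close>
  define \<sigma> where "\<sigma> s = sqrt (1 - 2 * t * (1 - s))" for s
  have rad: "1 - 2 * t * (1 - s) > 0" if "s \<in> {0..1}" for s
  proof -
    have "\<bar>2 * t * (1 - s)\<bar> \<le> (2 * (1 / 8)) * 1"
      unfolding abs_mult using t that by (intro mult_mono) auto
    then show ?thesis by linarith
  qed
  have \<sigma>_pos: "\<sigma> s > 0" if "s \<in> {0..1}" for s using rad[OF that] by (simp add: \<sigma>_def)
  have key: "P s * (\<sigma> s - t * g s) = 1" if s: "s \<in> {0..1}" for s
  proof -
    define a where "a m = (vP_int m s + real (catalan m) / 2 ^ m * (1 - s) ^ (m + 1)) * t ^ m" for m
    have "\<bar>t * (1 - s) / 2\<bar> < 1 / 4"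
    proof -
      have "\<bar>t * (1 - s)\<bar> \<le> (1 / 8) * 1" unfolding abs_mult using t s by (intro mult_mono) auto
      then show ?thesis by (simp add: abs_mult)
    qed
    then have cs: "(\<lambda>m. t * (real (catalan m) / 2 ^ m * (1 - s) ^ (m + 1) * t ^ m)) sums (1 - \<sigma> s)"
    proof -
      have "2 * (t * (1 - s) / 2) * (real (catalan m) * (t * (1 - s) / 2) ^ m) =
          t * (real (catalan m) / 2 ^ m * (1 - s) ^ (m + 1) * t ^ m)" for m
        by (simp add: power_divide power_mult_distrib)
      moreover have "1 - 4 * (t * (1 - s) / 2) = 1 - 2 * t * (1 - s)" by simp
      ultimately show ?thesis
        using catalan_sums[OF \<open>\<bar>t * (1 - s) / 2\<bar> < 1 / 4\<close>] unfolding \<sigma>_def by (simp only:)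
    qed
    have ta: "(\<lambda>m. t * a m) sums (t * g s + (1 - \<sigma> s))"
      using sums_add[OF sums_mult[OF g(1)[OF s], of t] cs] by (simp add: a_def algebra_simps)
    have sum_a: "summable (\<lambda>m. norm (t * a m))"
    proof (rule summable_comparison_test'[OF geo])
      fix m
      have "\<bar>vP_int m s + real (catalan m) / 2 ^ m * (1 - s) ^ (m + 1)\<bar> \<le> real (catalan m)"
        using vP_bound s by (rule vP_coeff_bound)
      then have "\<bar>a m\<bar> \<le> \<bar>real (catalan m) * t ^ m\<bar>"
        unfolding a_def abs_mult by (intro mult_right_mono) auto
      then have "\<bar>a m\<bar> \<le> (1 / 2) ^ m" using C[of m] by linarith
      then have "\<bar>t\<bar> * \<bar>a m\<bar> \<le> 1 * (1 / 2) ^ m" using t by (intro mult_mono) auto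
      then show "norm (norm (t * a m)) \<le> (1 / 2) ^ m" by (simp add: abs_mult)
    qed
    have "(\<lambda>n. \<Sum>m\<le>n. (t * a m) * (vP (n - m) s * t ^ (n - m))) sums ((\<Sum>m. t * a m) * P s)"
      unfolding P_def by (rule Cauchy_product_sums[OF sum_a sumP[OF s]])
    moreover have "(\<Sum>m\<le>n. (t * a m) * (vP (n - m) s * t ^ (n - m))) = vP (Suc n) s * t ^ Suc n"
      for n
    proof -
      have "(t * a m) * (vP (n - m) s * t ^ (n - m)) =
        (vP_int m s + real (catalan m) / 2 ^ m * (1 - s) ^ (m + 1)) * vP (n - m) s * t ^ Suc
          n" if "m \<le> n" for m
      proof -
        have "t ^ Suc n = t * (t ^ m * t ^ (n - m))" using that by (simp flip: power_add)
        then show ?thesis by (simp only: a_def mult_ac)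
      qed
      then show ?thesis unfolding vP_Suc sum_distrib_right by (intro sum.cong) auto
    qed
    ultimately have "(\<lambda>n. vP (Suc n) s * t ^ Suc n) sums ((t * g s + (1 - \<sigma> s)) * P s)"
      using sums_unique[OF ta] by simp
    then have "(\<lambda>n. vP n s * t ^ n) sums ((t * g s + (1 - \<sigma> s)) * P s + vP 0 s * t ^ 0)"
      by (rule sums_Suc)
    then have "P s = (t * g s + (1 - \<sigma> s)) * P s + 1" unfolding P_def by (simp add: sums_iff)
    then show ?thesis by (simp add: algebra_simps)
  qed
  define Q where "Q s = \<sigma> s - t * g s" for s
  have PQ: "P s = 1 / Q s" "Q s \<noteq> 0" if "s \<in> {0..1}" for s
  proof -
    have k: "P s * Q s = 1" using key[OF that] by (simp add: Q_def)
    then show "Q s \<noteq> 0" by auto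
    then show "P s = 1 / Q s" using k by (subst nonzero_eq_divide_eq)
  qed
  have d\<sigma>: "(\<sigma> has_field_derivative t / \<sigma> s) (at s within {0..1})" if s: "s \<in> {0..1}" for s
  proof -
    have "((\<lambda>s. 1 - 2 * t * (1 - s)) has_field_derivative 2 * t) (at s within {0..1})"
      by (auto intro!: derivative_eq_intros)
    from DERIV_chain2[OF DERIV_real_sqrt[OF rad[OF s]] this]
    show ?thesis by (simp add: \<sigma>_def[abs_def] field_simps)
  qed
  have dQ: "(Q has_field_derivative (t / \<sigma> s - t / Q s)) (at s within {0..1})"
    if s: "s \<in> {0..1}" for s
    unfolding Q_def[abs_def]
    using DERIV_diff[OF d\<sigma>[OF s] DERIV_cmult[OF g(2)[OF s], of t]] PQ[OF s] by (simp add: Q_def)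
  define v where "v s = Q s / \<sigma> s" for s
  have "\<exists>c. \<forall>s\<in>{0..1}. ln (\<sigma> s) + T_prim (v s) = c"
  proof (rule has_field_derivative_zero_constant)
    fix s :: real assume s: "s \<in> {0..1}"
    have ne: "\<sigma> s \<noteq> 0" "Q s \<noteq> 0" "v s \<noteq> 0" using \<sigma>_pos[OF s] PQ[OF s] by (auto simp: v_def)
    have dv: "(v has_field_derivative ((t / \<sigma> s - t / Q s) * \<sigma> s - Q s * (t / \<sigma> s)) / (\<sigma> s * \<sigma> s))
      (at s within {0..1})"
      unfolding v_def[abs_def] by (rule DERIV_divide[OF dQ[OF s] d\<sigma>[OF s] ne(1)])
    have "((\<lambda>s. ln (\<sigma> s) + T_prim (v s)) has_field_derivative
       (1 / \<sigma> s * (t / \<sigma> s) + v s / ((v s)\<^sup>2 - v s + 1) * (((t / \<sigma> s - t / Q s) * \<sigma> s - Q s * (t /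
         \<sigma> s)) / (\<sigma> s * \<sigma> s))))
       (at s within {0..1})"
      by (intro DERIV_add DERIV_chain2[OF DERIV_ln_divide d\<sigma>] DERIV_chain2[OF T_prim_deriv dv]
        \<sigma>_pos s)
    also have "((t / \<sigma> s - t / Q s) * \<sigma> s - Q s * (t / \<sigma> s)) / (\<sigma> s * \<sigma> s)
      = - (t / (\<sigma> s)\<^sup>2) * ((v s)\<^sup>2 - v s + 1) / v s"
      using ne(1,2) by (simp add: v_def field_simps power2_eq_square)
    also have "1 / \<sigma> s * (t / \<sigma> s) + v s / ((v s)\<^sup>2 - v s + 1) * (- (t / (\<sigma> s)\<^sup>2) * ((v s)\<^sup>2 - v s
      + 1) / v s) = 0"
    proof -
      have "v s / q * (- x * q / v s) = - x" if "q \<noteq> 0" for q x :: real using that ne(3) by simp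
      moreover have "(v s)\<^sup>2 - v s + 1 \<noteq> 0" using quad_pos[of "v s"] by simp
      ultimately show ?thesis by (simp add: power2_eq_square)
    qed
    finally show "((\<lambda>s. ln (\<sigma> s) + T_prim (v s)) has_field_derivative 0) (at s within {0..1})" .
  qed auto
  then obtain c where c: "\<And>s. s \<in> {0..1} \<Longrightarrow> ln (\<sigma> s) + T_prim (v s) = c" by blast
  have v0: "v 0 = 1" using \<sigma>_pos[of 0] by (simp add: v_def Q_def g0)
  have v1: "v 1 = Q 1" by (simp add: v_def \<sigma>_def)
  have "T_prim (Q 1) = ln (\<sigma> 0)"
    using c[of 0] c[of 1] by (simp add: v0 v1 T_prim_1 \<sigma>_def)
  also have "\<dots> = ln (1 - 2 * t) / 2" using rad[of 0] by (simp add: \<sigma>_def ln_sqrt)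
  finally have "2 * T_prim (Q 1) = ln (1 - 2 * t)" by simp
  then have H: "exp (2 * T_prim (Q 1)) = 1 - 2 * t"
    using rad[of 0] by (simp del: exp_ln add: exp_ln)
  \<comment> \<open>\<open>Q\<close> starts positive and has no zero, because its product with
    \<open>P\<close> is 1.\<close>
  have Q1: "Q 1 > 0"
  proof (rule ccontr)
    assume "\<not> Q 1 > 0"
    moreover have "Q 0 > 0" using \<sigma>_pos[of 0] by (simp add: Q_def g0)
    moreover have "continuous_on {0..1} Q" using dQ by (rule DERIV_continuous_on)
    ultimately have "\<exists>x\<ge>0. x \<le> 1 \<and> Q x = 0" by (intro IVT2') auto
    then show False using PQ(2) by auto
  qed
  have "(\<lambda>n. vP n 1 * t ^ n) sums P 1"
    unfolding P_def by (rule summable_sums[OF summable_norm_cancel[OF sumP]]) simp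
  then have "(\<lambda>n. vP n 1 * t ^ n) sums (1 / Q 1)" using PQ(1)[of 1] by simp
  then show ?thesis using that[OF Q1] H by simp
qed

subsection \<open>The density along the boundary curves\<close>

abbreviation T2_0 :: real where "T2_0 \<equiv> 2 * sqrt 3 * pi / 9"
definition x_max :: real where "x_max = sqrt (2 + gamma0)"
text \<open>Both parameters solve \<open>x^2 = 2 * g / (g - 1)\<close>: on the left edge
  \<open>g\<close> is \<open>exp (curve_T 0 b) > 1\<close>, on the right edge \<open>g\<close> is
  minus an exponential. The left edge gives \<open>x\<close> above \<open>sqrt 2\<close>, the right
  edge \<open>x\<close> below, and infinite height is \<open>sqrt 2\<close> itself.\<close>

definition x_outer :: "real \<Rightarrow> real" where "x_outer b = sqrt (2 / (1 - exp (- curve_T 0 b)))"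
definition x_inner :: "real \<Rightarrow> real" where "x_inner b = sqrt (2 / (1 + exp (- curve_T (pi / 2) b)))"

lemma T2_0_pos: "T2_0 > 0" by simp

lemma two_plus_gamma0: "2 + gamma0 = 2 / (1 - exp (- T2_0))"
proof -
  have "exp T2_0 \<noteq> 1" "exp T2_0 \<noteq> 0" using T2_0_pos by auto
  then show ?thesis unfolding gamma0_def exp_minus by (simp add: field_simps)
qed

lemma gamma0_pos: "gamma0 > 0"
  unfolding gamma0_def using T2_0_pos by (intro divide_pos_pos) auto

lemma x_max_gt: "sqrt 2 < x_max" using gamma0_pos by (simp add: x_max_def)

lemma x_max_pos: "x_max > 0" using gamma0_pos by (simp add: x_max_def add_pos_pos)

lemma x_max_sq: "x_max\<^sup>2 = 2 + gamma0" using gamma0_pos by (simp add: x_max_def add_nonneg_nonneg)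

text \<open>A crude bound from \<open>sqrt 3 * pi >= 9 / 2\<close>. For \<open>|t| <= 1/8\<close> it
  keeps \<open>|t * x^2|\<close> at most 1/2 on the support.\<close>

lemma x_max_sq_le: "x_max\<^sup>2 \<le> 4"
proof -
  have "1 + T2_0 \<le> exp T2_0" by (rule exp_ge_add_one_self)
  moreover have "T2_0 \<ge> 1"
  proof -
    have "sqrt 3 \<ge> sqrt (9 / 4)" by (subst real_sqrt_le_iff) simp
    also have "sqrt (9 / 4) = (3 / 2 :: real)" by (simp add: real_sqrt_divide)
    finally have "sqrt 3 * pi \<ge> 3 / 2 * 3" using pi_gt3 by (intro mult_mono) auto
    then show ?thesis by simp
  qed
  ultimately have "exp T2_0 - 1 \<ge> 1" by linarith
  then have "gamma0 \<le> 2 / 1" unfolding gamma0_def by (intro divide_left_mono) auto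
  then show ?thesis by (simp add: x_max_sq)
qed

lemma curve_T_0_pos: "b > 0 \<Longrightarrow> curve_T 0 b > 0"
  using curve_T_0_lower[of b] T2_0_pos by linarith

lemma exp_curve_T_0: "b > 0 \<Longrightarrow> exp (- curve_T 0 b) < exp (- T2_0)" "b > 0 \<Longrightarrow> exp (- curve_T 0 b) < 1"
  using curve_T_0_lower[of b] curve_T_0_pos[of b] by auto

lemma exp_T2_0: "exp (- T2_0) < 1" using T2_0_pos by simp

lemma inverse_exp_minus: "1 / exp (- x) = exp (x :: real)"
  by (simp add: exp_minus inverse_eq_divide)

lemma x_outer_sq: "b > 0 \<Longrightarrow> (x_outer b)\<^sup>2 = 2 / (1 - exp (- curve_T 0 b))"
  using exp_curve_T_0(2)[of b] by (simp add: x_outer_def)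

lemma x_inner_sq: "(x_inner b)\<^sup>2 = 2 / (1 + exp (- curve_T (pi / 2) b))"
  by (simp add: x_inner_def add_nonneg_nonneg)

lemma x_outer_bounds:
  assumes "b > 0" shows "sqrt 2 < x_outer b" "x_outer b < x_max" "x_outer b > 0"
proof -
  have "2 / 1 < 2 / (1 - exp (- curve_T 0 b))"
    using exp_curve_T_0(2)[OF assms] by (intro divide_strict_left_mono) auto
  then show "sqrt 2 < x_outer b" unfolding x_outer_def by (subst real_sqrt_less_iff) simp
  then show "x_outer b > 0" by (meson less_trans real_sqrt_gt_0_iff zero_less_numeral)
  have "2 / (1 - exp (- curve_T 0 b)) < 2 / (1 - exp (- T2_0))"
    using exp_curve_T_0[OF assms] exp_T2_0 by (intro divide_strict_left_mono mult_pos_pos) auto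
  then show "x_outer b < x_max" unfolding x_outer_def x_max_def two_plus_gamma0
    by (subst real_sqrt_less_iff)
qed

lemma x_inner_bounds: "0 < x_inner b" "x_inner b < sqrt 2"
proof -
  have p: "1 + exp (- curve_T (pi / 2) b) > 1" by simp
  have "0 < 2 / (1 + exp (- curve_T (pi / 2) b))" using p by (intro divide_pos_pos) linarith+
  then show "0 < x_inner b" unfolding x_inner_def by (subst real_sqrt_gt_0_iff)
  have "1 + exp (- curve_T (pi / 2) b) > 0" using p by linarith
  then have "2 / (1 + exp (- curve_T (pi / 2) b)) < 2 / 1"
    using p by (intro divide_strict_left_mono mult_pos_pos) linarith+
  then show "x_inner b < sqrt 2" unfolding x_inner_def by (subst real_sqrt_less_iff) simp
qed

lemma x_outer_anti: "0 < b \<Longrightarrow> b < b' \<Longrightarrow> x_outer b' < x_outer b"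
  unfolding x_outer_def using curve_T_strict_mono[of b b' 0] exp_curve_T_0(2)[of b]
    exp_curve_T_0(2)[of b']
  by (auto intro!: divide_strict_left_mono mult_pos_pos)

lemma x_inner_mono: "0 < b \<Longrightarrow> b < b' \<Longrightarrow> x_inner b < x_inner b'"
  unfolding x_inner_def using curve_T_strict_mono[of b b' "pi / 2"]
  by (auto intro!: divide_strict_left_mono mult_pos_pos add_pos_pos)

lemma x_outer_surj:
  assumes "sqrt 2 < x" "x < x_max"
  obtains b where "b > 0" "x_outer b = x"
proof -
  have x: "x > 0" using assms(1) by (meson less_trans real_sqrt_gt_0_iff zero_less_numeral)
  have x2: "2 < x\<^sup>2" using assms(1) x
    by (metis less_le real_less_rsqrt real_sqrt_less_iff real_sqrt_abs abs_of_pos)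
  have "x\<^sup>2 < x_max\<^sup>2" using assms x by (intro power_strict_mono) auto
  then have "x\<^sup>2 < 2 / (1 - exp (- T2_0))" by (simp add: x_max_sq two_plus_gamma0)
  then have *: "x\<^sup>2 * (1 - exp (- T2_0)) < 2" using exp_T2_0 by (simp add: field_simps)
  define y where "y = - ln ((x\<^sup>2 - 2) / x\<^sup>2)"
  have "0 < (x\<^sup>2 - 2) / x\<^sup>2" using x2 x by (intro divide_pos_pos) auto
  then have e: "exp (- y) = (x\<^sup>2 - 2) / x\<^sup>2" unfolding y_def by simp
  have "(x\<^sup>2 - 2) / x\<^sup>2 < exp (- T2_0)" using * x2 x by (simp add: field_simps)
  then have "exp (- y) < exp (- T2_0)" unfolding e .
  then have "T2_0 < y" by simp
  then obtain b where b: "b > 0" "curve_T 0 b = y" by (rule curve_T_0_surj)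
  have "2 / (1 - (x\<^sup>2 - 2) / x\<^sup>2) = x\<^sup>2" using x by (simp add: field_simps)
  then have "x_outer b = x" unfolding x_outer_def b e using x by simp
  then show ?thesis using that b by blast
qed

lemma x_inner_surj:
  assumes "0 < x" "x < sqrt 2"
  obtains b where "b > 0" "x_inner b = x"
proof -
  have x2: "x\<^sup>2 < 2" using assms
    by (metis less_eq_real_def real_sqrt_pow2 power_strict_mono zero_le_numeral zero_less_numeral)
  define y where "y = - ln ((2 - x\<^sup>2) / x\<^sup>2)"
  have e: "exp (- y) = (2 - x\<^sup>2) / x\<^sup>2" using x2 assms unfolding y_def by simp
  obtain b where b: "b > 0" "curve_T (pi / 2) b = y" by (rule curve_T_pi_half_surj)
  have "2 / (1 + (2 - x\<^sup>2) / x\<^sup>2) = x\<^sup>2" using assms by (simp add: field_simps)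
  then have "x_inner b = x" unfolding x_inner_def b e using assms by simp
  then show ?thesis using that b by blast
qed

text \<open>\<open>1 + 2 / (x^2 - 2)\<close> inverts the substitution, so it equals
  \<open>g\<close>, and \<open>W_fun\<close> is half its logarithm.\<close>

lemma W_x_outer: 
  assumes "b > 0" shows "W_fun (x_outer b) = T2 (curve 0 b) / 2"
proof -
  let ?e = "exp (- curve_T 0 b)"
  have e: "0 < ?e" "?e < 1" using exp_curve_T_0(2)[OF assms] by auto
  have "(x_outer b)\<^sup>2 - 2 = 2 * ?e / (1 - ?e)" unfolding x_outer_sq[OF assms] using e
    by (simp add: field_simps)
  moreover have "1 + 2 / (2 * x / (1 - x)) = 1 / x" if "0 < x" "x < 1" for x :: real using that
    by (simp add: field_simps)
  ultimately have "1 + 2 / ((x_outer b)\<^sup>2 - 2) = 1 / ?e" using e by simp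
  then have "1 + 2 / ((x_outer b)\<^sup>2 - 2) = exp (curve_T 0 b)" by (simp only: inverse_exp_minus)
  then show ?thesis
    using x_outer_bounds(1)[OF assms] by (simp add: W_fun_def T2_curve[OF assms] complex_eq_iff)
qed

text \<open>Now \<open>g\<close> is negative, which explains the absolute value in
  \<open>W_fun\<close>; the term \<open>- i * pi / 2\<close> is half the level \<open>- pi\<close>
  of the right edge.\<close>

lemma W_x_inner: 
  assumes "b > 0" shows "W_fun (x_inner b) = T2 (curve (pi / 2) b) / 2"
proof -
  let ?e = "exp (- curve_T (pi / 2) b)"
  have e: "0 < ?e" by auto
  have "2 / (1 + x) - 2 = - (2 * x / (1 + x))" if "x > 0" for x :: real using that
    by (simp add: field_simps)
  from this[OF e] have "(x_inner b)\<^sup>2 - 2 = - (2 * ?e / (1 + ?e))" unfolding x_inner_sq .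
  moreover have "1 + 2 / - (2 * x / (1 + x)) = - (1 / x)" if "x > 0" for x :: real
  proof -
    have "1 + x \<noteq> 0" using that by linarith
    then have "2 / - (2 * x / (1 + x)) = - ((1 + x) / x)" using that by (simp add: field_simps)
    then show ?thesis using that by (simp add: add_divide_distrib)
  qed
  note this[OF e]
  ultimately have "1 + 2 / ((x_inner b)\<^sup>2 - 2) = - (1 / ?e)" by (simp only:)
  also have "\<dots> = - exp (curve_T (pi / 2) b)" by (simp only: inverse_exp_minus)
  finally have "\<bar>1 + 2 / ((x_inner b)\<^sup>2 - 2)\<bar> = exp (curve_T (pi / 2) b)" by simp
  then show ?thesis
    using x_inner_bounds(2)[of b] by (simp add: W_fun_def T2_curve[OF assms] complex_eq_iff)
qed

lemma F_hat_x_outer: "b > 0 \<Longrightarrow> F_hat (x_outer b) = of_real (x_outer b) * u_of (curve 0 b)"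
  unfolding F_hat_def by (simp add: W_x_outer T_inv_T2 curve_in_cregion)

lemma F_hat_x_inner: "b > 0 \<Longrightarrow> F_hat (x_inner b) = of_real (x_inner b) * u_of (curve (pi / 2) b)"
  unfolding F_hat_def by (simp add: W_x_inner T_inv_T2 curve_in_cregion)

lemma rho_formula:
  assumes "b > 0" "X > 0"
  shows "Im (of_real X * u_of (curve m b)) / (pi * (cmod (of_real X * u_of (curve m b)))\<^sup>2)
    = 4 / (sqrt 3 * pi * X * curve_T' m b)"
proof -
  have I: "Im (u_of (curve m b)) > 0" using Im_u_of_pos[of "curve m b"] assms by simp
  then have "u_of (curve m b) \<noteq> 0" by auto
  then have c: "cmod (u_of (curve m b)) \<noteq> 0" by simp
  have "Im (of_real X * u_of (curve m b)) = X * Im (u_of (curve m b))" by simp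
  then show ?thesis
    using I c assms(2) unfolding curve_T'_def norm_mult
    by (simp add: power_mult_distrib divide_simps power2_eq_square)
qed

lemma rho_x_outer: "b > 0 \<Longrightarrow> rho (x_outer b) = 4 / (sqrt 3 * pi * x_outer b * curve_T' 0 b)"
  using x_outer_bounds[of b] rho_formula[of b "x_outer b" 0]
  by (simp add: rho_def rho_nonneg_def F_hat_x_outer x_max_def)

lemma rho_x_inner: "b > 0 \<Longrightarrow> rho (x_inner b) = 4 / (sqrt 3 * pi * x_inner b * curve_T' (pi / 2) b)"
proof -
  assume b: "b > 0"
  have "x_inner b < x_max" using x_inner_bounds(2)[of b] x_max_gt by linarith
  then show ?thesis
    using b x_inner_bounds[of b] rho_formula[of b "x_inner b" "pi / 2"]
    by (simp add: rho_def rho_nonneg_def F_hat_x_inner x_max_def)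
qed

lemma rho_even: "rho (- x) = rho x" by (simp add: rho_def)

lemma rho_outside: "x_max \<le> \<bar>x\<bar> \<Longrightarrow> rho x = 0"
  using x_max_gt x_max_pos by (auto simp: rho_def rho_nonneg_def x_max_def)

lemma rho_pos: 
  assumes "\<bar>x\<bar> < x_max" shows "rho x > 0"
proof -
  have "rho y > 0" if y: "0 \<le> y" "y < x_max" for y
  proof -
    consider "y = 0" | "y = sqrt 2" | "0 < y" "y < sqrt 2" | "sqrt 2 < y" using y by linarith
    then show ?thesis
    proof cases
      case 1
      then show ?thesis by (simp add: rho_def rho_nonneg_def)
    next
      case 2
      then show ?thesis by (simp add: rho_def rho_nonneg_def)
    next
      case 3
      then obtain b where b: "b > 0" "x_inner b = y" by (rule x_inner_surj)
      show ?thesis using rho_x_inner[OF b(1)] x_inner_bounds[of b] curve_T'_pos[OF b(1)] b by simp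
    next
      case 4
      then obtain b where b: "b > 0" "x_outer b = y" using y(2) by (rule x_outer_surj)
      show ?thesis using rho_x_outer[OF b(1)] x_outer_bounds[of b] curve_T'_pos[OF b(1)] b by simp
    qed
  qed
  from this[of "\<bar>x\<bar>"] assms show ?thesis by (simp add: rho_def)
qed

lemma rho_nonneg': "rho x \<ge> 0"
  using rho_pos[of x] rho_outside[of x] by (cases "\<bar>x\<bar> < x_max") auto

section \<open>Continuity and measurability of the density\<close>

lemma isCont_curve_T': "b > 0 \<Longrightarrow> isCont (curve_T' m) b"
proof -
  assume b: "b > 0"
  have "continuous_on {0<..} (curve_T' m)"
    unfolding curve_T'_def[abs_def] using Im_u_of_pos[of "curve m _"]
    by (intro continuous_intros continuous_on_u_of_curve) force
  then show ?thesis using b by (simp add: continuous_on_eq_continuous_at)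
qed

lemma isCont_curve_T: "b > 0 \<Longrightarrow> isCont (curve_T m) b"
  using DERIV_isCont[OF curve_T_deriv] .

lemma isCont_x_outer: "b > 0 \<Longrightarrow> isCont x_outer b"
  unfolding x_outer_def[abs_def] using exp_curve_T_0(2)[of b]
  by (intro continuous_intros isCont_curve_T) auto

lemma isCont_x_inner: "b > 0 \<Longrightarrow> isCont x_inner b"
  unfolding x_inner_def[abs_def]
  by (intro continuous_intros isCont_curve_T) (auto simp: add_pos_pos less_imp_neq[THEN not_sym])

text \<open>The density is explicit only as a function of the height. A continuous injection of an
  interval is a homeomorphism onto its image, so continuity in the parameter transfers to
  \<open>x\<close>.\<close>

lemma isCont_via_param:
  fixes X :: "real \<Rightarrow> real"
  assumes X: "\<And>b. b > 0 \<Longrightarrow> isCont X b" "inj_on X {0<..}" "X ` {0<..} = S" "open S"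
    and f: "\<And>b. b > 0 \<Longrightarrow> isCont (\<lambda>b. f (X b)) b" and x: "x \<in> S"
  shows "isCont f x"
proof -
  have "continuous_on {0<..} X" using X(1) by (intro continuous_at_imp_continuous_on) auto
  then obtain g where g: "homeomorphism {0<..} S X g"
    using homeomorphism_into_1d[of "{0<..}" X S] X(2,3) by (auto simp: convex_imp_path_connected)
  have "continuous_on {0<..} (\<lambda>b. f (X b))" using f by (intro continuous_at_imp_continuous_on) auto
  then have "continuous_on S (\<lambda>x. f (X (g x)))"
    using g by (intro continuous_on_compose2[of "{0<..}" "\<lambda>b. f (X b)" S g]) (auto simp:
      homeomorphism_def)
  then have "continuous_on S f"
    by (rule continuous_on_eq) (use g in \<open>auto simp: homeomorphism_def\<close>)
  then show ?thesis using x X(4) by (simp add: continuous_on_eq_continuous_at)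
qed

lemma x_outer_image: "x_outer ` {0<..} = {sqrt 2<..<x_max}"
proof
  show "{sqrt 2<..<x_max} \<subseteq> x_outer ` {0<..}"
  proof
    fix x assume "x \<in> {sqrt 2<..<x_max}"
    then obtain b where "b > 0" "x_outer b = x" using x_outer_surj[of x] by auto
    then show "x \<in> x_outer ` {0<..}" by auto
  qed
qed (use x_outer_bounds in auto)

lemma x_inner_image: "x_inner ` {0<..} = {0<..<sqrt 2}"
proof
  show "{0<..<sqrt 2} \<subseteq> x_inner ` {0<..}"
  proof
    fix x assume "x \<in> {0<..<sqrt 2}"
    then obtain b where "b > 0" "x_inner b = x" using x_inner_surj[of x] by auto
    then show "x \<in> x_inner ` {0<..}" by auto
  qed
qed (use x_inner_bounds in auto)

lemma isCont_rho_param: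
  assumes X: "\<And>b. b > 0 \<Longrightarrow> isCont X b" "\<And>b. b > 0 \<Longrightarrow> X b > 0" "inj_on X {0<..}" "X ` {0<..} = S"
    "open S"
    and rho_X: "\<And>b. b > 0 \<Longrightarrow> rho (X b) = 4 / (sqrt 3 * pi * X b * curve_T' m b)" and x: "x \<in> S"
  shows "isCont rho x"
proof (rule isCont_via_param[OF X(1,3,4,5) _ x])
  fix b :: real assume b: "b > 0"
  then have "\<forall>\<^sub>F b in nhds b. b \<in> {0<..}" by (intro eventually_nhds_in_open) auto
  then have "\<forall>\<^sub>F b in nhds b. rho (X b) = 4 / (sqrt 3 * pi * X b * curve_T' m b)"
    by eventually_elim (simp add: rho_X)
  moreover have "isCont (\<lambda>b. 4 / (sqrt 3 * pi * X b * curve_T' m b)) b"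
    using X(2)[OF b] curve_T'_pos[OF b, of m]
      by (intro continuous_intros X(1) isCont_curve_T' b) auto
  ultimately show "isCont (\<lambda>b. rho (X b)) b" by (simp add: isCont_cong)
qed

lemma isCont_rho_right: "sqrt 2 < x \<Longrightarrow> x < x_max \<Longrightarrow> isCont rho x"
  by (rule isCont_rho_param[OF isCont_x_outer x_outer_bounds(3) linorder_inj_onI x_outer_image _
    rho_x_outer])
    (auto dest: x_outer_anti)

lemma isCont_rho_left: "0 < x \<Longrightarrow> x < sqrt 2 \<Longrightarrow> isCont rho x"
  by (rule isCont_rho_param[OF isCont_x_inner x_inner_bounds(1) linorder_inj_onI x_inner_image _
    rho_x_inner])
    (auto dest: x_inner_mono)

lemma isCont_rho:
  assumes "x \<notin> {0, sqrt 2, - sqrt 2, x_max, - x_max}" shows "isCont rho x"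
proof -
  have pos: "isCont rho y" if y: "y > 0" "y \<noteq> sqrt 2" "y \<noteq> x_max" for y
  proof -
    consider "y < sqrt 2" | "sqrt 2 < y" "y < x_max" | "y > x_max" using y by linarith
    then show ?thesis
    proof cases
      case 3
      then have "\<forall>\<^sub>F b in nhds y. b \<in> {x_max<..}" by (intro eventually_nhds_in_open) auto
      then have "\<forall>\<^sub>F b in nhds y. rho b = 0" by eventually_elim (simp add: rho_outside)
      then show ?thesis by (simp add: isCont_cong)
    qed (use isCont_rho_left isCont_rho_right y in auto)
  qed
  show ?thesis
  proof (cases "x > 0")
    case False
    then have "isCont rho (- x)" using assms by (intro pos) auto
    then have "isCont (\<lambda>x. rho (- x)) x" by (intro isCont_o2[of x uminus rho] continuous_intros)
    then show ?thesis by (simp add: rho_even)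
  qed (use pos assms in auto)
qed

lemma rho_measurable [measurable]: "rho \<in> borel_measurable borel"
proof -
  have "continuous_on (- {0, sqrt 2, - sqrt 2, x_max, - x_max}) rho"
    by (intro continuous_at_imp_continuous_on) (auto intro: isCont_rho)
  moreover have "finite {0, sqrt 2, - sqrt 2, x_max, - x_max}" by simp
  ultimately show ?thesis
    using borel_measurable_continuous_countable_exceptions[of
      "{0, sqrt 2, - sqrt 2, x_max, - x_max}" rho]
    by (simp add: countable_finite Compl_eq_Diff_UNIV)
qed

lemma x_outer_sq': "b > 0 \<Longrightarrow> (x_outer b)\<^sup>2 = 2 * exp (curve_T 0 b) / (exp (curve_T 0 b) - 1)"
  using curve_T_0_pos[of b] by (simp add: x_outer_sq exp_minus field_simps)

lemma x_inner_sq': "(x_inner b)\<^sup>2 = 2 * exp (curve_T (pi / 2) b) / (exp (curve_T (pi / 2) b) + 1)"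
proof -
  have "2 / (1 + 1 / x) = 2 * x / (x + 1)" if "x > 0" for x :: real
    using that by (simp add: field_simps)
  then show ?thesis unfolding x_inner_sq exp_minus inverse_eq_divide by simp
qed

lemma sqrt_deriv:
  assumes "(h has_field_derivative h') (at b)" "h b > 0"
  shows "((\<lambda>b. sqrt (h b)) has_field_derivative (h' / (2 * sqrt (h b)))) (at b)"
  using DERIV_chain2[OF DERIV_real_sqrt[OF assms(2)] assms(1)] by (simp add: field_simps)

lemma x_outer_deriv:
  assumes b: "b > 0"
  shows "(x_outer has_field_derivative (- (x_outer b * curve_T' 0 b / (2 * (exp (curve_T 0 b) -
    1))))) (at b)"
proof -
  let ?e = "exp (- curve_T 0 b)"
  have e: "?e < 1" "?e > 0" using exp_curve_T_0(2)[OF b] by auto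
  have "((\<lambda>b. 2 / (1 - exp (- curve_T 0 b))) has_field_derivative (- (2 * ?e * curve_T' 0 b / (1 -
    ?e)\<^sup>2))) (at b)"
    using e by (auto intro!: derivative_eq_intros curve_T_deriv[OF b] simp: power2_eq_square)
  then have "(x_outer has_field_derivative (- (2 * ?e * curve_T' 0 b / (1 - ?e)\<^sup>2) / (2 * x_outer
    b))) (at b)"
    unfolding x_outer_def[abs_def] using e by (intro sqrt_deriv) auto
  also have "- (2 * ?e * curve_T' 0 b / (1 - ?e)\<^sup>2) / (2 * x_outer b)
    = - (x_outer b * curve_T' 0 b / (2 * (exp (curve_T 0 b) - 1)))"
  proof -
    have x: "x_outer b \<noteq> 0" using x_outer_bounds[OF b] by simp
    \<comment> \<open>The relation \<open>x^2 * (1 - e) = 2\<close> moves the square root from the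
      denominator to the numerator, the form in which it cancels against the density.\<close>
    have "- (2 * e * G / (1 - e)\<^sup>2) / (2 * x) = - (x * G / (2 * (1 / e - 1)))"
      if "0 < e" "e < 1" "x \<noteq> 0" "x\<^sup>2 = 2 / (1 - e)" for e x G :: real
    proof -
      have "1 - e \<noteq> 0" using that by linarith
      then have "x\<^sup>2 * (1 - e) = 2" using that(4) by (rule nonzero_eq_divide_eq[THEN iffD1])
      then have "x * x * (1 - e) = 2" by (simp only: power2_eq_square)
      then have "(1 - e) * (x * x * (1 - e)) = 2 - 2 * e" by simp
      then have "2 - 2 * e = x * ((1 - e) * ((1 - e) * x))" by (simp only: mult_ac)
      then show ?thesis using that(1-3)
        by (simp add: divide_simps power2_eq_square)
    qed
    from this[OF e(2,1) x x_outer_sq[OF b]] show ?thesis by (simp only: inverse_exp_minus)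
  qed
  finally show ?thesis .
qed

lemma x_inner_deriv:
  assumes b: "b > 0"
  shows "(x_inner has_field_derivative (x_inner b * curve_T' (pi / 2) b / (2 * (exp (curve_T (pi /
    2) b) + 1)))) (at b)"
proof -
  let ?e = "exp (- curve_T (pi / 2) b)"
  have e: "?e > 0" by simp
  then have e1: "1 + ?e > 0" by linarith
  have "((\<lambda>b. 2 / (1 + exp (- curve_T (pi / 2) b))) has_field_derivative (2 * ?e * curve_T' (pi /
    2) b / (1 + ?e)\<^sup>2)) (at b)"
    using e1 by (auto intro!: derivative_eq_intros curve_T_deriv[OF b] simp: power2_eq_square)
  then have "(x_inner has_field_derivative (2 * ?e * curve_T' (pi / 2) b / (1
    + ?e)\<^sup>2 / (2 * x_inner b))) (at b)"
    unfolding x_inner_def[abs_def] using e1 by (intro sqrt_deriv) auto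
  also have "2 * ?e * curve_T' (pi / 2) b / (1 + ?e)\<^sup>2 / (2 * x_inner b)
    = x_inner b * curve_T' (pi / 2) b / (2 * (exp (curve_T (pi / 2) b) + 1))"
  proof -
    have x: "x_inner b \<noteq> 0" using x_inner_bounds[of b] by simp
    have "2 * e * G / (1 + e)\<^sup>2 / (2 * x) = x * G / (2 * (1 / e + 1))"
      if "0 < e" "x \<noteq> 0" "x\<^sup>2 = 2 / (1 + e)" for e x G :: real
    proof -
      have "1 + e \<noteq> 0" using that by linarith
      moreover from this have "x\<^sup>2 * (1 + e) = 2" using that(3)
        by (rule nonzero_eq_divide_eq[THEN iffD1])
      then have "x * x * (1 + e) = 2" by (simp only: power2_eq_square)
      then have "(1 + e) * (x * x * (1 + e)) = 2 + 2 * e" by simp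
      then have "2 + 2 * e = x * ((1 + e) * ((1 + e) * x))" by (simp only: mult_ac)
      ultimately show ?thesis using that(1,2)
        by (simp add: divide_simps power2_eq_square)
    qed
    from this[OF e x x_inner_sq] show ?thesis by (simp only: inverse_exp_minus)
  qed
  finally show ?thesis .
qed

section \<open>The change of variables in the moment integral\<close>

context kernel
begin

definition t_par :: real where "t_par = (1 - \<kappa>) / 2"
definition rho_t :: "real \<Rightarrow> real" where "rho_t x = rho x / (1 - t_par * x\<^sup>2)"

text \<open>The inequality \<open>\<kappa>_gt\<close> in terms of \<open>x\<close>: it keeps
  \<open>1 - t_par * x^2\<close> positive up to the end of the support.\<close>

lemma t_par_x_max: "t_par * x_max\<^sup>2 < 1"
proof -
  have "\<kappa> > exp (- T2_0)" using \<kappa>_gt by (simp add: exp_minus field_simps)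
  then have "t_par < (1 - exp (- T2_0)) / 2" by (simp add: t_par_def)
  then show ?thesis unfolding x_max_sq two_plus_gamma0 using exp_T2_0 by (simp add: field_simps)
qed

lemma denom_pos: 
  assumes "\<bar>x\<bar> \<le> x_max" shows "1 - t_par * x\<^sup>2 > 0"
proof (cases "t_par \<le> 0")
  case True
  then have "t_par * x\<^sup>2 \<le> 0" by (simp add: mult_nonpos_nonneg)
  then show ?thesis by linarith
next
  case False
  have "x\<^sup>2 \<le> x_max\<^sup>2" using assms x_max_pos by (simp add: abs_le_square_iff[symmetric])
  then have "t_par * x\<^sup>2 \<le> t_par * x_max\<^sup>2" using False by (intro mult_left_mono) auto
  then show ?thesis using t_par_x_max by linarith
qed

lemma rho_t_even: "rho_t (- x) = rho_t x" by (simp add: rho_t_def rho_even)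

lemma rho_t_nonneg: "\<bar>x\<bar> \<le> x_max \<Longrightarrow> rho_t x \<ge> 0"
  unfolding rho_t_def using rho_nonneg'[of x] denom_pos[of x] by (intro divide_nonneg_pos) auto

definition K_outer :: "real \<Rightarrow> real" where "K_outer b = 2 / (\<kappa> * exp (curve_T 0 b) - 1)"
definition K_inner :: "real \<Rightarrow> real" where "K_inner b = 2 / (\<kappa> * exp (curve_T (pi / 2) b) + 1)"

lemma K_nonneg: "b > 0 \<Longrightarrow> K_outer b \<ge> 0" "K_inner b \<ge> 0"
  using kden_curve_0_pos[of b] \<kappa>_pos by (auto simp: K_outer_def K_inner_def add_nonneg_nonneg)

lemma isCont_K: "b > 0 \<Longrightarrow> isCont K_outer b" "b > 0 \<Longrightarrow> isCont K_inner b"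
proof -
  assume b: "b > 0"
  show "isCont K_outer b" unfolding K_outer_def[abs_def]
    using kden_curve_0_pos[OF b] by (intro continuous_intros isCont_curve_T b) auto
  show "isCont K_inner b" using kden_curve_pi_half_pos[of b] unfolding K_inner_def[abs_def]
    by (intro continuous_intros isCont_curve_T b) auto
qed

lemma einterval_0_inf: "einterval 0 \<infinity> = {0<..}"
  by (auto simp: einterval_def)

text \<open>Integrability is known for the sum; since both summands are nonnegative, the sum
  dominates each of them.\<close>

lemma K_integrable: "set_integrable lborel (einterval 0 \<infinity>) K_outer"
  "set_integrable lborel (einterval 0 \<infinity>) K_inner"
proof -
  have m: "set_borel_measurable lborel (einterval 0 \<infinity>) K" if "\<And>b. b > 0 \<Longrightarrow> isCont K b"
    for K :: "real \<Rightarrow> real"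
  proof -
    have "(\<lambda>x. indicat_real {0<..} x *\<^sub>R K x) \<in> borel_measurable borel"
      using that by (intro borel_measurable_continuous_on_indicator
        continuous_at_imp_continuous_on) auto
    then show ?thesis unfolding einterval_0_inf set_borel_measurable_def by simp
  qed
  have K_edge: "K_edge b = K_outer b + K_inner b" for b
    by (simp add: K_edge_def K_outer_def K_inner_def)
  show "set_integrable lborel (einterval 0 \<infinity>) K_outer"
    by (rule set_integrable_bound[OF kernel_integral(1) m]) (use isCont_K K_nonneg in \<open>auto simp:
      K_edge einterval_0_inf\<close>)
  show "set_integrable lborel (einterval 0 \<infinity>) K_inner"
    by (rule set_integrable_bound[OF kernel_integral(1) m]) (use isCont_K K_nonneg in \<open>auto simp:
      K_edge einterval_0_inf\<close>)
qed

lemma K_sum: "(LBINT b=0..\<infinity>. K_outer b) + (LBINT b=0..\<infinity>. K_inner b) = sqrt 3 * pi / (2 * U)"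
proof -
  have "(LBINT b=0..\<infinity>. K_outer b + K_inner b) = (LBINT b=0..\<infinity>. K_outer b)
    + (LBINT b=0..\<infinity>. K_inner b)"
    using K_integrable by (intro interval_lebesgue_integral_add) (auto simp:
      interval_lebesgue_integrable_def)
  then show ?thesis using kernel_integral(2)
    by (simp add: K_edge_def[abs_def] K_outer_def[abs_def] K_inner_def[abs_def])
qed

text \<open>The cancellation that determines the kernel: \<open>X\<close> is the point,
  \<open>G\<close> the speed \<open>curve_T'\<close>, and \<open>e\<close> is
  \<open>|g - 1|\<close>, which occurs both in \<open>1 - t * x^2\<close> and in the derivative of
  \<open>X\<close>.\<close>

lemma density_cancel:
  "X > 0 \<Longrightarrow> G > 0 \<Longrightarrow> d > 0 \<Longrightarrow> e > 0 \<Longrightarrow> c > 0 \<Longrightarrow>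
    4 / (c * X * G) / (d / e) * (X * G / (2 * e)) = 2 / d / c" for X G d e c :: real
  by (simp add: field_simps)

lemma rho_t_x_outer:
  assumes b: "b > 0"
  shows "rho_t (x_outer b) * (x_outer b * curve_T' 0 b / (2 * (exp (curve_T 0 b) - 1)))
    = K_outer b / (sqrt 3 * pi)"
proof -
  let ?E = "exp (curve_T 0 b)"
  have E: "?E - 1 > 0" using curve_T_0_pos[OF b] by simp
  have d: "\<kappa> * ?E - 1 > 0" by (rule kden_curve_0_pos[OF b])
  have "1 - t_par * (x_outer b)\<^sup>2 = (\<kappa> * ?E - 1) / (?E - 1)"
    unfolding x_outer_sq'[OF b] t_par_def using E by (simp add: field_simps)
  then have "rho_t (x_outer b) = 4 / (sqrt 3 * pi * x_outer b * curve_T' 0 b) / ((\<kappa> * ?E - 1) / (?E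
    - 1))"
    unfolding rho_t_def rho_x_outer[OF b] by simp
  moreover note density_cancel[OF x_outer_bounds(3)[OF b] curve_T'_pos[OF b] d E, of "sqrt 3 * pi"
    0]
  ultimately show ?thesis unfolding K_outer_def by simp
qed

lemma rho_t_x_inner:
  assumes b: "b > 0"
  shows "rho_t (x_inner b) * (x_inner b * curve_T' (pi / 2) b / (2 * (exp (curve_T (pi / 2) b)
    + 1))) = K_inner b / (sqrt 3 * pi)"
proof -
  let ?E = "exp (curve_T (pi / 2) b)"
  have E: "?E + 1 > 0" by (simp add: add_pos_pos)
  have d: "\<kappa> * ?E + 1 > 0" by (rule kden_curve_pi_half_pos)
  have "1 - t_par * (x_inner b)\<^sup>2 = (\<kappa> * ?E + 1) / (?E + 1)"
    unfolding x_inner_sq' t_par_def using E by (simp add: field_simps)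
  then have "rho_t (x_inner b) = 4 / (sqrt 3 * pi * x_inner b * curve_T' (pi / 2) b) / ((\<kappa> * ?E
    + 1) / (?E + 1))"
    unfolding rho_t_def rho_x_inner[OF b] by simp
  moreover note density_cancel[OF x_inner_bounds(1)[of b] curve_T'_pos[OF b, of "pi / 2"] d E, of
    "sqrt 3 * pi"]
  ultimately show ?thesis unfolding K_inner_def by simp
qed

lemma isCont_rho_t: "x \<notin> {0, sqrt 2, - sqrt 2, x_max, - x_max} \<Longrightarrow> \<bar>x\<bar> \<le> x_max \<Longrightarrow> isCont rho_t x"
  unfolding rho_t_def[abs_def] using denom_pos[of x]
  by (intro continuous_intros isCont_rho) auto

lemma x_inner_at_0: "(x_inner \<longlongrightarrow> 0) (at_right 0)"
proof -
  have "filterlim (\<lambda>b. exp (- curve_T (pi / 2) b)) at_top (at_right 0)"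
    by (rule filterlim_compose[OF exp_at_top]) (use curve_T_pi_half_at_0 in \<open>simp add:
      filterlim_uminus_at_bot\<close>)
  then have "filterlim (\<lambda>b. 1 + exp (- curve_T (pi / 2) b)) at_top (at_right 0)"
    by (rule filterlim_tendsto_add_at_top[OF tendsto_const])
  then have "((\<lambda>b. 2 / (1 + exp (- curve_T (pi / 2) b))) \<longlongrightarrow> 0) (at_right 0)"
    by (intro tendsto_divide_0[OF tendsto_const] filterlim_at_top_imp_at_infinity)
  from tendsto_real_sqrt[OF this] show ?thesis by (simp add: x_inner_def[abs_def])
qed

lemma exp_minus_curve_T: "0 \<le> m \<Longrightarrow> m \<le> pi / 2 \<Longrightarrow> ((\<lambda>b. exp (- curve_T m b)) \<longlongrightarrow> 0) at_top"
  by (rule filterlim_compose[OF exp_at_bot]) (use curve_T_at_top[of m] in \<open>simp add: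
    filterlim_uminus_at_top\<close>)

lemma x_inner_at_top: "(x_inner \<longlongrightarrow> sqrt 2) at_top"
proof -
  have "((\<lambda>b. 2 / (1 + exp (- curve_T (pi / 2) b))) \<longlongrightarrow> 2 / (1 + 0)) at_top"
    by (intro tendsto_intros exp_minus_curve_T) auto
  from tendsto_real_sqrt[OF this] show ?thesis by (simp add: x_inner_def[abs_def])
qed

lemma x_outer_at_top: "(x_outer \<longlongrightarrow> sqrt 2) at_top"
proof -
  have "((\<lambda>b. 2 / (1 - exp (- curve_T 0 b))) \<longlongrightarrow> 2 / (1 - 0)) at_top"
    by (intro tendsto_intros exp_minus_curve_T) auto
  from tendsto_real_sqrt[OF this] show ?thesis by (simp add: x_outer_def[abs_def])
qed

lemma x_outer_at_0: "(x_outer \<longlongrightarrow> x_max) (at_right 0)"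
proof -
  have "((\<lambda>b. 2 / (1 - exp (- curve_T 0 b))) \<longlongrightarrow> 2 / (1 - exp (- T2_0))) (at_right 0)"
    using exp_T2_0 by (intro tendsto_intros curve_T_0_at_0) auto
  from tendsto_real_sqrt[OF this] show ?thesis
    by (simp add: x_outer_def[abs_def] x_max_def two_plus_gamma0)
qed

text \<open>The change of variables shared by both branches. Nonnegativity of \<open>rho_t\<close>
  and \<open>d\<close> lets integrability be carried over from \<open>K\<close>.\<close>

lemma param_integral:
  fixes X d K :: "real \<Rightarrow> real"
  assumes d: "\<And>b. b > 0 \<Longrightarrow> DERIV X b :> d b" "\<And>b. b > 0 \<Longrightarrow> isCont d b" "\<And>b. b > 0 \<Longrightarrow> d b \<ge> 0"
    and X: "\<And>b. b > 0 \<Longrightarrow> \<bar>X b\<bar> \<le> x_max" "\<And>b. b > 0 \<Longrightarrow> X b \<notin> {0, sqrt 2, - sqrt 2, x_max, - x_max}"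
    and eq: "\<And>b. b > 0 \<Longrightarrow> rho_t (X b) * d b = K b / (sqrt 3 * pi)"
    and K: "set_integrable lborel (einterval 0 \<infinity>) K"
    and lims: "(X \<longlongrightarrow> A) (at_right 0)" "(X \<longlongrightarrow> B) at_top" and AB: "A \<le> B"
  shows "set_integrable lborel {A<..<B} rho_t \<and> (LBINT x:{A<..<B}. rho_t x)
    = (LBINT b=0..\<infinity>. K b) / (sqrt 3 * pi)"
proof -
  \<comment> \<open>Filled with 0 because the substitution rule asks for nonnegativity at the end
    point 0 too, where nothing is known about \<open>d\<close>.\<close>
  define g' where "g' b = (if b > 0 then d b else 0)" for b
  have cont_g': "isCont g' b" if "b > 0" for b
  proof -
    have "\<forall>\<^sub>F b in nhds b. b \<in> {0<..}" using that by (intro eventually_nhds_in_open) auto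
    then have "\<forall>\<^sub>F b in nhds b. g' b = d b" by eventually_elim (simp add: g'_def)
    then show ?thesis using d(2)[OF that] by (simp add: isCont_cong)
  qed
  have eq': "rho_t (X b) * g' b = K b / (sqrt 3 * pi)" if "b > 0" for b
    using eq[OF that] that by (simp add: g'_def)
  have "set_integrable lborel (einterval 0 \<infinity>) (\<lambda>b. K b / (sqrt 3 * pi))" using K by simp
  then have int: "set_integrable lborel (einterval 0 \<infinity>) (\<lambda>b. rho_t (X b) * g' b)"
    by (rule set_integrable_cong[THEN iffD1, rotated -1]) (auto simp: eq' einterval_0_inf)
  have A: "((ereal \<circ> X \<circ> real_of_ereal) \<longlongrightarrow> ereal A) (at_right 0)"
    using lims(1) unfolding zero_ereal_def by (simp add: ereal_tendsto_simps)
  have B: "((ereal \<circ> X \<circ> real_of_ereal) \<longlongrightarrow> ereal B) (at_left \<infinity>)"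
    using lims(2) by (simp add: ereal_tendsto_simps)
  note * = interval_integral_substitution_nonneg[where f = rho_t and g = X and g' = g' and a = 0
    and b = \<infinity>,
      OF _ _ _ _ _ _ A B int]
  have c: "isCont rho_t (X b)" if "b > 0" for b using X[OF that] by (intro isCont_rho_t)
  have n: "g' b \<ge> 0" for b using d(3) by (simp add: g'_def)
  have D: "DERIV X b :> g' b" if "b > 0" for b using d(1)[OF that] that by (simp add: g'_def)
  have 1: "set_integrable lborel (einterval (ereal A) (ereal B)) rho_t"
    by (rule *(1)) (use D c n cont_g' rho_t_nonneg[OF X(1)] in auto)
  have 2: "(LBINT x=ereal A..ereal B. rho_t x) = (LBINT x=0..\<infinity>. rho_t (X x) * g' x)"
    by (rule *(2)) (use D c n cont_g' rho_t_nonneg[OF X(1)] in auto)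
  have ei: "einterval (ereal A) (ereal B) = {A<..<B}" by (auto simp: einterval_def)
  then have "set_integrable lborel {A<..<B} rho_t" using 1 by simp
  have "(LBINT x:einterval (ereal A) (ereal B). rho_t x) = (LBINT x=ereal A..ereal B. rho_t x)"
    by (rule interval_lebesgue_integral_le_eq[symmetric]) (use AB in simp)
  also have "\<dots> = (LBINT x=0..\<infinity>. K x / (sqrt 3 * pi))"
    unfolding 2 by (intro interval_integral_cong) (auto simp: eq' einterval_0_inf)
  also have "\<dots> = (LBINT b=0..\<infinity>. K b) / (sqrt 3 * pi)" by simp
  finally show ?thesis using \<open>set_integrable lborel {A<..<B} rho_t\<close> by (simp only: ei simp_thms)
qed

lemma right_integral:
  "set_integrable lborel {0<..<sqrt 2} rho_t \<and>
   (LBINT x:{0<..<sqrt 2}. rho_t x) = (LBINT b=0..\<infinity>. K_inner b) / (sqrt 3 * pi)"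
proof (rule param_integral[where X = x_inner and K = K_inner and d =
  "\<lambda>b. x_inner b * curve_T' (pi / 2) b / (2 * (exp (curve_T (pi / 2) b) + 1))"])
  fix b :: real assume b: "b > 0"
  have "exp (curve_T (pi / 2) b) + 1 > 0" by (simp add: add_pos_pos)
  then show "isCont (\<lambda>b. x_inner b * curve_T' (pi / 2) b / (2 * (exp (curve_T (pi / 2) b) + 1))) b"
    by (intro continuous_intros isCont_x_inner isCont_curve_T' isCont_curve_T b) auto
  show "0 \<le> x_inner b * curve_T' (pi / 2) b / (2 * (exp (curve_T (pi / 2) b) + 1))"
    using curve_T'_pos[OF b, of "pi / 2"] x_inner_bounds[of b]
      by (intro divide_nonneg_nonneg mult_nonneg_nonneg) auto
  show "\<bar>x_inner b\<bar> \<le> x_max" "x_inner b \<notin> {0, sqrt 2, - sqrt 2, x_max, - x_max}"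
    using x_inner_bounds[of b] x_max_gt by auto
qed ((rule x_inner_deriv rho_t_x_inner K_integrable x_inner_at_0 x_inner_at_top, assumption?) |
  simp)+

text \<open>The substitution lemma wants an increasing function, whence the reflection.\<close>
lemma left_integral:
  "set_integrable lborel {- x_max<..<- sqrt 2} rho_t \<and>
   (LBINT x:{- x_max<..<- sqrt 2}. rho_t x) = (LBINT b=0..\<infinity>. K_outer b) / (sqrt 3 * pi)"
proof (rule param_integral[where X = "\<lambda>b. - x_outer b" and K = K_outer and d =
  "\<lambda>b. x_outer b * curve_T' 0 b / (2 * (exp (curve_T 0 b) - 1))"])
  fix b :: real assume b: "b > 0"
  show "isCont (\<lambda>b. x_outer b * curve_T' 0 b / (2 * (exp (curve_T 0 b) - 1))) b"
    using curve_T_0_pos[OF b] by (intro continuous_intros isCont_x_outer isCont_curve_T'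
      isCont_curve_T b) auto
  show "0 \<le> x_outer b * curve_T' 0 b / (2 * (exp (curve_T 0 b) - 1))"
    using curve_T'_pos[OF b, of 0] x_outer_bounds[OF b] curve_T_0_pos[OF b]
      by (intro divide_nonneg_nonneg mult_nonneg_nonneg) auto
  show "DERIV (\<lambda>b. - x_outer b) b :> x_outer b * curve_T' 0 b / (2 * (exp (curve_T 0 b) - 1))"
    using DERIV_minus[OF x_outer_deriv[OF b]] by simp
  show "rho_t (- x_outer b) * (x_outer b * curve_T' 0 b / (2 * (exp (curve_T 0 b) - 1)))
    = K_outer b / (sqrt 3 * pi)"
    unfolding rho_t_even by (rule rho_t_x_outer[OF b])
  show "\<bar>- x_outer b\<bar> \<le> x_max" using x_outer_bounds[OF b] by simp
  have "sqrt 2 > 0" by simp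
  then show "- x_outer b \<notin> {0, sqrt 2, - sqrt 2, x_max, - x_max}"
    using x_outer_bounds[OF b] x_max_pos unfolding insert_iff empty_iff
      by (intro notI, elim disjE; linarith)
qed (use x_max_gt in \<open>simp_all add: K_integrable tendsto_minus[OF x_outer_at_0] tendsto_minus[OF
  x_outer_at_top]\<close>)

lemma reflect_integral:
  assumes "set_integrable lborel {a<..<b} rho_t"
  shows "set_integrable lborel {- b<..<- a} rho_t" "(LBINT x:{- b<..<- a}. rho_t x)
    = (LBINT x:{a<..<b}. rho_t x)"
proof -
  have e: "indicat_real {a<..<b} (0 + - 1 * x) *\<^sub>R rho_t (0 + - 1 * x)
    = indicat_real {- b<..<- a} x *\<^sub>R rho_t x" for x
    by (auto simp: rho_t_even indicator_def)
  show "set_integrable lborel {- b<..<- a} rho_t"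
    using lborel_integrable_real_affine[OF assms[unfolded set_integrable_def], of "- 1" 0]
    unfolding e set_integrable_def by simp
  show "(LBINT x:{- b<..<- a}. rho_t x) = (LBINT x:{a<..<b}. rho_t x)"
    using lborel_integral_real_affine[of "- 1" "\<lambda>x. indicat_real {a<..<b} x *\<^sub>R rho_t x" 0]
    unfolding e set_lebesgue_integral_def by simp
qed

text \<open>Evenness doubles the two computed pieces, and
  \<open>2 * (sqrt 3 * pi / (2 * U)) / (sqrt 3 * pi)\<close> is \<open>1 / U\<close>. The points
  between the pieces form a null set.\<close>

lemma rho_t_integral: "integrable lborel rho_t" "integral\<^sup>L lborel rho_t = 1 / U"
proof -
  \<comment> \<open>The double minus signs keep the reflected intervals in the form in which
    \<open>reflect_integral\<close> produces them.\<close>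
  let ?S1 = "{0<..<sqrt 2}" and ?S2 = "{- x_max<..<- sqrt 2}" and ?S3 = "{- sqrt 2<..<- 0}" and ?S4
    = "{- (- sqrt 2)<..<- (- x_max)}"
  define h where "h x = indicat_real ?S1 x *\<^sub>R rho_t x + indicat_real ?S2 x *\<^sub>R rho_t x
    + (indicat_real ?S3 x *\<^sub>R rho_t x + indicat_real ?S4 x *\<^sub>R rho_t x)" for x
  note i = right_integral[THEN conjunct1] left_integral[THEN conjunct1] reflect_integral(1)[OF
    right_integral[THEN conjunct1]] reflect_integral(1)[OF left_integral[THEN conjunct1]]
  have h: "integrable lborel h" unfolding h_def
    using i unfolding set_integrable_def by (intro Bochner_Integration.integrable_add)
  have "integral\<^sup>L lborel h = (LBINT x:?S1. rho_t x) + (LBINT x:?S2. rho_t x)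
    + ((LBINT x:?S3. rho_t x) + (LBINT x:?S4. rho_t x))"
    using i unfolding h_def set_integrable_def set_lebesgue_integral_def
    by (simp only: Bochner_Integration.integral_add Bochner_Integration.integrable_add)
  also have "\<dots> = 2 * ((LBINT b=0..\<infinity>. K_inner b) / (sqrt 3 * pi))
    + 2 * ((LBINT b=0..\<infinity>. K_outer b) / (sqrt 3 * pi))"
  proof -
    have gen: "x + y + (x + y) = 2 * x + 2 * y" for x y :: real by simp
    show ?thesis
      unfolding reflect_integral(2)[OF right_integral[THEN conjunct1]] reflect_integral(2)[OF
        left_integral[THEN conjunct1]] right_integral[THEN conjunct2] left_integral[THEN conjunct2]
      by (rule gen)
  qed
  also have "\<dots> = 2 * (((LBINT b=0..\<infinity>. K_outer b) + (LBINT b=0..\<infinity>. K_inner b)) / (sqrt 3 * pi))"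
  proof -
    have "2 * (a / c) + 2 * (b / c) = 2 * ((b + a) / c)" for a b c :: real
      by (simp add: add_divide_distrib)
    then show ?thesis .
  qed
  also have "\<dots> = 1 / U" unfolding K_sum using U by simp
  finally have ih: "integral\<^sup>L lborel h = 1 / U" .
  have "{0, sqrt 2, - sqrt 2, x_max, - x_max} \<in> null_sets lborel"
    by (intro countable_imp_null_set_lborel) auto
  then have ae: "AE x in lborel. h x = rho_t x"
  proof (rule AE_I')
    have s2: "sqrt 2 > 0" by simp
    show "{x \<in> space lborel. h x \<noteq> rho_t x} \<subseteq> {0, sqrt 2, - sqrt 2, x_max, - x_max}"
    proof
      fix x assume "x \<in> {x \<in> space lborel. h x \<noteq> rho_t x}"
      then have x: "h x \<noteq> rho_t x" by simp
      show "x \<in> {0, sqrt 2, - sqrt 2, x_max, - x_max}"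
      proof (rule ccontr)
        assume n: "x \<notin> {0, sqrt 2, - sqrt 2, x_max, - x_max}"
        have "rho x = 0" if "\<bar>x\<bar> > x_max"
          using that by (simp add: rho_outside)
        then have "rho_t x = 0" if "\<bar>x\<bar> > x_max" using that by (simp add: rho_t_def)
        moreover have "\<bar>x\<bar> > x_max \<or> (- x_max < x \<and> x < - sqrt 2) \<or> (- sqrt 2 < x \<and> x < 0) \<or>
            (0 < x \<and> x < sqrt 2) \<or> (sqrt 2 < x \<and> x < x_max)"
          using n x_max_gt s2 unfolding insert_iff empty_iff abs_if by (auto split: if_splits)
        ultimately have "h x = rho_t x"
          using x_max_gt s2 unfolding h_def
          by (elim disjE) (simp_all add: indicator_def, (insert s2, elim conjE, intro impI,
            linarith)+)
        then show False using x by simp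
      qed
    qed
  qed
  have rho_t_m: "rho_t \<in> borel_measurable lborel" unfolding rho_t_def[abs_def] by measurable
  show "integrable lborel rho_t"
    by (rule integrable_cong_AE_imp[OF h rho_t_m]) (use ae in auto)
  show "integral\<^sup>L lborel rho_t = 1 / U"
    using integral_cong_AE[of h lborel rho_t] h ae rho_t_m ih by auto
qed

end

subsection \<open>Moments and determinacy\<close>

text \<open>Once the lower coefficients vanish, division by \<open>x ^ n\<close> leaves a series
  with constant term \<open>a n\<close> that sums to 0 off the origin; its limit at 0 is
  \<open>a n\<close>.\<close>

lemma powser_unique:
  fixes a :: "nat \<Rightarrow> real"
  assumes s: "s > 0" and z: "\<And>x. \<bar>x\<bar> < s \<Longrightarrow> (\<lambda>n. a n * x ^ n) sums 0"
  shows "a n = 0"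
proof (induction n rule: less_induct)
  case (less n)
  have "(\<lambda>k. a (k + n) * x ^ k) sums 0" if x: "x \<noteq> 0" "norm x < s" for x
  proof -
    have "(\<lambda>k. a (k + n) * x ^ (k + n)) sums (0 - (\<Sum>i<n. a i * x ^ i))"
      using z[of x] x by (intro sums_split_initial_segment) auto
    then have "(\<lambda>k. a (k + n) * x ^ (k + n)) sums 0" by (simp add: less)
    then have "(\<lambda>k. a (k + n) * x ^ (k + n) / x ^ n) sums (0 / x ^ n)" by (rule sums_divide)
    then show ?thesis using x by (simp add: power_add)
  qed
  then have "((\<lambda>_. 0) \<longlongrightarrow> a (0 + n)) (at (0::real))"
    by (intro powser_limit_0_strong[OF s]) auto
  then show ?case by (metis LIM_const_eq add_0)
qed

lemma kernel_of_small:
  assumes "\<bar>t\<bar> \<le> 1 / 8"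
  obtains U where "kernel (1 - 2 * t) U" "(\<lambda>n. vP n 1 * t ^ n) sums (1 / U)"
proof -
  obtain U where U: "U > 0" "1 - 2 * t = exp (2 * T_prim U)" "(\<lambda>n. vP n 1 * t ^ n) sums (1 / U)"
    using vP_series[OF assms] .
  have "(1 - 2 * t) * exp T2_0 > 1"
  proof -
    \<comment> \<open>The threshold 4/3 balances \<open>1 - 2 * t >= 3/4\<close>.\<close>
    have "exp T2_0 > 4 / 3"
    proof -
      have "2 + gamma0 \<le> 4" using x_max_sq_le by (simp add: x_max_sq)
      then have "2 / (1 - exp (- T2_0)) \<le> 4" unfolding two_plus_gamma0 .
      then have "exp (- T2_0) \<le> 1 / 2" using exp_T2_0 by (simp add: field_simps)
      then have "2 \<le> exp T2_0" by (simp add: exp_minus field_simps)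
      then show ?thesis by linarith
    qed
    moreover have "1 - 2 * t \<ge> 3 / 4" using assms by linarith
    ultimately have "(1 - 2 * t) * exp T2_0 > 3 / 4 * (4 / 3)" by (intro mult_le_less_imp_less) auto
    then show ?thesis by simp
  qed
  then have "kernel (1 - 2 * t) U" using U by unfold_locales auto
  then show ?thesis using that U(3) by blast
qed

lemma rho_t_eq: "kernel.rho_t (1 - 2 * t) x = rho x / (1 - t * x\<^sup>2)" if "kernel (1 - 2 * t) U"
  using kernel.rho_t_def[OF that] kernel.t_par_def[OF that] by simp

lemma rho_integrable: "integrable lborel rho"
proof -
  \<comment> \<open>At \<open>t = 0\<close> the weight \<open>1 / (1 - t * x^2)\<close> is
    1.\<close>
  obtain U where k: "kernel (1 - 2 * 0) U" using kernel_of_small[of 0] by auto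
  have "kernel.rho_t (1 - 2 * 0) = rho"
    by (rule ext) (simp only: rho_t_eq[OF k], simp)
  then show ?thesis using kernel.rho_t_integral(1)[OF k] by (simp only:)
qed

lemma pow_rho_bound: "\<bar>x ^ n * rho x\<bar> \<le> x_max ^ n * rho x"
proof (cases "\<bar>x\<bar> < x_max")
  case True
  then have "\<bar>x\<bar> ^ n \<le> x_max ^ n" by (intro power_mono) auto
  then show ?thesis using rho_nonneg'[of x] by (simp add: abs_mult power_abs mult_right_mono)
qed (simp add: rho_outside)

lemma pow_rho_integrable: "integrable lborel (\<lambda>x. x ^ n * rho x)"
proof (rule Bochner_Integration.integrable_bound)
  show "integrable lborel (\<lambda>x. x_max ^ n * rho x)" using rho_integrable by simp
  show "AE x in lborel. norm (x ^ n * rho x) \<le> norm (x_max ^ n * rho x)"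
    using pow_rho_bound[of _ n] rho_nonneg' x_max_pos by (auto simp: abs_mult intro!: AE_I2)
qed measurable

definition rho_mom :: "nat \<Rightarrow> real" where "rho_mom n = (\<integral>x. x ^ n * rho x \<partial>lborel)"

lemma rho_mom_abs: "(\<integral>x. \<bar>x ^ n * rho x\<bar> \<partial>lborel) \<le> x_max ^ n * (\<integral>x. rho x \<partial>lborel)"
proof -
  have "(\<integral>x. \<bar>x ^ n * rho x\<bar> \<partial>lborel) \<le> (\<integral>x. x_max ^ n * rho x \<partial>lborel)"
    using pow_rho_integrable[of n] rho_integrable pow_rho_bound by (intro integral_mono) auto
  then show ?thesis by simp
qed

lemma rho_mom_odd: "odd n \<Longrightarrow> rho_mom n = 0"
proof -
  assume "odd n"
  then have "rho_mom n = - rho_mom n"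
    using lborel_integral_real_affine[of "- 1" "\<lambda>x. x ^ n * rho x" 0]
      by (simp add: rho_mom_def rho_even)
  then show ?thesis by simp
qed

text \<open>The weight \<open>1 / (1 - t * x^2)\<close> is expanded as a geometric series. Its ratio
  is at most 1/2 in absolute value on the support, so the terms are dominated by
  \<open>(1 / 2) ^ n * rho x\<close> and the sum can be taken out of the integral.\<close>

lemma rho_mom_series:
  assumes t: "\<bar>t\<bar> \<le> 1 / 8" and k: "kernel (1 - 2 * t) U"
  shows "(\<lambda>n. rho_mom (2 * n) * t ^ n) sums (1 / U)"
proof -
  define f where "f n x = t ^ n * (x ^ (2 * n) * rho x)" for n x
  have tx: "\<bar>t * x\<^sup>2\<bar> \<le> 1 / 2" if "\<bar>x\<bar> \<le> x_max" for x
  proof -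
    have "x\<^sup>2 \<le> x_max\<^sup>2" using that x_max_pos by (simp add: abs_le_square_iff[symmetric])
    then have "\<bar>t\<bar> * x\<^sup>2 \<le> 1 / 8 * 4" using t x_max_sq_le by (intro mult_mono) auto
    then show ?thesis by (simp add: abs_mult)
  qed
  have zero: "rho x = 0" if "\<not> \<bar>x\<bar> \<le> x_max" for x using that by (simp add: rho_outside)
  have fe: "f n x = (t * x\<^sup>2) ^ n * rho x" for n x
    by (simp add: f_def power_mult_distrib power_mult)
  have sums_f: "(\<lambda>n. f n x) sums (rho x / (1 - t * x\<^sup>2))" for x
  proof (cases "\<bar>x\<bar> \<le> x_max")
    case True
    then have "norm (t * x\<^sup>2) < 1" using tx[OF True] by simp
    from sums_mult2[OF geometric_sums[OF this], of "rho x"] show ?thesis by (simp add: fe)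
  qed (simp add: fe zero)
  have summ_f: "summable (\<lambda>n. norm (f n x))" for x
  proof (cases "\<bar>x\<bar> \<le> x_max")
    case True
    have "norm (t * x\<^sup>2) < 1" using tx[OF True] by simp
    then have "summable (\<lambda>n. norm (t * x\<^sup>2) ^ n * \<bar>rho x\<bar>)"
      by (intro summable_mult2 summable_geometric) auto
    then show ?thesis by (simp add: fe norm_mult norm_power power_abs abs_mult)
  qed (simp add: fe zero)
  have int_f: "integrable lborel (f n)" for n
    unfolding f_def using pow_rho_integrable by (intro integrable_mult_right) auto
  have summ_int: "summable (\<lambda>n. \<integral>x. norm (f n x) \<partial>lborel)"
  proof (rule summable_comparison_test')
    show "summable (\<lambda>n. (1 / 2) ^ n * (\<integral>x. rho x \<partial>lborel))" by (intro summable_mult2) simp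
    fix n
    have "(\<integral>x. norm (f n x) \<partial>lborel) \<le> (\<integral>x. (1 / 2) ^ n * rho x \<partial>lborel)"
    proof (rule integral_mono)
      show "norm (f n x) \<le> (1 / 2) ^ n * rho x" for x
      proof (cases "\<bar>x\<bar> \<le> x_max")
        case True
        have "\<bar>t * x\<^sup>2\<bar> ^ n \<le> (1 / 2) ^ n" using tx[OF True] by (intro power_mono) auto
        then show ?thesis using rho_nonneg'[of x]
          by (simp add: fe abs_mult power_abs mult_right_mono)
      qed (simp add: fe zero)
    qed (use int_f rho_integrable in auto)
    then show "norm (\<integral>x. norm (f n x) \<partial>lborel) \<le> (1 / 2) ^ n * (\<integral>x. rho x \<partial>lborel)" by simp
  qed
  have "(\<lambda>n. integral\<^sup>L lborel (f n)) sums (\<integral>x. (\<Sum>n. f n x) \<partial>lborel)"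
    using int_f summ_f summ_int by (intro sums_integral) auto
  moreover have "(\<Sum>n. f n x) = kernel.rho_t (1 - 2 * t) x" for x
    using sums_unique[OF sums_f[of x]] by (simp add: rho_t_eq[OF k])
  moreover have "integral\<^sup>L lborel (f n) = rho_mom (2 * n) * t ^ n" for n
    by (simp add: f_def[abs_def] rho_mom_def)
  ultimately show ?thesis using kernel.rho_t_integral(2)[OF k] by simp
qed

lemma rho_mom_even: "rho_mom (2 * n) = vP n 1"
proof -
  have "rho_mom (2 * n) - vP n 1 = 0"
  proof (rule powser_unique[of "1 / 8" "\<lambda>n. rho_mom (2 * n) - vP n 1"])
    fix t :: real assume "\<bar>t\<bar> < 1 / 8"
    then have t: "\<bar>t\<bar> \<le> 1 / 8" by simp
    then obtain U where U: "kernel (1 - 2 * t) U" "(\<lambda>n. vP n 1 * t ^ n) sums (1 / U)"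
      by (rule kernel_of_small)
    from sums_diff[OF rho_mom_series[OF t U(1)] U(2)]
    show "(\<lambda>n. (rho_mom (2 * n) - vP n 1) * t ^ n) sums 0" by (simp add: left_diff_distrib)
  qed simp
  then show ?thesis by simp
qed

lemma rho_mom_eq: "rho_mom n = v_moment n"
  using rho_mom_even[of "n div 2"] rho_mom_odd[of n] by (auto simp: v_moment_def)

section \<open>The measure with density rho and its uniqueness\<close>

abbreviation (input) rho_measure :: "real measure" where
  "rho_measure \<equiv> density lborel (\<lambda>x. ennreal (rho x))"

lemma rho_measure_moments:
  "integrable rho_measure (\<lambda>x. x ^ n)" "(\<integral>x. x ^ n \<partial>rho_measure) = v_moment n"
proof -
  have quot_deriv: "AE x in lborel. 0 \<le> rho x" using rho_nonneg' by auto
  show "integrable rho_measure (\<lambda>x. x ^ n)"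
    using pow_rho_integrable[of n] quot_deriv
      by (subst integrable_density) (auto simp: mult.commute)
  show "(\<integral>x. x ^ n \<partial>rho_measure) = v_moment n"
    using quot_deriv rho_mom_eq[of n]
      by (subst integral_density) (auto simp: rho_mom_def mult.commute[of "rho _"])
qed

lemma emeasure_rho_measure: "emeasure rho_measure UNIV = 1"
proof -
  have "emeasure rho_measure UNIV = (\<integral>\<^sup>+x. ennreal (rho x) \<partial>lborel)"
    by (subst emeasure_density) auto
  also have "\<dots> = ennreal (\<integral>x. rho x \<partial>lborel)"
    by (rule nn_integral_eq_integral[OF rho_integrable]) (use rho_nonneg' in auto)
  also have "(\<integral>x. rho x \<partial>lborel) = 1" using rho_mom_eq[of 0] by (simp add: rho_mom_def v_moment_def)
  finally show ?thesis by simp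
qed

lemma real_distribution_rho: "real_distribution rho_measure"
  by (intro real_distribution.intro real_distribution_axioms.intro prob_spaceI)
    (auto simp: emeasure_rho_measure)

text \<open>The Taylor sums of both characteristic functions coincide, as they involve only moments.
  Orders are even, so that the absolute moment in the error term is an ordinary moment; its
  geometric growth loses against the factorial. The bound on \<open>M\<close> serves
  \<open>N\<close> as well through the equality of moments.\<close>

lemma moment_determinate:
  fixes M N :: "real measure"
  assumes M: "real_distribution M" "\<And>n. integrable M (\<lambda>x. x ^ n)"
    and N: "real_distribution N" "\<And>n. integrable N (\<lambda>x. x ^ n)"
    and eq: "\<And>n. (\<integral>x. x ^ n \<partial>M) = (\<integral>x. x ^ n \<partial>N)"
    and bound: "\<And>n. (\<integral>x. x ^ (2 * n) \<partial>M) \<le> B ^ (2 * n)"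
  shows "M = N"
proof (rule Levy_uniqueness[OF M(1) N(1)])
  show "char M = char N"
  proof
    fix t :: real
    define S where "S n = (\<Sum>k\<le>2 * n. ((\<i> * t) ^ k / fact k) * complex_of_real (\<integral>x. x ^ k \<partial>M))" for n
    define e where "e n = 2 * (\<bar>t\<bar> * \<bar>B\<bar>) ^ (2 * n) / fact (2 * n)" for n
    have abs: "\<bar>x :: real\<bar> ^ (2 * n) = x ^ (2 * n)" for x n by (simp add: power_mult)
    have e: "(2 * \<bar>t\<bar> ^ (2 * n) / fact (2 * n)) * (\<integral>x. x ^ (2 * n) \<partial>M) \<le> e n" for n
    proof -
      have "(2 * \<bar>t\<bar> ^ (2 * n) / fact (2 * n)) * (\<integral>x. x ^ (2 * n) \<partial>M) \<le> (2 * \<bar>t\<bar> ^ (2 * n) / fact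
        (2 * n)) * B ^ (2 * n)"
        by (intro mult_left_mono bound) auto
      also have "\<dots> = e n" by (simp add: e_def power_mult_distrib abs)
      finally show ?thesis .
    qed
    have b: "cmod (char M t - S n) \<le> e n" "cmod (char N t - S n) \<le> e n" for n
    proof -
      show "cmod (char M t - S n) \<le> e n"
        using real_distribution.char_approx1[OF M(1), of "2 * n" t] M(2) e[of n]
          by (simp add: S_def abs)
      show "cmod (char N t - S n) \<le> e n"
        using real_distribution.char_approx1[OF N(1), of "2 * n" t] N(2) e[of n]
          by (simp add: S_def abs eq)
    qed
    have "(\<lambda>n. (\<bar>t\<bar> * \<bar>B\<bar>) ^ n / fact n) \<longlonglongrightarrow> 0" 
      using summable_LIMSEQ_zero[OF summable_exp[of "\<bar>t\<bar> * \<bar>B\<bar>"]] by (simp add: field_simps)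
    from LIMSEQ_subseq_LIMSEQ[OF this, of "\<lambda>n. 2 * n"]
    have "(\<lambda>n. (\<bar>t\<bar> * \<bar>B\<bar>) ^ (2 * n) / fact (2 * n)) \<longlonglongrightarrow> 0" by (simp add: o_def strict_mono_def)
    from tendsto_mult[OF tendsto_const this, of 2] have "e \<longlonglongrightarrow> 0" by (simp add: e_def[abs_def])
    moreover have "cmod (char M t - char N t) \<le> e n + e n" for n
      using b[of n] norm_triangle_ineq4[of "char M t - S n" "char N t - S n"] by simp
    ultimately have "cmod (char M t - char N t) \<le> 0 + 0"
      by (intro LIMSEQ_le_const[OF tendsto_add]) auto
    then show "char M t = char N t" by simp
  qed
qed

lemma standard_eq_rho_measure:
  assumes "standard_V_monotone_gaussian \<mu>"
  shows "\<mu> = rho_measure"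
proof (rule moment_determinate[symmetric, where B = x_max])
  show "real_distribution rho_measure" by (rule real_distribution_rho)
  show "real_distribution \<mu>"
    using assms by (intro real_distribution.intro real_distribution_axioms.intro)
      (auto simp: standard_V_monotone_gaussian_def)
  show "integrable \<mu> (\<lambda>x. x ^ n)" for n using assms by (simp add: standard_V_monotone_gaussian_def)
  show "(\<integral>x. x ^ n \<partial>rho_measure) = (\<integral>x. x ^ n \<partial>\<mu>)" for n
    using assms by (simp add: rho_measure_moments standard_V_monotone_gaussian_def)
  show "(\<integral>x. x ^ (2 * n) \<partial>rho_measure) \<le> x_max ^ (2 * n)" for n
  proof -
    have "rho_mom (2 * n) \<le> (\<integral>x. \<bar>x ^ (2 * n) * rho x\<bar> \<partial>lborel)"
      unfolding rho_mom_def using pow_rho_integrable[of "2 * n"] by (intro integral_mono) auto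
    also have "\<dots> \<le> x_max ^ (2 * n) * rho_mom 0" using rho_mom_abs[of "2 * n"]
      by (simp add: rho_mom_def)
    also have "rho_mom 0 = 1" by (simp add: rho_mom_eq v_moment_def)
    finally show ?thesis by (simp add: rho_measure_moments rho_mom_eq)
  qed
qed (rule rho_measure_moments)

lemma emeasure_lborel_open_ne_0:
  fixes U :: "real set"
  assumes "open U" "U \<noteq> {}"
  shows "emeasure lborel U \<noteq> 0"
proof -
  obtain y e where "e > 0" "ball y e \<subseteq> U" using assms by (meson all_not_in_conv openE)
  then have "{y - e<..<y + e} \<subseteq> U" by (simp add: ball_eq_greaterThanLessThan)
  then have "emeasure lborel {y - e<..<y + e} \<le> emeasure lborel U"
    using assms by (intro emeasure_mono) auto
  then show ?thesis using \<open>e > 0\<close> by (auto simp: ennreal_eq_0_iff)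
qed

text \<open>The density is positive on the open interval, so an open null set would meet that
  interval in a Lebesgue null set. The end points belong to the support because they are limits of
  the interval.\<close>

lemma support_rho_measure: "measure_support rho_measure = {- x_max..x_max}"
proof -
  have open_sets: "U \<in> sets lborel" if "open U" for U :: "real set" using that by simp
  have pos: "emeasure rho_measure U > 0" if U: "open U" "x \<in> U" and x: "\<bar>x\<bar> \<le> x_max" for U x
  proof -
    have "U \<inter> {- x_max<..<x_max} \<noteq> {}"
    proof -
      have "x \<in> closure {- x_max<..<x_max}" using x x_max_pos
        by (simp add: closure_greaterThanLessThan abs_le_iff)
      then show ?thesis using U open_Int_closure_eq_empty[of U "{- x_max<..<x_max}"] by auto
    qed
    then have ne: "emeasure lborel (U \<inter> {- x_max<..<x_max}) \<noteq> 0"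
      using U(1) by (intro emeasure_lborel_open_ne_0) auto
    have "emeasure rho_measure U \<noteq> 0"
    proof
      assume "emeasure rho_measure U = 0"
      then have "U \<in> null_sets rho_measure" using U(1) by (simp add: null_sets_def)
      then have "AE x in lborel. x \<in> U \<longrightarrow> rho x = 0"
        using rho_nonneg' by (subst (asm) null_sets_density_iff) (auto simp: ennreal_eq_0_iff
          order_antisym)
      then have "AE x in lborel. x \<notin> U \<inter> {- x_max<..<x_max}"
      proof eventually_elim
        case (elim y)
        then show ?case using rho_pos[of y] by (auto simp: abs_less_iff)
      qed
      then have "U \<inter> {- x_max<..<x_max} \<in> null_sets lborel"
        using U(1) by (subst AE_iff_null_sets) auto
      then show False using ne by (simp add: null_sets_def)
    qed
    then show ?thesis by (simp add: zero_less_iff_neq_zero)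
  qed
  have out: "\<exists>U. open U \<and> x \<in> U \<and> emeasure rho_measure U = 0" if x: "\<bar>x\<bar> > x_max" for x
  proof (intro exI conjI)
    show "open (- {- x_max..x_max})" by (intro open_Compl closed_atLeastAtMost)
    show "x \<in> - {- x_max..x_max}" using x by (auto simp: abs_if split: if_splits)
    have "rho y = 0" if "y \<notin> {- x_max..x_max}" for y
      using that by (intro rho_outside) auto
    then have "- {- x_max..x_max} \<in> null_sets rho_measure"
      by (subst null_sets_density_iff) auto
    then show "emeasure rho_measure (- {- x_max..x_max}) = 0" by (simp add: null_sets_def)
  qed
  show ?thesis
  proof (intro equalityI subsetI)
    fix x assume "x \<in> measure_support rho_measure"
    then have "\<not> \<bar>x\<bar> > x_max" using out[of x] unfolding measure_support_def by force
    then show "x \<in> {- x_max..x_max}" by (auto simp: abs_le_iff not_less)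
  next
    fix x assume "x \<in> {- x_max..x_max}"
    then show "x \<in> measure_support rho_measure"
      using pos[of _ x] unfolding measure_support_def by (auto simp: abs_le_iff)
  qed
qed

theorem theorem5p2:
  fixes \<mu> :: "real measure"
  assumes "standard_V_monotone_gaussian \<mu>"
  shows "measure_support \<mu> = {- sqrt (2 + gamma0) .. sqrt (2 + gamma0)}
    \<and> absolutely_continuous lborel \<mu>
    \<and> rho \<in> borel_measurable borel
    \<and> (\<forall>x. rho x \<ge> 0)
    \<and> \<mu> = density lborel (\<lambda>x. ennreal (rho x))"
proof -
  have \<mu>: "\<mu> = rho_measure" using assms by (rule standard_eq_rho_measure)
  have "absolutely_continuous lborel rho_measure"
    by (rule absolutely_continuousI_density) measurable
  then show ?thesis
    using support_rho_measure rho_measurable rho_nonneg' \<mu> by (simp add: x_max_def)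
qed

end
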